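(* The triple $(E,(l_k)_{k\ge1},\rho)$ described in the context defines a Lie $3$-algebroid over $\mathbb{O}^2$. It is a universal Lie $3$-algebroid of the singular octonionic Hopf foliation $\mathcal{F}_{OH}$, whose linear part is a geometric resolution minimal at the origin.
   Context: $\mathbb{O}\cong\mathbb{R}^8$ denotes the octonions: the real unital non-associative algebra with orthonormal basis $e_0=1,e_1,\dots,e_7$ and $e_i\cdot e_j=-\delta_{ij}1+\sum_k\epsilon_{ijk}e_k$ for $1\le i,j\le 7$, where $\epsilon_{ijk}$ is completely antisymmetric, equal to $1$ for $ijk\in\{123,145,176,246,257,347,365\}$, and $0$ for all triples that are not permutations of these; $\langle\cdot,\cdot\rangle$, $\|\cdot\|$ are the Euclidean inner product and norm and $\overline{a}=2\langle a,1\rangle 1-a$ is conjugation. $(x,y)$ denotes the point of the smooth manifold $\mathbb{O}^2\cong\mathbb{R}^{16}$; $\underline{V}$ is the trivial bundle over $\mathbb{O}^2$ with fiber $V$; $T\mathbb{O}^2\cong\underline{\mathbb{O}^2}$. The data. $E=E_0\oplus E_{-1}\oplus E_{-2}$ with $E_0=\underline{\mathbb{O}^2}$, $E_{-1}=\underline{\mathbb{R}\oplus\mathbb{O}\oplus\mathbb{R}}$, $E_{-2}=\underline{\mathbb{R}}$. Anchor $\rho:E_0\to T\mathbb{O}^2$ and $1$-bracket $l_1$ (with $l_1|_{E_{-i}}=\mathrm{d}^{(i)}:E_{-i}\to E_{-i+1}$): $$\rho\begin{pmatrix}u \\ v\end{pmatrix}=\begin{pmatrix}\|x\|^2u+(x\cdot\overline{y})\cdot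 v-(\langle x,u\rangle+\langle y,v\rangle)x \\ \|y\|^2v+(y\cdot\overline{x})\cdot u-(\langle x,u\rangle+\langle y,v\rangle)y\end{pmatrix},$$ $$\mathrm{d}^{(1)}\begin{pmatrix}\mu \\ a \\ \nu\end{pmatrix}=\begin{pmatrix}\mu x+a\cdot y \\ \nu y+\overline{a}\cdot x\end{pmatrix},\qquad \mathrm{d}^{(2)}(t)=\begin{pmatrix}-\|y\|^2t \\ (x\cdot\overline{y})t \\ -\|x\|^2t\end{pmatrix}.$$ The $2$-bracket $l_2=[\cdot,\cdot]$ is the graded skew-symmetric bracket of degree $0$ given on constant sections by $$\left[\begin{pmatrix}u \\ v\end{pmatrix},\begin{pmatrix}u' \\ v'\end{pmatrix}\right]=(\langle x,u\rangle+\langle y,v\rangle)\begin{pmatrix}u' \\ v'\end{pmatrix}-(\langle x,u'\rangle+\langle y,v'\rangle)\begin{pmatrix}u \\ v\end{pmatrix},$$ $$\left[\begin{pmatrix}u \\ v\end{pmatrix},\begin{pmatrix}\mu \\ a \\ \nu\end{pmatrix}\right]=\begin{pmatrix}-2\langle y,\overline{a}\cdot u\rangle+2\langle y,v\rangle\mu \\ x\cdot(\overline{u}\cdot a)+(a\cdot v)\cdot\overline{y}-\mu(x\cdot\overline{v})-\nu(u\cdot\overline{y}) \\ -2\langle x,a\cdot v\rangle+2\langle x,u\rangle\nu\end{pmatrix},$$ $$\left[\begin{pmatrix}u \\ v\end{pmatrix},t\right]=2(\langle x,u\rangle+\langle y,v\rangle)t,\qquad \left[\begin{pmatrix}\mu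 \\ a \\ \nu\end{pmatrix},\begin{pmatrix}\mu' \\ a' \\ \nu'\end{pmatrix}\right]=4\langle a,a'\rangle-2\mu\nu'-2\mu'\nu,$$ extended to all sections by the Leibniz rule; all remaining $2$-brackets vanish for degree reasons, and $l_k=0$ for $k\ge3$. Lie $\infty$-algebroid over $M$: a graded vector bundle $E=\bigoplus_{i\ge0}E_{-i}$ with graded skew-symmetric multilinear maps $l_k:\wedge^k\Gamma(E)\to\Gamma(E)$ of degree $2-k$ ($k\ge1$) and a vector bundle morphism $\rho:E_0\to TM$ such that: $l_k$ is $C^\infty$-linear for $k\ne2$; $l_2$ is $C^\infty$-linear except that $l_2(e,fe')=f\,l_2(e,e')+(\rho(e)\cdot f)e'$ for $e\in\Gamma(E_0)$, $e'\in\Gamma(E)$, $f\in C^\infty$; $\rho(l_1(e))=0$ for $e\in\Gamma(E_{-1})$; and for all $n\geq 1$ and $x_1,\dots,x_n\in\Gamma(E)$ $$\sum_{i=1}^n(-1)^{i(n-i)}\sum_{\sigma\in\mathrm{Un}(i,n-i)}\epsilon(\sigma)\,l_{n-i+1}(l_i(x_{\sigma(1)},\dots,x_{\sigma(i)}),x_{\sigma(i+1)},\dots,x_{\sigma(n)})=0,$$ with $\mathrm{Un}(i,n-i)$ the $(i,n-i)$-unshuffles and $\epsilon(\sigma)$ the sign defined by $x_{\sigma(1)}\wedge\dots\wedge x_{\sigma(n)}=\epsilon(\sigma)x_1\wedge\dots\wedge x_n$ in the graded exterior algebra. It is a Lie $n$-algebroid if $E_{-i}=0$ for $i\ge n$.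 Its linear part is the complex $\cdots\to E_{-2}\xrightarrow{\mathrm{d}^{(2)}}E_{-1}\xrightarrow{\mathrm{d}^{(1)}}E_0\xrightarrow{\rho}TM$. Geometric resolution of a singular foliation $\mathcal{F}$ (viewed as a sheaf of vector fields): a complex of vector bundles $\cdots\to E_{-1}\xrightarrow{\mathrm{d}^{(1)}}E_0\xrightarrow{\rho}TM$ with $\rho(\Gamma(E_0))=\mathcal{F}$ such that for every open $U\subset M$ the sequence of sections $\cdots\to\Gamma_U(E_{-1})\to\Gamma_U(E_0)\to\mathcal{F}(U)\to0$ is exact. It is minimal at $q$ if all $\mathrm{d}^{(i)}_q:E_{-i}|_q\to E_{-i+1}|_q$ ($i\ge1$) vanish. A universal Lie $n$-algebroid of $\mathcal{F}$ is a Lie $n$-algebroid whose linear part is a geometric resolution of $\mathcal{F}$. $\mathcal{F}_{OH}$ is the singular foliation on $\mathbb{O}^2$ generated by $\rho(\Gamma(E_0))$, where $\rho:E_0=\underline{\mathbb{O}^2}\to T\mathbb{O}^2$ is the anchor $\rho\begin{pmatrix}u \\ v\end{pmatrix}=\begin{pmatrix}\|x\|^2u+(x\cdot\overline{y})\cdot v-(\langle x,u\rangle+\langle y,v\rangle)x \\ \|y\|^2v+(y\cdot\overline{x})\cdot u-(\langle x,u\rangle+\langle y,v\rangle)y\end{pmatrix}$. *)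

theory Defs
  imports "HOL-Analysis.Analysis"
begin

section \<open>Smooth functions and sections\<close>

primrec Ck_on :: "nat \<Rightarrow> 'a set \<Rightarrow> ('a::euclidean_space \<Rightarrow> 'b::real_normed_vector) \<Rightarrow> bool" where
  "Ck_on 0 U f \<longleftrightarrow> continuous_on U f"
| "Ck_on (Suc k) U f \<longleftrightarrow> (\<forall>p\<in>U. f differentiable (at p)) \<and>
     (\<forall>h. Ck_on k U (\<lambda>p. frechet_derivative f (at p) h))"

text \<open>Used for open sets \<open>U\<close> only: the derivatives above are two-sided.\<close>

definition smooth_on :: "'a set \<Rightarrow> ('a::euclidean_space \<Rightarrow> 'b::real_normed_vector) \<Rightarrow> bool" where
  "smooth_on U f \<longleftrightarrow> (\<forall>k. Ck_on k U f)"

text \<open>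
  All vector bundles considered here are trivial, over a Euclidean space \<open>'m\<close> (which is
  contractible, so that this is no restriction up to isomorphism). The bundle whose fibre is the
  subspace \<open>A\<close> of \<open>'v\<close> is represented by \<open>A\<close>, and \<open>T'm\<close> by the fibre \<open>UNIV :: 'm set\<close>.
  Sections over \<open>U\<close> are total functions; their values outside \<open>U\<close> are irrelevant.
\<close>

definition sections :: "'m::euclidean_space set \<Rightarrow> 'v::euclidean_space set \<Rightarrow> ('m \<Rightarrow> 'v) set" where
  "sections U A = {s. smooth_on U s \<and> (\<forall>p\<in>U. s p \<in> A)}"

definition bundle_morphism ::
  "'v::euclidean_space set \<Rightarrow> 'w::euclidean_space set \<Rightarrow> ('m::euclidean_space \<Rightarrow> 'v \<Rightarrow> 'w) \<Rightarrow> bool" where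
  "bundle_morphism A B \<phi> \<longleftrightarrow>
     (\<forall>p. \<forall>v\<in>A. \<phi> p v \<in> B) \<and>
     (\<forall>p. \<forall>v\<in>A. \<forall>w\<in>A. \<forall>a b. \<phi> p (a *\<^sub>R v + b *\<^sub>R w) = a *\<^sub>R \<phi> p v + b *\<^sub>R \<phi> p w) \<and>
     (\<forall>v\<in>A. smooth_on UNIV (\<lambda>p. \<phi> p v))"

text \<open>
  A graded vector bundle \<open>E = \<Oplus>\<^sub>i E\<^sub>-\<^sub>i\<close> of finite total rank: \<open>E i\<close> is the
  fibre of the component of degree \<open>-i\<close>, and the fibre \<open>'v\<close> of the total bundle is the
  direct sum of the \<open>E i\<close>.
\<close>

definition graded_fibre :: "(nat \<Rightarrow> 'v::euclidean_space set) \<Rightarrow> bool" where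
  "graded_fibre E \<longleftrightarrow> (\<forall>i. subspace (E i)) \<and>
     (\<forall>v. \<exists>!c. (\<forall>i. c i \<in> E i) \<and> finite {i. c i \<noteq> 0} \<and> v = (\<Sum>i | c i \<noteq> 0. c i))"

definition graded_part :: "(nat \<Rightarrow> 'v::euclidean_space set) \<Rightarrow> int \<Rightarrow> 'v set" where
  "graded_part E k = (if k \<le> 0 then E (nat (- k)) else {0})"


section \<open>Singular foliations\<close>

definition lie_bracket :: "('m::euclidean_space \<Rightarrow> 'm) \<Rightarrow> ('m \<Rightarrow> 'm) \<Rightarrow> 'm \<Rightarrow> 'm" where
  "lie_bracket X Y p = frechet_derivative Y (at p) (X p) - frechet_derivative X (at p) (Y p)"

text \<open>
  A singular foliation is an involutive, locally finitely generated subsheaf of \<open>C\<^sup>\<infinity>\<close>-modules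
  of the sheaf of vector fields. \<open>F U\<close> is meant for open \<open>U\<close> and is closed under
  changing a vector field outside \<open>U\<close>.
\<close>

locale singular_foliation =
  fixes F :: "'m::euclidean_space set \<Rightarrow> ('m \<Rightarrow> 'm) set"
  assumes vector_fields: "\<lbrakk>open U; X \<in> F U\<rbrakk> \<Longrightarrow> smooth_on U X"
    and cong: "\<lbrakk>open U; X \<in> F U; \<And>p. p \<in> U \<Longrightarrow> Y p = X p\<rbrakk> \<Longrightarrow> Y \<in> F U"
    and restrict: "\<lbrakk>open U; open W; W \<subseteq> U; X \<in> F U\<rbrakk> \<Longrightarrow> X \<in> F W"
    and glue: "\<lbrakk>open U; \<And>p. p \<in> U \<Longrightarrow> \<exists>W. open W \<and> p \<in> W \<and> W \<subseteq> U \<and> X \<in> F W\<rbrakk> \<Longrightarrow> X \<in> F U"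
    and zero: "open U \<Longrightarrow> (\<lambda>_. 0) \<in> F U"
    and add: "\<lbrakk>open U; X \<in> F U; Y \<in> F U\<rbrakk> \<Longrightarrow> (\<lambda>p. X p + Y p) \<in> F U"
    and scale: "\<lbrakk>open U; X \<in> F U; smooth_on U f\<rbrakk> \<Longrightarrow> (\<lambda>p. f p *\<^sub>R X p) \<in> F U"
    and involutive: "\<lbrakk>open U; X \<in> F U; Y \<in> F U\<rbrakk> \<Longrightarrow> lie_bracket X Y \<in> F U"
    and locally_finitely_generated:
      "\<exists>W G. open W \<and> p \<in> W \<and> finite G \<and> G \<subseteq> F W \<and>
         (\<forall>U X. open U \<and> U \<subseteq> W \<and> X \<in> F U \<longrightarrow>
            (\<exists>c. (\<forall>Y\<in>G. smooth_on U (c Y)) \<and> (\<forall>q\<in>U. X q = (\<Sum>Y\<in>G. c Y q *\<^sub>R Y q))))"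

text \<open>The sheaf of vector fields that are locally in the image of the global sections of \<open>A\<close>.\<close>

definition generated_foliation ::
  "'v::euclidean_space set \<Rightarrow> ('m::euclidean_space \<Rightarrow> 'v \<Rightarrow> 'm) \<Rightarrow> 'm set \<Rightarrow> ('m \<Rightarrow> 'm) set" where
  "generated_foliation A \<rho> U = {X. \<forall>p\<in>U. \<exists>W. open W \<and> p \<in> W \<and> W \<subseteq> U \<and>
     (\<exists>e\<in>sections UNIV A. \<forall>q\<in>W. X q = \<rho> q (e q))}"


section \<open>Geometric resolutions\<close>

text \<open>\<open>d\<close> collects the maps \<open>d\<^sup>(\<^sup>i\<^sup>)\<close>, \<open>i \<ge> 1\<close>; the restriction of \<open>d p\<close> to \<open>E i\<close> is \<open>d\<^sup>(\<^sup>i\<^sup>)\<close> at \<open>p\<close>.\<close>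

locale geometric_resolution = singular_foliation F
  for E :: "nat \<Rightarrow> 'v::euclidean_space set"
    and d :: "'m::euclidean_space \<Rightarrow> 'v \<Rightarrow> 'v"
    and \<rho> :: "'m \<Rightarrow> 'v \<Rightarrow> 'm"
    and F :: "'m set \<Rightarrow> ('m \<Rightarrow> 'm) set" +
  assumes graded: "graded_fibre E"
    and d_morphism: "bundle_morphism (E (Suc i)) (E i) d"
    and \<rho>_morphism: "bundle_morphism (E 0) UNIV \<rho>"
    and d_d: "v \<in> E (Suc (Suc i)) \<Longrightarrow> d p (d p v) = 0"
    and \<rho>_d: "v \<in> E 1 \<Longrightarrow> \<rho> p (d p v) = 0"
    and exact_F: "open U \<Longrightarrow> X \<in> F U \<longleftrightarrow> (\<exists>e\<in>sections U (E 0). \<forall>p\<in>U. X p = \<rho> p (e p))"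
    and exact_0: "\<lbrakk>open U; s \<in> sections U (E 0); \<And>p. p \<in> U \<Longrightarrow> \<rho> p (s p) = 0\<rbrakk>
       \<Longrightarrow> \<exists>r\<in>sections U (E 1). \<forall>p\<in>U. s p = d p (r p)"
    and exact_Suc: "\<lbrakk>open U; s \<in> sections U (E (Suc i)); \<And>p. p \<in> U \<Longrightarrow> d p (s p) = 0\<rbrakk>
       \<Longrightarrow> \<exists>r\<in>sections U (E (Suc (Suc i))). \<forall>p\<in>U. s p = d p (r p)"

definition minimal_at ::
  "(nat \<Rightarrow> 'v::euclidean_space set) \<Rightarrow> ('m::euclidean_space \<Rightarrow> 'v \<Rightarrow> 'v) \<Rightarrow> 'm \<Rightarrow> bool" where
  "minimal_at E d q \<longleftrightarrow> (\<forall>i. \<forall>v\<in>E (Suc i). d q v = 0)"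


section \<open>Lie infinity-algebroids\<close>

text \<open>Unshuffles, as permutations of \<open>{0, \<dots>, i + j - 1}\<close>.\<close>

definition unshuffles :: "nat \<Rightarrow> nat \<Rightarrow> (nat \<Rightarrow> nat) set" where
  "unshuffles i j = {\<sigma>. \<sigma> permutes {..<i + j} \<and>
     strict_mono_on {..<i} \<sigma> \<and> strict_mono_on {i..<i + j} \<sigma>}"

text \<open>
  The sign \<open>\<epsilon>(\<sigma>)\<close> for elements of degrees \<open>-ds!0, -ds!1, \<dots>\<close>. In the graded exterior algebra
  \<open>x \<and> y = -(-1)\<^bsup>|x||y|\<^esup> y \<and> x\<close>, so every inversion of \<open>\<sigma>\<close> contributes one factor \<open>-(-1)\<^bsup>|x||y|\<^esup>\<close>.
\<close>

definition koszul_sign :: "nat list \<Rightarrow> (nat \<Rightarrow> nat) \<Rightarrow> real" where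
  "koszul_sign ds \<sigma> =
     (\<Prod>(a, b)\<in>{(a, b). a < b \<and> b < length ds \<and> \<sigma> b < \<sigma> a}. - ((-1) ^ (ds ! \<sigma> a * ds ! \<sigma> b)))"

text \<open>
  \<open>l [x\<^sub>1, \<dots>, x\<^sub>k]\<close> is \<open>l\<^sub>k(x\<^sub>1, \<dots>, x\<^sub>k)\<close>. Signs only make sense for homogeneous arguments; a list
  \<open>ds\<close> records that the j-th argument is a section of \<open>E (ds ! j)\<close>, i.e. of degree \<open>- ds ! j\<close>.
  Function linearity and the Leibniz rule for \<open>l\<^sub>2\<close> are stated in the second argument only;
  graded skew-symmetry transfers them to the first one.
\<close>

locale lie_infinity_algebroid =
  fixes E :: "nat \<Rightarrow> 'v::euclidean_space set"
    and l :: "('m::euclidean_space \<Rightarrow> 'v) list \<Rightarrow> 'm \<Rightarrow> 'v"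
    and \<rho> :: "'m \<Rightarrow> 'v \<Rightarrow> 'm"
  assumes graded: "graded_fibre E"
    and anchor: "bundle_morphism (E 0) UNIV \<rho>"
    and l_smooth: "\<lbrakk>xs \<noteq> []; set xs \<subseteq> sections UNIV UNIV\<rbrakk> \<Longrightarrow> l xs \<in> sections UNIV UNIV"
    and l_multilinear:
      "set xs \<union> {x, y} \<union> set ys \<subseteq> sections UNIV UNIV \<Longrightarrow>
       l (xs @ (\<lambda>p. a *\<^sub>R x p + b *\<^sub>R y p) # ys)
         = (\<lambda>p. a *\<^sub>R l (xs @ x # ys) p + b *\<^sub>R l (xs @ y # ys) p)"
    and l_degree:
      "\<lbrakk>xs \<noteq> []; length ds = length xs;
        \<And>j. j < length xs \<Longrightarrow> xs ! j \<in> sections UNIV (E (ds ! j))\<rbrakk> \<Longrightarrow>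
       l xs \<in> sections UNIV (graded_part E (2 - int (length xs) - int (sum_list ds)))"
    and l_skew:
      "\<lbrakk>set xs \<union> set ys \<subseteq> sections UNIV UNIV;
        x \<in> sections UNIV (E i); y \<in> sections UNIV (E j)\<rbrakk> \<Longrightarrow>
       l (xs @ y # x # ys) = (\<lambda>p. - ((-1) ^ (i * j)) *\<^sub>R l (xs @ x # y # ys) p)"
    and l_function_linear:
      "\<lbrakk>length xs + length ys \<noteq> 1; set xs \<union> {x} \<union> set ys \<subseteq> sections UNIV UNIV;
        smooth_on UNIV f\<rbrakk> \<Longrightarrow>
       l (xs @ (\<lambda>p. f p *\<^sub>R x p) # ys) = (\<lambda>p. f p *\<^sub>R l (xs @ x # ys) p)"
    and l2_function_linear:
      "\<lbrakk>x \<in> sections UNIV (E (Suc i)); y \<in> sections UNIV UNIV; smooth_on UNIV f\<rbrakk> \<Longrightarrow>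
       l [x, \<lambda>p. f p *\<^sub>R y p] = (\<lambda>p. f p *\<^sub>R l [x, y] p)"
    and l2_leibniz:
      "\<lbrakk>x \<in> sections UNIV (E 0); y \<in> sections UNIV UNIV; smooth_on UNIV f\<rbrakk> \<Longrightarrow>
       l [x, \<lambda>p. f p *\<^sub>R y p]
         = (\<lambda>p. f p *\<^sub>R l [x, y] p + frechet_derivative f (at p) (\<rho> p (x p)) *\<^sub>R y p)"
    and anchor_l1: "x \<in> sections UNIV (E 1) \<Longrightarrow> \<rho> p (l [x] p) = 0"
    and higher_jacobi:
      "\<lbrakk>n \<ge> 1; length xs = n; length ds = n;
        \<And>j. j < n \<Longrightarrow> xs ! j \<in> sections UNIV (E (ds ! j))\<rbrakk> \<Longrightarrow>
       (\<Sum>i = 1..n. (-1) ^ (i * (n - i)) *\<^sub>R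
          (\<Sum>\<sigma>\<in>unshuffles i (n - i). koszul_sign ds \<sigma> *\<^sub>R
             l (l (map (\<lambda>j. xs ! \<sigma> j) [0..<i]) # map (\<lambda>j. xs ! \<sigma> j) [i..<n]) p)) = 0"

locale lie_n_algebroid = lie_infinity_algebroid E l \<rho>
  for n :: nat
    and E :: "nat \<Rightarrow> 'v::euclidean_space set"
    and l :: "('m::euclidean_space \<Rightarrow> 'v) list \<Rightarrow> 'm \<Rightarrow> 'v"
    and \<rho> :: "'m \<Rightarrow> 'v \<Rightarrow> 'm" +
  assumes bounded: "i \<ge> n \<Longrightarrow> E i = {0}"

text \<open>
  The bundle maps \<open>d\<^sup>(\<^sup>i\<^sup>)\<close> underlying \<open>l\<^sub>1\<close>. As \<open>l\<^sub>1\<close> is linear over functions, evaluating it on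
  constant sections determines it.
\<close>

definition linear_part :: "(('m \<Rightarrow> 'v) list \<Rightarrow> 'm \<Rightarrow> 'v) \<Rightarrow> 'm \<Rightarrow> 'v \<Rightarrow> 'v" where
  "linear_part l p v = l [\<lambda>_. v] p"

definition universal_lie_n_algebroid ::
  "nat \<Rightarrow> (nat \<Rightarrow> 'v::euclidean_space set) \<Rightarrow> (('m::euclidean_space \<Rightarrow> 'v) list \<Rightarrow> 'm \<Rightarrow> 'v)
    \<Rightarrow> ('m \<Rightarrow> 'v \<Rightarrow> 'm) \<Rightarrow> ('m set \<Rightarrow> ('m \<Rightarrow> 'm) set) \<Rightarrow> bool" where
  "universal_lie_n_algebroid n E l \<rho> F \<longleftrightarrow>
     lie_n_algebroid n E l \<rho> \<and> geometric_resolution E (linear_part l) \<rho> F"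


section \<open>Octonions\<close>

text \<open>
  The coordinates of \<open>real ^ 8\<close> are indexed by the elements \<open>0, \<dots>, 7\<close> of the type \<open>8\<close>. The
  library multiplication and unit of \<open>real ^ 8\<close> are the componentwise ones and are not used.
\<close>

type_synonym oct = "real ^ 8"

abbreviation oct_basis :: "8 \<Rightarrow> oct" where
  "oct_basis i \<equiv> axis i 1"

definition oct_triples :: "(8 \<times> 8 \<times> 8) set" where
  "oct_triples = {(1,2,3), (1,4,5), (1,7,6), (2,4,6), (2,5,7), (3,4,7), (3,6,5)}"

definition oct_eps :: "8 \<Rightarrow> 8 \<Rightarrow> 8 \<Rightarrow> real" where
  "oct_eps i j k =
     (if (i,j,k) \<in> oct_triples \<or> (j,k,i) \<in> oct_triples \<or> (k,i,j) \<in> oct_triples then 1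
      else if (j,i,k) \<in> oct_triples \<or> (i,k,j) \<in> oct_triples \<or> (k,j,i) \<in> oct_triples then -1
      else 0)"

definition oct_basis_mult :: "8 \<Rightarrow> 8 \<Rightarrow> oct" where
  "oct_basis_mult i j =
     (if i = 0 then oct_basis j
      else if j = 0 then oct_basis i
      else (if i = j then - oct_basis 0 else 0) + (\<Sum>k\<in>UNIV - {0}. oct_eps i j k *\<^sub>R oct_basis k))"

definition oct_mult :: "oct \<Rightarrow> oct \<Rightarrow> oct" (infixl "\<odot>" 70) where
  "a \<odot> b = (\<Sum>i\<in>UNIV. \<Sum>j\<in>UNIV. (a $ i * b $ j) *\<^sub>R oct_basis_mult i j)"

definition oct_cnj :: "oct \<Rightarrow> oct" where
  "oct_cnj a = (2 * (a \<bullet> oct_basis 0)) *\<^sub>R oct_basis 0 - a"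


section \<open>The data of the octonionic Hopf foliation\<close>

type_synonym oct2 = "oct \<times> oct"

type_synonym OH_fibre = "oct2 \<times> (real \<times> oct \<times> real) \<times> real"

definition OH_E :: "nat \<Rightarrow> OH_fibre set" where
  "OH_E i =
     (if i = 0 then {(w, 0, 0) | w. True}
      else if i = 1 then {(0, e, 0) | e. True}
      else if i = 2 then {(0, 0, t) | t. True}
      else {0})"

text \<open>The inner product of \<open>oct2\<close> satisfies \<open>(x, y) \<bullet> (u, v) = x \<bullet> u + y \<bullet> v\<close>.\<close>

fun OH_rho0 :: "oct2 \<Rightarrow> oct2 \<Rightarrow> oct2" where
  "OH_rho0 (x, y) (u, v) =
     ((norm x)\<^sup>2 *\<^sub>R u + (x \<odot> oct_cnj y) \<odot> v - (x \<bullet> u + y \<bullet> v) *\<^sub>R x,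
      (norm y)\<^sup>2 *\<^sub>R v + (y \<odot> oct_cnj x) \<odot> u - (x \<bullet> u + y \<bullet> v) *\<^sub>R y)"

definition OH_rho :: "oct2 \<Rightarrow> OH_fibre \<Rightarrow> oct2" where
  "OH_rho p s = OH_rho0 p (fst s)"

fun OH_d1 :: "oct2 \<Rightarrow> real \<times> oct \<times> real \<Rightarrow> oct2" where
  "OH_d1 (x, y) (\<mu>, a, \<nu>) = (\<mu> *\<^sub>R x + a \<odot> y, \<nu> *\<^sub>R y + oct_cnj a \<odot> x)"

fun OH_d2 :: "oct2 \<Rightarrow> real \<Rightarrow> real \<times> oct \<times> real" where
  "OH_d2 (x, y) t = (- ((norm y)\<^sup>2 * t), t *\<^sub>R (x \<odot> oct_cnj y), - ((norm x)\<^sup>2 * t))"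

fun OH_d :: "oct2 \<Rightarrow> OH_fibre \<Rightarrow> OH_fibre" where
  "OH_d p (w, e, t) = (OH_d1 p e, OH_d2 p t, 0)"

fun OH_br00 :: "oct2 \<Rightarrow> oct2 \<Rightarrow> oct2 \<Rightarrow> oct2" where
  "OH_br00 (x, y) (u, v) (u', v') =
     (x \<bullet> u + y \<bullet> v) *\<^sub>R (u', v') - (x \<bullet> u' + y \<bullet> v') *\<^sub>R (u, v)"

fun OH_br01 :: "oct2 \<Rightarrow> oct2 \<Rightarrow> real \<times> oct \<times> real \<Rightarrow> real \<times> oct \<times> real" where
  "OH_br01 (x, y) (u, v) (\<mu>, a, \<nu>) =
     (- 2 * (y \<bullet> (oct_cnj a \<odot> u)) + 2 * (y \<bullet> v) * \<mu>,
      x \<odot> (oct_cnj u \<odot> a) + (a \<odot> v) \<odot> oct_cnj y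
        - \<mu> *\<^sub>R (x \<odot> oct_cnj v) - \<nu> *\<^sub>R (u \<odot> oct_cnj y),
      - 2 * (x \<bullet> (a \<odot> v)) + 2 * (x \<bullet> u) * \<nu>)"

fun OH_br02 :: "oct2 \<Rightarrow> oct2 \<Rightarrow> real \<Rightarrow> real" where
  "OH_br02 (x, y) (u, v) t = 2 * (x \<bullet> u + y \<bullet> v) * t"

fun OH_br11 :: "real \<times> oct \<times> real \<Rightarrow> real \<times> oct \<times> real \<Rightarrow> real" where
  "OH_br11 (\<mu>, a, \<nu>) (\<mu>', a', \<nu>') = 4 * (a \<bullet> a') - 2 * \<mu> * \<nu>' - 2 * \<mu>' * \<nu>"

text \<open>
  The bracket of two constant sections, evaluated at \<open>p\<close>. The brackets of \<open>E\<^sub>-\<^sub>1\<close> and of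
  \<open>E\<^sub>-\<^sub>2\<close> with \<open>E\<^sub>0\<close> are those of \<open>E\<^sub>0\<close> with them, with the opposite sign.
\<close>

fun OH_br_const :: "oct2 \<Rightarrow> OH_fibre \<Rightarrow> OH_fibre \<Rightarrow> OH_fibre" where
  "OH_br_const p (w, e, t) (w', e', t') =
     (OH_br00 p w w',
      OH_br01 p w e' - OH_br01 p w' e,
      OH_br02 p w t' - OH_br02 p w' t + OH_br11 e e')"

text \<open>
  The extension to all sections by the Leibniz rule: writing \<open>s = \<Sum>\<^sub>a f\<^sub>a c\<^sub>a\<close> and
  \<open>s' = \<Sum>\<^sub>b g\<^sub>b c\<^sub>b\<close> in a basis of constant homogeneous sections, the rule gives
  \<open>[s, s'] = \<Sum>\<^sub>a\<^sub>,\<^sub>b (f\<^sub>a g\<^sub>b [c\<^sub>a, c\<^sub>b] + f\<^sub>a (\<rho>(c\<^sub>a) \<cdot> g\<^sub>b) c\<^sub>b - g\<^sub>b (\<rho>(c\<^sub>b) \<cdot> f\<^sub>a) c\<^sub>a)\<close>,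
  where \<open>\<rho>\<close> is extended by zero to \<open>E\<^sub>-\<^sub>1\<close> and \<open>E\<^sub>-\<^sub>2\<close>.
\<close>

definition OH_bracket :: "(oct2 \<Rightarrow> OH_fibre) \<Rightarrow> (oct2 \<Rightarrow> OH_fibre) \<Rightarrow> oct2 \<Rightarrow> OH_fibre" where
  "OH_bracket s s' p =
     OH_br_const p (s p) (s' p)
       + frechet_derivative s' (at p) (OH_rho p (s p))
       - frechet_derivative s (at p) (OH_rho p (s' p))"

lemma OH_bracket_const: "OH_bracket (\<lambda>_. v) (\<lambda>_. v') p = OH_br_const p v v'"
  by (simp add: OH_bracket_def)

fun OH_l :: "(oct2 \<Rightarrow> OH_fibre) list \<Rightarrow> oct2 \<Rightarrow> OH_fibre" where
  "OH_l [s] = (\<lambda>p. OH_d p (s p))"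
| "OH_l [s, s'] = OH_bracket s s'"
| "OH_l _ = (\<lambda>_. 0)"

definition F_OH :: "oct2 set \<Rightarrow> (oct2 \<Rightarrow> oct2) set" where
  "F_OH = generated_foliation (OH_E 0) OH_rho"

end

theory Submission
  imports Defs
begin

text \<open>
  In terms of the Clifford action of the Hermitian octonionic \<open>2\<times>2\<close> matrices on spinors
  \<open>p = (x, y)\<close>, the structure equations reduce to one identity, that the square of a spinor
  annihilates this spinor, and to its polarisations. The linear part carries a homotopy
  contracting multiplication by \<open>\<bar>p\<bar>\<^sup>2\<close>, so it is exact wherever \<open>p \<noteq> 0\<close>. Exactness at
  \<open>E\<^sub>-\<^sub>1\<close> over the origin is the smooth division of a multiple of \<open>\<bar>y\<bar>\<^sup>2\<close> by \<open>\<bar>x\<bar>\<^sup>2\<close>. At \<open>E\<^sub>0\<close>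
  a cycle that is flat at the origin may be divided by \<open>\<bar>p\<bar>\<^sup>2\<close> first, and a general cycle is made
  flat by subtracting a boundary: its homogeneous Taylor components are polynomial cycles, these
  are boundaries because \<open>\<bar>x\<bar>\<^sup>2\<close>, \<open>\<bar>y\<bar>\<^sup>2\<close>, \<open>\<langle>x, y\<rangle>\<close> is a regular sequence of polynomials, and the
  primitives are summed by Borel's lemma.
\<close>

section \<open>Calculus of smooth functions\<close>

text \<open>At \<open>E\<^sub>0\<close> the homotopy turns exactness into a division problem: a
  cycle w satisfies |p|^2 w = d1 (h w), but in general h w is divisible by |p|^2 only after a
  boundary d2 t has been added. As h w is trace-free, say (\<mu>, a, -\<mu>), a suitable t is
  \<beta> - \<alpha> once \<mu> = \<alpha> |x|^2 + \<beta> |y|^2. This ideal membership has no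
  pointwise formula and is the reason for the detour through polynomials: there the cycle condition
  puts \<mu> <x, y> into the ideal of the two squares, and regularity removes the factor <x, y>. At
  \<open>E\<^sub>-\<^sub>1\<close> the diagonal entries already determine the quotient, so no choice
  occurs. All divisions at the origin rest on one criterion: a function on a punctured neighbourhood
  extends smoothly if each of its iterated derivatives stays bounded. The homotopy is also used
  algebraically. Off the origin an element of \<open>E\<^sub>-\<^sub>1\<close> is zero if its trace
  and its image under d1 vanish; this proves the Jacobi identity for two sections of
  \<open>E\<^sub>0\<close> and one of \<open>E\<^sub>-\<^sub>1\<close> without expanding octonionic
  products.\<close>

abbreviation dder :: "'a \<Rightarrow> ('a::real_normed_vector \<Rightarrow> 'b::real_normed_vector) \<Rightarrow> 'a \<Rightarrow> 'b" where
  "dder h f \<equiv> (\<lambda>p. frechet_derivative f (at p) h)"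

text \<open>The two functions have the same set of derivatives at p, so the choice operator returns
  the same value for both, even if neither is differentiable there.\<close>

lemma frechet_derivative_cong_open:
  assumes "open U" "p \<in> U" "\<And>q. q \<in> U \<Longrightarrow> f q = g q"
  shows "frechet_derivative f (at p) = frechet_derivative g (at p)"
proof -
  have "(f has_derivative D) (at p) \<longleftrightarrow> (g has_derivative D) (at p)" for D
    using assms has_derivative_transform_within_open[of f D p UNIV U g]
      has_derivative_transform_within_open[of g D p UNIV U f] by auto
  then show ?thesis by (simp add: frechet_derivative_def)
qed

lemma dder_eqI: "(f has_derivative D) (at p) \<Longrightarrow> dder h f p = D h"
  using frechet_derivative_at by metis

lemma differentiable_cong_open:
  assumes "open U" "p \<in> U" "\<And>q. q \<in> U \<Longrightarrow> f q = g q"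
  shows "f differentiable (at p) \<longleftrightarrow> g differentiable (at p)"
  using assms has_derivative_transform_within_open[of f _ p UNIV U g]
      has_derivative_transform_within_open[of g _ p UNIV U f]
  unfolding differentiable_def by (metis (no_types, lifting))

lemma Ck_on_cong:
  assumes "open U" "\<And>q. q \<in> U \<Longrightarrow> f q = g q"
  shows "Ck_on k U f \<longleftrightarrow> Ck_on k U g"
  using assms(2)
proof (induction k arbitrary: f g)
  case 0
  then show ?case by (auto cong: continuous_on_cong)
next
  case (Suc k)
  have "\<forall>p\<in>U. f differentiable (at p) \<longleftrightarrow> g differentiable (at p)"
    using differentiable_cong_open[OF assms(1)] Suc.prems by blast
  moreover have "Ck_on k U (dder h f) \<longleftrightarrow> Ck_on k U (dder h g)" for h
    by (rule Suc.IH) (simp add: frechet_derivative_cong_open[OF assms(1) _ Suc.prems])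
  ultimately show ?case by auto
qed

lemma Ck_on_SucD: "Ck_on (Suc k) U f \<Longrightarrow> Ck_on k U f"
proof (induction k arbitrary: f)
  case 0
  then show ?case
    by (simp add: continuous_at_imp_continuous_on differentiable_imp_continuous_within)
qed auto

text \<open>Lets an explicit derivative replace the choice-based one, so that inductions on k only
  have to recognise the explicit expression as \<open>Ck_on\<close>.\<close>

lemma Ck_on_SucI:
  assumes "open U" "\<And>p. p \<in> U \<Longrightarrow> (f has_derivative f' p) (at p)"
    and "\<And>h. Ck_on k U (\<lambda>p. f' p h)"
  shows "Ck_on (Suc k) U f"
proof -
  have "Ck_on k U (dder h f) \<longleftrightarrow> Ck_on k U (\<lambda>p. f' p h)" for h
    by (rule Ck_on_cong[OF assms(1)]) (simp add: frechet_derivative_at[OF assms(2), symmetric])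
  then show ?thesis using assms(2,3) by (auto simp: differentiable_def)
qed

lemma Ck_on_subset: "Ck_on k U f \<Longrightarrow> V \<subseteq> U \<Longrightarrow> Ck_on k V f"
  by (induction k arbitrary: f) (auto intro: continuous_on_subset)

lemma Ck_on_has_derivative:
  assumes "Ck_on (Suc k) U f" "p \<in> U"
  shows "(f has_derivative frechet_derivative f (at p)) (at p)"
  using assms frechet_derivative_works by auto

lemma Ck_on_const: "Ck_on k U (\<lambda>_. c)"
  by (induction k arbitrary: c) auto

lemma Ck_on_add:
  assumes "open U" shows "Ck_on k U f \<Longrightarrow> Ck_on k U g \<Longrightarrow> Ck_on k U (\<lambda>p. f p + g p)"
proof (induction k arbitrary: f g)
  case (Suc k)
  show ?case
    by (rule Ck_on_SucI[OF assms, where f' = "\<lambda>p h. frechet_derivative f (at p) h + frechet_derivative g (at p) h"])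
       (use Suc in \<open>auto intro!: has_derivative_add Ck_on_has_derivative\<close>)
qed (auto intro: continuous_on_add)

lemma Ck_on_bilinear:
  assumes "bounded_bilinear B" "open U"
  shows "Ck_on k U f \<Longrightarrow> Ck_on k U g \<Longrightarrow> Ck_on k U (\<lambda>p. B (f p) (g p))"
proof (induction k arbitrary: f g)
  case 0
  then show ?case using bounded_bilinear.continuous_on[OF assms(1)] by auto
next
  case (Suc k)
  show ?case
    by (rule Ck_on_SucI[OF assms(2), where f' = "\<lambda>p h. B (f p) (frechet_derivative g (at p) h)
          + B (frechet_derivative f (at p) h) (g p)"])
       (use Suc in \<open>auto intro!: bounded_bilinear.FDERIV[OF assms(1)] Ck_on_has_derivative
          Ck_on_add[OF assms(2)] Suc.IH intro: Ck_on_SucD\<close>)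
qed

lemma Ck_on_bounded_linear:
  assumes "bounded_linear L" "open U"
  shows "Ck_on k U f \<Longrightarrow> Ck_on k U (\<lambda>p. L (f p))"
proof (induction k arbitrary: f)
  case 0
  then show ?case using bounded_linear.continuous_on[OF assms(1)] by auto
next
  case (Suc k)
  show ?case
    by (rule Ck_on_SucI[OF assms(2), where f' = "\<lambda>p h. L (frechet_derivative f (at p) h)"])
       (use Suc in \<open>auto intro!: bounded_linear.has_derivative[OF assms(1)] Ck_on_has_derivative\<close>)
qed

lemma Ck_on_id: "Ck_on k U (\<lambda>p. p)"
  by (cases k) (auto simp: Ck_on_const)

lemma smooth_onD:
  assumes "smooth_on U f"
  shows "p \<in> U \<Longrightarrow> f differentiable (at p)"
    and "p \<in> U \<Longrightarrow> (f has_derivative frechet_derivative f (at p)) (at p)"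
    and "smooth_on U (dder h f)"
    and "continuous_on U f"
  using assms frechet_derivative_works[of f "at p"] unfolding smooth_on_def
  by (metis Ck_on.simps)+

lemma smooth_on_cong:
  "open U \<Longrightarrow> (\<And>q. q \<in> U \<Longrightarrow> f q = g q) \<Longrightarrow> smooth_on U f \<longleftrightarrow> smooth_on U g"
  unfolding smooth_on_def using Ck_on_cong by blast

lemma smooth_on_subset: "smooth_on U f \<Longrightarrow> V \<subseteq> U \<Longrightarrow> smooth_on V f"
  unfolding smooth_on_def using Ck_on_subset by blast

named_theorems smooth_intros

lemma smooth_on_const [smooth_intros]: "smooth_on U (\<lambda>_. c)"
  by (simp add: smooth_on_def Ck_on_const)

lemma smooth_on_id [smooth_intros]: "smooth_on U (\<lambda>p. p)"
  by (simp add: smooth_on_def Ck_on_id)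

lemma smooth_on_add [smooth_intros]:
  "open U \<Longrightarrow> smooth_on U f \<Longrightarrow> smooth_on U g \<Longrightarrow> smooth_on U (\<lambda>p. f p + g p)"
  by (simp add: smooth_on_def Ck_on_add)

lemma smooth_on_bilinear:
  "bounded_bilinear B \<Longrightarrow> open U \<Longrightarrow> smooth_on U f \<Longrightarrow> smooth_on U g \<Longrightarrow> smooth_on U (\<lambda>p. B (f p) (g p))"
  by (simp add: smooth_on_def Ck_on_bilinear)

lemma smooth_on_bounded_linear:
  "bounded_linear L \<Longrightarrow> open U \<Longrightarrow> smooth_on U f \<Longrightarrow> smooth_on U (\<lambda>p. L (f p))"
  by (simp add: smooth_on_def Ck_on_bounded_linear)

lemmas smooth_on_scaleR [smooth_intros] = smooth_on_bilinear[OF bounded_bilinear_scaleR]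
lemmas smooth_on_mult [smooth_intros] = smooth_on_bilinear[OF bounded_bilinear_mult]
lemmas smooth_on_inner [smooth_intros] = smooth_on_bilinear[OF bounded_bilinear_inner]
lemmas smooth_on_fst [smooth_intros] = smooth_on_bounded_linear[OF bounded_linear_fst]
lemmas smooth_on_snd [smooth_intros] = smooth_on_bounded_linear[OF bounded_linear_snd]
lemmas smooth_on_minus [smooth_intros] =
  smooth_on_bounded_linear[OF bounded_linear_minus[OF bounded_linear_ident]]

lemma smooth_on_diff [smooth_intros]:
  "open U \<Longrightarrow> smooth_on U f \<Longrightarrow> smooth_on U g \<Longrightarrow> smooth_on U (\<lambda>p. f p - g p)"
  using smooth_on_add[OF _ _ smooth_on_minus] by fastforce

lemma smooth_on_sum [smooth_intros]:
  "open U \<Longrightarrow> (\<And>i. i \<in> I \<Longrightarrow> smooth_on U (f i)) \<Longrightarrow> smooth_on U (\<lambda>p. \<Sum>i\<in>I. f i p)"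
  by (induction I rule: infinite_finite_induct) (auto intro!: smooth_intros)

lemma smooth_on_norm_power2 [smooth_intros]:
  "open U \<Longrightarrow> smooth_on U f \<Longrightarrow> smooth_on U (\<lambda>p. (norm (f p :: 'b::euclidean_space))\<^sup>2)"
  by (simp add: power2_norm_eq_inner smooth_on_inner)

lemma smooth_on_Pair [smooth_intros]:
  assumes "open U" "smooth_on U f" "smooth_on U g"
  shows "smooth_on U (\<lambda>p. (f p, g p))"
proof -
  have "bounded_linear (\<lambda>a. (a, 0))" "bounded_linear (\<lambda>b. (0, b))"
    by (auto intro!: bounded_linear_Pair bounded_linear_ident bounded_linear_zero)
  from smooth_on_add[OF assms(1) smooth_on_bounded_linear[OF this(1) assms(1,2)]
      smooth_on_bounded_linear[OF this(2) assms(1,3)]]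
  show ?thesis by simp
qed

lemma smooth_on_componentwise:
  fixes f :: "'a::euclidean_space \<Rightarrow> 'b::euclidean_space"
  assumes "open U" "\<And>b. b \<in> Basis \<Longrightarrow> smooth_on U (\<lambda>p. f p \<bullet> b)"
  shows "smooth_on U f"
proof -
  have "smooth_on U (\<lambda>p. \<Sum>b\<in>Basis. (f p \<bullet> b) *\<^sub>R b)"
    by (intro smooth_intros assms)
  then show ?thesis by (simp add: euclidean_representation)
qed

lemma dder_bounded_linear:
  assumes "bounded_linear L" "f differentiable (at p)"
  shows "dder h (\<lambda>q. L (f q)) p = L (dder h f p)"
  using frechet_derivative_at[OF bounded_linear.has_derivative[OF assms(1)
      assms(2)[unfolded frechet_derivative_works]]] by metis

lemma dder_sum_Basis:
  fixes f :: "'a::euclidean_space \<Rightarrow> 'b::real_normed_vector"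
  assumes "f differentiable (at p)"
  shows "dder h f p = (\<Sum>b\<in>Basis. (h \<bullet> b) *\<^sub>R dder b f p)"
proof -
  have l: "linear (frechet_derivative f (at p))" by (rule linear_frechet_derivative[OF assms])
  have "dder h f p = frechet_derivative f (at p) (\<Sum>b\<in>Basis. (h \<bullet> b) *\<^sub>R b)"
    by (simp add: euclidean_representation)
  then show ?thesis by (simp add: linear_sum[OF l] linear_scale[OF l])
qed

text \<open>Expanding the moving direction in the basis leaves finitely many derivatives in fixed
  directions, the only ones that \<open>Ck_on\<close> controls.\<close>

lemma smooth_on_dder_vary:
  fixes f :: "'a::euclidean_space \<Rightarrow> 'b::euclidean_space"
  assumes "open U" "smooth_on U f" "smooth_on U v"
  shows "smooth_on U (\<lambda>p. frechet_derivative f (at p) (v p))"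
proof -
  have "smooth_on U (\<lambda>p. \<Sum>b\<in>Basis. (v p \<bullet> b) *\<^sub>R dder b f p)"
    by (intro smooth_intros assms smooth_onD(3)[OF assms(2)])
  then show ?thesis
    by (subst smooth_on_cong[OF assms(1) dder_sum_Basis[OF smooth_onD(1)[OF assms(2)]]])
qed

section \<open>Restriction to lines and symmetry of mixed second derivatives\<close>

lemma has_vector_derivative_line:
  assumes "f differentiable (at (a + s *\<^sub>R h))"
  shows "((\<lambda>s. f (a + s *\<^sub>R h)) has_vector_derivative dder h f (a + s *\<^sub>R h)) (at s)"
proof -
  have "(f has_derivative frechet_derivative f (at (a + s *\<^sub>R h))) (at (a + s *\<^sub>R h))"
    using assms frechet_derivative_works by blast
  moreover have "((\<lambda>s. a + s *\<^sub>R h) has_derivative (\<lambda>t. t *\<^sub>R h)) (at s)"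
    by (auto intro!: derivative_eq_intros)
  ultimately have "((\<lambda>s. f (a + s *\<^sub>R h)) has_derivative
      (\<lambda>t. frechet_derivative f (at (a + s *\<^sub>R h)) (t *\<^sub>R h))) (at s)"
    using has_derivative_compose by fastforce
  then show ?thesis
    by (simp add: has_vector_derivative_def linear_frechet_derivative[OF assms] linear_scale)
qed

lemma has_real_derivative_line:
  fixes f :: "'a::real_normed_vector \<Rightarrow> real"
  assumes "f differentiable (at (a + s *\<^sub>R h))"
  shows "((\<lambda>s. f (a + s *\<^sub>R h)) has_real_derivative dder h f (a + s *\<^sub>R h)) (at s)"
  using has_vector_derivative_line[OF assms] by (simp add: has_real_derivative_iff_has_vector_derivative)

text \<open>The mean value theorem is applied in direction h to the increment of f along k, and
  again in direction k to the resulting derivative.\<close>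

lemma second_difference_mvt:
  fixes f :: "'a::euclidean_space \<Rightarrow> real"
  assumes "open U" "smooth_on U f" "t > 0"
    and U: "\<And>s s'. 0 \<le> s \<Longrightarrow> s \<le> t \<Longrightarrow> 0 \<le> s' \<Longrightarrow> s' \<le> t \<Longrightarrow> p + s *\<^sub>R h + s' *\<^sub>R k \<in> U"
  shows "\<exists>s s'. 0 < s \<and> s < t \<and> 0 < s' \<and> s' < t \<and>
    f (p + t *\<^sub>R h + t *\<^sub>R k) - f (p + t *\<^sub>R h) - f (p + t *\<^sub>R k) + f p
      = t\<^sup>2 * dder k (dder h f) (p + s *\<^sub>R h + s' *\<^sub>R k)"
proof -
  define \<phi> where "\<phi> s = f ((p + t *\<^sub>R k) + s *\<^sub>R h) - f (p + s *\<^sub>R h)" for s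
  define \<phi>' where "\<phi>' s = dder h f ((p + t *\<^sub>R k) + s *\<^sub>R h) - dder h f (p + s *\<^sub>R h)" for s
  have d: "(\<phi> has_real_derivative \<phi>' s) (at s)" if "0 \<le> s" "s \<le> t" for s
    unfolding \<phi>_def \<phi>'_def
    using U[of s t] U[of s 0] that assms(3)
    by (intro DERIV_diff has_real_derivative_line[where f = f and h = h] smooth_onD(1)[OF assms(2)])
      (simp_all add: algebra_simps)
  obtain s where s: "0 < s" "s < t" "\<phi> t - \<phi> 0 = (t - 0) * \<phi>' s"
    using MVT2[OF assms(3) d] by auto
  define \<psi> where "\<psi> s' = dder h f ((p + s *\<^sub>R h) + s' *\<^sub>R k)" for s'
  have d': "(\<psi> has_real_derivative dder k (dder h f) ((p + s *\<^sub>R h) + s' *\<^sub>R k)) (at s')"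
    if "0 \<le> s'" "s' \<le> t" for s'
    unfolding \<psi>_def
    using U[of s s'] that s
    by (intro has_real_derivative_line[where f = "dder h f"] smooth_onD(1)[OF smooth_onD(3)[OF assms(2)]]) (auto simp: algebra_simps)
  obtain s' where s': "0 < s'" "s' < t" "\<psi> t - \<psi> 0 = (t - 0) * dder k (dder h f) ((p + s *\<^sub>R h) + s' *\<^sub>R k)"
    using MVT2[OF assms(3) d'] by auto
  have "\<phi>' s = \<psi> t - \<psi> 0" by (simp add: \<phi>'_def \<psi>_def algebra_simps)
  moreover have "f (p + t *\<^sub>R h + t *\<^sub>R k) - f (p + t *\<^sub>R h) - f (p + t *\<^sub>R k) + f p = \<phi> t - \<phi> 0"
    by (simp add: \<phi>_def algebra_simps)
  ultimately have "f (p + t *\<^sub>R h + t *\<^sub>R k) - f (p + t *\<^sub>R h) - f (p + t *\<^sub>R k) + f p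
      = t\<^sup>2 * dder k (dder h f) (p + s *\<^sub>R h + s' *\<^sub>R k)"
    using s s' by (simp add: power2_eq_square)
  then show ?thesis using s s' by blast
qed

text \<open>The second difference is symmetric in h and k. By \<open>second_difference_mvt\<close>
  it is therefore t^2 times a value of either mixed derivative near p, and continuity forces the
  values at p to agree.\<close>

lemma dder_commute_real:
  fixes f :: "'a::euclidean_space \<Rightarrow> real"
  assumes U: "open U" "p \<in> U" and f: "smooth_on U f"
  shows "dder k (dder h f) p = dder h (dder k f) p"
proof (rule ccontr)
  let ?a = "dder k (dder h f)" and ?b = "dder h (dder k f)"
  assume "?a p \<noteq> ?b p"
  \<comment> \<open>Half of the supposed gap: two errors below e cannot add up to it.\<close>
  define e where "e = \<bar>?a p - ?b p\<bar> / 2"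
  have e: "e > 0" using \<open>?a p \<noteq> ?b p\<close> by (simp add: e_def)
  have "continuous (at p) ?a" "continuous (at p) ?b"
    using smooth_onD(4)[OF smooth_onD(3)[OF smooth_onD(3)[OF f]]] U
      continuous_on_eq_continuous_at by blast+
  then obtain d1 d2 where d: "d1 > 0" "d2 > 0"
    "\<And>q. dist q p < d1 \<Longrightarrow> dist (?a q) (?a p) < e" "\<And>q. dist q p < d2 \<Longrightarrow> dist (?b q) (?b p) < e"
    using e unfolding continuous_at_eps_delta by metis
  obtain d3 where d3: "d3 > 0" "ball p d3 \<subseteq> U" using U open_contains_ball by blast
  define d where "d = Min {d1, d2, d3}"
  have dp: "d > 0" "d \<le> d1" "d \<le> d2" "d \<le> d3" using d d3 by (auto simp: d_def)
  \<comment> \<open>Small enough that the whole parallelogram spanned by t h and t k stays within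
    distance d of p; the summand 1 guards against h = k = 0.\<close>
  define t where "t = d / (2 * (norm h + norm k + 1))"
  have hk: "norm h + norm k + 1 > 0" using norm_ge_zero[of h] norm_ge_zero[of k] by linarith
  have t: "t > 0" using dp(1) hk by (simp add: t_def)
  have dist: "dist (p + s *\<^sub>R h + s' *\<^sub>R k) p < d" if "0 \<le> s" "s \<le> t" "0 \<le> s'" "s' \<le> t" for s s'
  proof -
    have "dist (p + s *\<^sub>R h + s' *\<^sub>R k) p = norm (s *\<^sub>R h + s' *\<^sub>R k)"
      by (simp add: dist_norm algebra_simps)
    also have "\<dots> \<le> s * norm h + s' * norm k"
      using norm_triangle_ineq[of "s *\<^sub>R h" "s' *\<^sub>R k"] that by simp
    also have "\<dots> \<le> t * norm h + t * norm k"
      using that by (intro add_mono mult_right_mono) auto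
    also have "\<dots> < t * (norm h + norm k + 1) * 2"
      using t by (simp add: algebra_simps add_pos_nonneg add_nonneg_pos)
    also have "\<dots> = d" using hk by (simp add: t_def field_simps)
    finally show ?thesis .
  qed
  have inU: "p + s *\<^sub>R h + s' *\<^sub>R k \<in> U" if "0 \<le> s" "s \<le> t" "0 \<le> s'" "s' \<le> t" for s s'
    using dist[OF that] d3 dp(4) by (auto simp: subset_eq dist_commute)
  obtain s s' where s: "0 < s" "s < t" "0 < s'" "s' < t"
    "f (p + t *\<^sub>R h + t *\<^sub>R k) - f (p + t *\<^sub>R h) - f (p + t *\<^sub>R k) + f p = t\<^sup>2 * ?a (p + s *\<^sub>R h + s' *\<^sub>R k)"
    using second_difference_mvt[OF U(1) f t inU] by blast
  have inU': "p + s *\<^sub>R k + s' *\<^sub>R h \<in> U" if "0 \<le> s" "s \<le> t" "0 \<le> s'" "s' \<le> t" for s s'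
    using inU[OF that(3,4,1,2)] by (simp add: algebra_simps)
  obtain r r' where r: "0 < r" "r < t" "0 < r'" "r' < t"
    "f (p + t *\<^sub>R k + t *\<^sub>R h) - f (p + t *\<^sub>R k) - f (p + t *\<^sub>R h) + f p = t\<^sup>2 * ?b (p + r *\<^sub>R k + r' *\<^sub>R h)"
    using second_difference_mvt[OF U(1) f t inU'] by blast
  have "t\<^sup>2 * ?a (p + s *\<^sub>R h + s' *\<^sub>R k) = t\<^sup>2 * ?b (p + r' *\<^sub>R h + r *\<^sub>R k)"
    using s(5) r(5) by (simp add: algebra_simps)
  then have "?a (p + s *\<^sub>R h + s' *\<^sub>R k) = ?b (p + r' *\<^sub>R h + r *\<^sub>R k)" using t by simp
  moreover have "dist (?a (p + s *\<^sub>R h + s' *\<^sub>R k)) (?a p) < e"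
    using d(3) dist[of s s'] s dp by fastforce
  moreover have "dist (?b (p + r' *\<^sub>R h + r *\<^sub>R k)) (?b p) < e"
    using d(4) dist[of r' r] r dp by fastforce
  ultimately have "\<bar>?a p - ?b p\<bar> < 2 * e"
    unfolding dist_real_def by linarith
  then show False by (simp add: e_def)
qed

lemma dder_commute:
  fixes f :: "'a::euclidean_space \<Rightarrow> 'b::euclidean_space"
  assumes U: "open U" "p \<in> U" and f: "smooth_on U f"
  shows "dder k (dder h f) p = dder h (dder k f) p"
proof (rule euclidean_eqI)
  fix b :: 'b
  have inner: "dder h g q \<bullet> b = dder h (\<lambda>p. g p \<bullet> b) q" if "smooth_on U g" "q \<in> U" for g h q
    using dder_bounded_linear[OF bounded_linear_inner_left smooth_onD(1)[OF that]] by metis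
  have 2: "dder k (dder h f) p \<bullet> b = dder k (dder h (\<lambda>p. f p \<bullet> b)) p" for h k
    unfolding inner[OF smooth_onD(3)[OF f] U(2)]
    by (rule fun_cong[OF frechet_derivative_cong_open[OF U]]) (rule inner[OF f])
  show "dder k (dder h f) p \<bullet> b = dder h (dder k f) p \<bullet> b"
    unfolding 2
    by (rule dder_commute_real[OF U]) (intro smooth_intros U f)
qed

subsection \<open>Iterated directional derivatives and Taylor expansion\<close>

primrec dders :: "'a list \<Rightarrow> ('a::euclidean_space \<Rightarrow> 'b::real_normed_vector) \<Rightarrow> 'a \<Rightarrow> 'b" where
  "dders [] f = f"
| "dders (h # hs) f = dders hs (dder h f)"

lemma dders_append: "dders (hs @ hs') f = dders hs' (dders hs f)"
  by (induction hs arbitrary: f) auto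

lemma dders_replicate_Suc: "dders (replicate (Suc n) h) f = dder h (dders (replicate n h) f)"
  using dders_append[of "replicate n h" "[h]" f]
  by (simp add: replicate_append_same del: replicate_Suc) (simp add: replicate_append_same)

lemma smooth_on_dders: "smooth_on U f \<Longrightarrow> smooth_on U (dders hs f)"
  by (induction hs arbitrary: f) (auto intro: smooth_onD(3))

lemma dders_cong:
  assumes "open U" "p \<in> U" "\<And>q. q \<in> U \<Longrightarrow> f q = g q"
  shows "dders hs f p = dders hs g p"
  using assms(3)
proof (induction hs arbitrary: f g)
  case (Cons h hs)
  show ?case
    by (simp, rule Cons.IH) (simp add: frechet_derivative_cong_open[OF assms(1) _ Cons.prems])
qed (use assms in auto)

lemma dders_scaleR_sum:
  assumes "open U" "p \<in> U" "\<And>i. i \<in> I \<Longrightarrow> smooth_on U (f i)"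
  shows "dders hs (\<lambda>q. \<Sum>i\<in>I. c i *\<^sub>R f i q) p = (\<Sum>i\<in>I. c i *\<^sub>R dders hs (f i) p)"
  using assms(3)
proof (induction hs arbitrary: f)
  case (Cons h hs)
  have "dder h (\<lambda>q. \<Sum>i\<in>I. c i *\<^sub>R f i q) q = (\<Sum>i\<in>I. c i *\<^sub>R dder h (f i) q)" if "q \<in> U" for q
  proof -
    show ?thesis
      by (rule dder_eqI, intro has_derivative_sum has_derivative_scaleR_right
          smooth_onD(2)[OF Cons.prems that])
  qed
  then have "dders hs (dder h (\<lambda>q. \<Sum>i\<in>I. c i *\<^sub>R f i q)) p
      = dders hs (\<lambda>q. \<Sum>i\<in>I. c i *\<^sub>R dder h (f i) q) p"
    by (intro dders_cong[OF assms(1,2)])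
  then show ?case
    using Cons.IH[of "\<lambda>i. dder h (f i)"] smooth_onD(3)[OF Cons.prems] by simp
qed auto

lemma dders_replicate_scaleR:
  assumes "open U" "p \<in> U" "smooth_on U f"
  shows "dders (replicate j (c *\<^sub>R h)) f p = c ^ j *\<^sub>R dders (replicate j h) f p"
  using assms(3)
proof (induction j arbitrary: f)
  case (Suc j)
  have "dders (replicate j (c *\<^sub>R h)) (dder (c *\<^sub>R h) f) p
      = dders (replicate j (c *\<^sub>R h)) (\<lambda>q. \<Sum>i\<in>{()}. c *\<^sub>R dder h f q) p"
    by (rule dders_cong[OF assms(1,2)])
      (simp add: linear_scale linear_frechet_derivative smooth_onD(1)[OF Suc.prems])
  also have "\<dots> = c *\<^sub>R dders (replicate j (c *\<^sub>R h)) (dder h f) p"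
    by (subst dders_scaleR_sum[OF assms(1,2)]) (simp_all add: smooth_onD(3)[OF Suc.prems])
  finally show ?case using Suc.IH[OF smooth_onD(3)[OF Suc.prems]] by simp
qed auto

lemma dders_bounded_linear:
  assumes "bounded_linear L" "open U" "p \<in> U" "smooth_on U f"
  shows "dders hs (\<lambda>q. L (f q)) p = L (dders hs f p)"
  using assms(4)
proof (induction hs arbitrary: f)
  case (Cons h hs)
  have "dders hs (dder h (\<lambda>q. L (f q))) p = dders hs (\<lambda>q. L (dder h f q)) p"
    by (rule dders_cong[OF assms(2,3)])
      (simp add: dder_bounded_linear[OF assms(1) smooth_onD(1)[OF Cons.prems]])
  then show ?case using Cons.IH[OF smooth_onD(3)[OF Cons.prems]] by simp
qed auto

text \<open>Each direction is expanded in the basis; only finitely many iterated basis derivatives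
  occur, and each is bounded on K by continuity. The product of norms records multilinearity in the
  directions.\<close>

lemma dders_bounded_on_compact:
  fixes f :: "'a::euclidean_space \<Rightarrow> 'b::euclidean_space"
  assumes "open U" "compact K" "K \<subseteq> U" "smooth_on U f"
  shows "\<exists>M\<ge>0. \<forall>hs. length hs = m \<longrightarrow> (\<forall>p\<in>K. norm (dders hs f p) \<le> M * (\<Prod>h\<leftarrow>hs. norm h))"
  using assms(4)
proof (induction m arbitrary: f)
  case 0
  have "compact (f ` K)"
    using compact_continuous_image[OF _ assms(2)] smooth_onD(4)[OF 0] assms(3) continuous_on_subset by blast
  then obtain M where "\<forall>q\<in>f ` K. norm q \<le> M" using compact_imp_bounded bounded_iff by metis
  then show ?case by (intro exI[of _ "max M 0"]) auto
next
  case (Suc m)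
  have "\<exists>M. M \<ge> 0 \<and> (\<forall>hs. length hs = m \<longrightarrow> (\<forall>p\<in>K. norm (dders hs (dder b f) p) \<le> M * (\<Prod>h\<leftarrow>hs. norm h)))" for b
    using Suc.IH[OF smooth_onD(3)[OF Suc.prems]] by blast
  then obtain M where M: "\<And>b. M b \<ge> 0" "\<And>b hs p. length hs = m \<Longrightarrow> p \<in> K \<Longrightarrow>
      norm (dders hs (dder b f) p) \<le> M b * (\<Prod>h\<leftarrow>hs. norm h)"
    by metis
  have "norm (dders hs f p) \<le> (\<Sum>b\<in>Basis. M b) * (\<Prod>h\<leftarrow>hs. norm h)"
    if hs: "length hs = Suc m" and p: "p \<in> K" for hs p
  proof -
    obtain h hs' where [simp]: "hs = h # hs'" and l: "length hs' = m" using hs by (cases hs) auto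
    have "dders hs f p = dders hs' (\<lambda>q. \<Sum>b\<in>Basis. (h \<bullet> b) *\<^sub>R dder b f q) p"
      unfolding \<open>hs = h # hs'\<close> dders.simps
      by (rule dders_cong[OF assms(1)])
        (use p assms(3) dder_sum_Basis[OF smooth_onD(1)[OF Suc.prems]] in auto)
    also have "\<dots> = (\<Sum>b\<in>Basis. (h \<bullet> b) *\<^sub>R dders hs' (dder b f) p)"
      by (rule dders_scaleR_sum[OF assms(1)]) (use p assms(3) smooth_onD(3)[OF Suc.prems] in auto)
    also have "norm \<dots> \<le> (\<Sum>b\<in>Basis. norm h * (M b * (\<Prod>h\<leftarrow>hs'. norm h)))"
      by (rule sum_norm_le) (simp, intro mult_mono Basis_le_norm M(2)[OF l p], auto)
    also have "\<dots> = (\<Sum>b\<in>Basis. M b) * (\<Prod>h\<leftarrow>hs. norm h)"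
      by (simp add: sum_distrib_left sum_distrib_right mult_ac)
    finally show ?thesis .
  qed
  then show ?case by (intro exI[of _ "\<Sum>b\<in>Basis. M b"]) (auto intro: sum_nonneg M)
qed

lemma taylor_real:
  fixes f :: "'a::euclidean_space \<Rightarrow> real"
  assumes "smooth_on U f" "n > 0" "\<And>s. 0 \<le> s \<Longrightarrow> s \<le> 1 \<Longrightarrow> a + s *\<^sub>R h \<in> U"
  shows "\<exists>s. 0 < s \<and> s < 1 \<and> f (a + h) = (\<Sum>j<n. dders (replicate j h) f a / fact j)
      + dders (replicate n h) f (a + s *\<^sub>R h) / fact n"
proof -
  have "\<exists>t>0. t < 1 \<and> f (a + 1 *\<^sub>R h) =
      (\<Sum>m<n. dders (replicate m h) f (a + 0 *\<^sub>R h) / fact m * 1 ^ m)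
        + dders (replicate n h) f (a + t *\<^sub>R h) / fact n * 1 ^ n"
  proof (rule Maclaurin[where f = "\<lambda>s. f (a + s *\<^sub>R h)"])
    show "\<forall>m t. m < n \<and> 0 \<le> t \<and> t \<le> 1 \<longrightarrow>
      DERIV (\<lambda>s. dders (replicate m h) f (a + s *\<^sub>R h)) t :> dders (replicate (Suc m) h) f (a + t *\<^sub>R h)"
      unfolding dders_replicate_Suc
      by (intro allI impI has_real_derivative_line smooth_onD(1)[OF smooth_on_dders[OF assms(1)]])
        (use assms(3) in auto)
  qed (use assms in auto)
  then show ?thesis by auto
qed

text \<open>The constant is uniform in the base point and in the direction. The Lagrange remainder
  has a different intermediate point for each component, so the components are estimated separately
  and summed; this is the origin of the factor \<open>DIM('b)\<close>.\<close>

lemma taylor_bound: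
  fixes f :: "'a::euclidean_space \<Rightarrow> 'b::euclidean_space"
  assumes U: "open U" "compact K" "K \<subseteq> U" and f: "smooth_on U f"
  obtains C where "C \<ge> 0" "\<And>a h. (\<And>s. s \<in> {0..1} \<Longrightarrow> a + s *\<^sub>R h \<in> K) \<Longrightarrow>
    norm (f (a + h) - (\<Sum>j<n. (1 / fact j) *\<^sub>R dders (replicate j h) f a)) \<le> C * norm h ^ n"
proof -
  obtain M where M: "M \<ge> 0" "\<And>hs p. length hs = n \<Longrightarrow> p \<in> K \<Longrightarrow> norm (dders hs f p) \<le> M * (\<Prod>h\<leftarrow>hs. norm h)"
    using dders_bounded_on_compact[OF U f, of n] by blast
  have "norm (f (a + h) - (\<Sum>j<n. (1 / fact j) *\<^sub>R dders (replicate j h) f a)) \<le> real DIM('b) * M * norm h ^ n"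
    if K: "\<And>s. s \<in> {0..1} \<Longrightarrow> a + s *\<^sub>R h \<in> K" for a h
  \<comment> \<open>\<open>taylor_real\<close> needs at least one term; for n = 0 the claim is
    boundedness on K.\<close>
  proof (cases "n = 0")
    case True
    have "norm (f (a + h)) \<le> M" using M(2)[of "[]" "a + h"] True K[of 1] by simp
    then show ?thesis using True M(1) order_trans[OF _ mult_right_mono[of 1 "real DIM('b)" M]]
      by (simp add: Suc_leI)
  next
    case False
    let ?R = "f (a + h) - (\<Sum>j<n. (1 / fact j) *\<^sub>R dders (replicate j h) f a)"
    have aU: "a \<in> U" using K[of 0] U by auto
    have "\<bar>?R \<bullet> b\<bar> \<le> M * norm h ^ n" if b: "b \<in> Basis" for b
    proof -
      have inner: "dders hs f p \<bullet> b = dders hs (\<lambda>q. f q \<bullet> b) p" if "p \<in> U" for hs p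
        using dders_bounded_linear[OF bounded_linear_inner_left U(1) that f] by simp
      have "smooth_on U (\<lambda>q. f q \<bullet> b)" by (intro smooth_intros U f)
      then obtain s where s: "0 < s" "s < 1" "f (a + h) \<bullet> b
          = (\<Sum>j<n. dders (replicate j h) (\<lambda>q. f q \<bullet> b) a / fact j)
            + dders (replicate n h) (\<lambda>q. f q \<bullet> b) (a + s *\<^sub>R h) / fact n"
        using taylor_real[of U "\<lambda>q. f q \<bullet> b" n a h] False K U by auto
      have sK: "a + s *\<^sub>R h \<in> K" using K s by auto
      have "?R \<bullet> b = (dders (replicate n h) f (a + s *\<^sub>R h) \<bullet> b) / fact n"
        using s inner[OF aU] inner[of "a + s *\<^sub>R h"] sK U
        by (auto simp: inner_diff_left inner_sum_left)
      also have "\<bar>\<dots>\<bar> \<le> \<bar>dders (replicate n h) f (a + s *\<^sub>R h) \<bullet> b\<bar>"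
        by (simp add: divide_le_eq mult_le_cancel_left1 fact_ge_1)
      also have "\<dots> \<le> norm (dders (replicate n h) f (a + s *\<^sub>R h))"
        using Basis_le_norm[OF b] by simp
      also have "\<dots> \<le> M * norm h ^ n"
        using M(2)[of "replicate n h", OF _ sK] by simp
      finally show ?thesis .
    qed
    then have "(\<Sum>b\<in>Basis. \<bar>?R \<bullet> b\<bar>) \<le> (\<Sum>b\<in>(Basis::'b set). M * norm h ^ n)" by (rule sum_mono)
    then show ?thesis using norm_le_l1[of ?R] by (simp add: mult_ac)
  qed
  then show ?thesis using that[of "real DIM('b) * M"] M(1) by simp
qed

text \<open>Letting s tend to 0 kills the constant coefficient; dividing by s reduces the order by
  one.\<close>

lemma coefficients_zero_if_small:
  fixes c :: "nat \<Rightarrow> 'b::real_normed_vector"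
  assumes "\<And>s. 0 < s \<Longrightarrow> s \<le> 1 \<Longrightarrow> norm (\<Sum>j<n. s ^ j *\<^sub>R c j) \<le> C * s ^ n"
  shows "\<forall>j<n. c j = 0"
  using assms
proof (induction n arbitrary: c)
  case (Suc n)
  let ?F = "\<lambda>s. \<Sum>j<Suc n. s ^ j *\<^sub>R c j"
  have 1: "(?F \<longlongrightarrow> ?F 0) (at_right 0)"
    by (intro tendsto_intros)
  have "((\<lambda>s::real. C * s ^ Suc n) \<longlongrightarrow> C * 0 ^ Suc n) (at_right 0)" by (intro tendsto_intros)
  then have lim: "((\<lambda>s::real. C * s ^ Suc n) \<longlongrightarrow> 0) (at_right 0)" by simp
  have "\<forall>\<^sub>F s in at_right 0. norm (?F s) \<le> C * s ^ Suc n"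
    using Suc.prems unfolding eventually_at_right_field by (intro exI[of _ 1]) auto
  then have "(?F \<longlongrightarrow> 0) (at_right 0)" using lim by (rule Lim_null_comparison)
  with 1 have "?F 0 = 0" using tendsto_unique[OF trivial_limit_at_right_real] by blast
  then have c0: "c 0 = 0" by (simp add: lessThan_Suc_eq_insert_0 sum.insert_if sum.reindex power_0_left)
  have "norm (\<Sum>j<n. s ^ j *\<^sub>R c (Suc j)) \<le> C * s ^ n" if s: "0 < s" "s \<le> 1" for s
  proof -
    have "?F s = s *\<^sub>R (\<Sum>j<n. s ^ j *\<^sub>R c (Suc j))"
      by (simp only: sum.lessThan_Suc_shift c0) (simp add: scaleR_sum_right)
    then have "s * norm (\<Sum>j<n. s ^ j *\<^sub>R c (Suc j)) \<le> s * (C * s ^ n)"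
      using Suc.prems[OF s] s by (simp add: mult_ac)
    then show ?thesis using s by simp
  qed
  then have "\<forall>j<n. c (Suc j) = 0" by (rule Suc.IH)
  then show ?case using c0 by (auto simp: less_Suc_eq_0_disj)
qed simp

subsection \<open>Removable singularities\<close>

text \<open>A segment that avoids the centre is handled by the mean value inequality. One through
  the centre is tilted slightly, which is possible in dimension at least 2, and continuity passes to
  the limit.\<close>

lemma lipschitz_punctured_ball:
  fixes g :: "'a::euclidean_space \<Rightarrow> 'b::euclidean_space"
  assumes dim: "DIM('a) \<ge> 2"
    and diff: "\<And>p. p \<in> ball a r - {a} \<Longrightarrow> g differentiable (at p)"
    and bd: "\<And>p h. p \<in> ball a r - {a} \<Longrightarrow> norm (dder h g p) \<le> K * norm h"
    and pq: "p \<in> ball a r - {a}" "q \<in> ball a r - {a}"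
  shows "norm (g p - g q) \<le> K * norm (p - q)"
proof -
  have seg: "norm (g p - g q) \<le> K * norm (p - q)"
    if pq: "p \<in> ball a r - {a}" "q \<in> ball a r - {a}" and a: "a \<notin> closed_segment p q" for p q
  proof -
    have sub: "closed_segment p q \<subseteq> ball a r - {a}"
      using pq a closed_segment_subset[of p "ball a r" q] by auto
    show ?thesis
    proof (rule differentiable_bound[where S = "closed_segment p q" and f' = "\<lambda>x. frechet_derivative g (at x)"])
      fix x assume x: "x \<in> closed_segment p q"
      show "(g has_derivative frechet_derivative g (at x)) (at x within closed_segment p q)"
        using diff x sub frechet_derivative_works has_derivative_at_withinI by blast
      show "onorm (frechet_derivative g (at x)) \<le> K"
        using onorm_le[of "frechet_derivative g (at x)" K] bd x sub by blast
    qed auto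
  qed
  show ?thesis
  proof (cases "a \<in> closed_segment p q")
    case False then show ?thesis using seg pq by blast
  next
    case True
    obtain v where v: "v \<notin> span {q - p}"
    proof -
      have "dim (span {q - p}) \<le> card {q - p}" by (metis dim_le_card dim_span finite.emptyI finite.insertI span_superset subset_refl)
      then have "span {q - p} \<noteq> (UNIV::'a set)" using dim by (metis card_1_singleton_iff dim_UNIV not_less_eq_eq numeral_2_eq_2 One_nat_def)
      then show ?thesis using that by blast
    qed
    obtain u where u: "a = (1 - u) *\<^sub>R p + u *\<^sub>R q" using True by (auto simp: closed_segment_def)
    \<comment> \<open>Endpoints that leave the line through p and q in the direction v and converge
      to q; the segment from p to \<open>Q n\<close> misses a because v is not a multiple of q -
      p.\<close>
    define Q where "Q n = q + (1 / real (Suc n)) *\<^sub>R v" for n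
    have Ql: "Q \<longlonglongrightarrow> q"
      unfolding Q_def using tendsto_add[OF tendsto_const tendsto_scaleR[OF LIMSEQ_inverse_real_of_nat tendsto_const], of q v]
      by (simp add: inverse_eq_divide)
    have notin: "a \<notin> closed_segment p (Q n)" for n
    proof
      assume "a \<in> closed_segment p (Q n)"
      then obtain u' where u': "a = (1 - u') *\<^sub>R p + u' *\<^sub>R Q n" by (auto simp: closed_segment_def)
      have "u' \<noteq> 0" using u' pq by auto
      have "(u' * (1 / real (Suc n))) *\<^sub>R v = (u - u') *\<^sub>R (q - p)"
        using u u' by (simp add: Q_def algebra_simps)
      then have "v = ((u - u') / (u' * (1 / real (Suc n)))) *\<^sub>R (q - p)"
        using \<open>u' \<noteq> 0\<close> by (metis (no_types, lifting) divide_eq_0_iff mult_eq_0_iff of_nat_eq_0_iff old.nat.distinct(2)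
            real_vector.scale_scale real_vector_eq_affinity scaleR_left_imp_eq divide_inverse_commute zero_neq_one inverse_eq_divide scaleR_one right_inverse vector_fraction_eq_iff)
      then show False using v by (metis insertI1 span_base span_scale)
    qed
    have op: "open (ball a r - {a})" by auto
    have "\<forall>\<^sub>F n in sequentially. Q n \<in> ball a r - {a}"
      using topological_tendstoD[OF Ql op] pq by blast
    then have ev: "\<forall>\<^sub>F n in sequentially. norm (g p - g (Q n)) \<le> K * norm (p - Q n)"
      by (rule eventually_mono) (use seg pq notin in blast)
    have "g \<midarrow>q\<rightarrow> g q" using diff[OF pq(2)] differentiable_imp_continuous_within continuous_at by blast
    moreover have "isCont g q" using diff[OF pq(2)] differentiable_imp_continuous_within by blast
    ultimately have "(\<lambda>n. g (Q n)) \<longlonglongrightarrow> g q" using isCont_tendsto_compose[OF _ Ql] by blast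
    then show ?thesis
      by (intro tendsto_le[OF _ _ _ ev] tendsto_intros Ql) auto
  qed
qed


text \<open>Bounded first derivatives make each member of G Lipschitz near a, so it has a limit at
  a. As G is closed under differentiation, the derivatives have limits as well, and extending by the
  limit commutes with differentiation; smoothness follows by induction on the order.\<close>

theorem removable_singularity:
  fixes G :: "('a::euclidean_space \<Rightarrow> 'b::euclidean_space) set"
  assumes dim: "DIM('a) \<ge> 2" and U: "open U" "a \<in> U"
    and closed: "\<And>g h. g \<in> G \<Longrightarrow> dder h g \<in> G"
    and diff: "\<And>g p. g \<in> G \<Longrightarrow> p \<in> U - {a} \<Longrightarrow> g differentiable (at p)"
    and bdd: "\<And>g. g \<in> G \<Longrightarrow> \<exists>K. \<forall>\<^sub>F p in at a. norm (g p) \<le> K"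
    and g: "g \<in> G"
  obtains f where "smooth_on U f" "\<And>p. p \<noteq> a \<Longrightarrow> f p = g p"
proof -
  have evU: "\<forall>\<^sub>F p in at a. p \<in> U - {a}"
    using U by (simp add: eventually_at_topological) blast
  have ball: "\<exists>r>0. \<forall>p\<in>ball a r - {a}. P p" if "\<forall>\<^sub>F p in at a. P p" for P
    using that by (metis DiffD1 DiffD2 UNIV_I dist_commute eventually_at insertI1 mem_ball)
  \<comment> \<open>Estimates in the finitely many basis directions become one estimate that is
    uniform in the direction h. It is used with l = 0 for boundedness and with the limits for
    differentiability at a.\<close>
  have uniform: "\<forall>\<^sub>F p in at a. p \<in> U - {a} \<and> (\<forall>h. norm (dder h g p - (\<Sum>b\<in>Basis. (h \<bullet> b) *\<^sub>R l b)) \<le> (\<Sum>b\<in>Basis. c b) * norm h)"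
    if g: "g \<in> G" and l: "\<And>b. b \<in> Basis \<Longrightarrow> \<forall>\<^sub>F p in at a. norm (dder b g p - l b) \<le> c b" for g l c
  proof -
    have "\<forall>\<^sub>F p in at a. p \<in> U - {a} \<and> (\<forall>b\<in>Basis. norm (dder b g p - l b) \<le> c b)"
      by (intro eventually_conj evU eventually_ball_finite finite_Basis ballI l)
    then show ?thesis
    proof (rule eventually_mono, safe)
      fix p h assume p: "p \<in> U" "p \<noteq> a" and b: "\<forall>b\<in>Basis. norm (dder b g p - l b) \<le> c b"
      have "dder h g p - (\<Sum>b\<in>Basis. (h \<bullet> b) *\<^sub>R l b) = (\<Sum>b\<in>Basis. (h \<bullet> b) *\<^sub>R (dder b g p - l b))"
        using dder_sum_Basis[OF diff[OF g], of p h] p by (simp add: scaleR_diff_right sum_subtractf)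
      also have "norm \<dots> \<le> (\<Sum>b\<in>Basis. norm h * c b)"
        by (rule sum_norm_le) (use b in \<open>simp, intro mult_mono Basis_le_norm, auto\<close>)
      finally show "norm (dder h g p - (\<Sum>b\<in>Basis. (h \<bullet> b) *\<^sub>R l b)) \<le> (\<Sum>b\<in>Basis. c b) * norm h"
        by (simp add: sum_distrib_left[symmetric] mult.commute)
    qed
  qed
  have lim: "\<exists>l. (g \<longlongrightarrow> l) (at a)" if g: "g \<in> G" for g
  proof -
    obtain c where c: "\<And>b. \<forall>\<^sub>F p in at a. norm (dder b g p) \<le> c b"
      using bdd[OF closed[OF g]] by metis
    obtain r where r: "r > 0" "\<And>p. p \<in> ball a r - {a} \<Longrightarrow> p \<in> U - {a} \<and> (\<forall>h. norm (dder h g p) \<le> (\<Sum>b\<in>Basis. c b) * norm h)"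
      using ball[OF uniform[OF g, of "\<lambda>_. 0" c]] c by auto
    let ?X = "ball a r - {a}" and ?K = "max (\<Sum>b\<in>Basis. c b) 0"
    have "?K-lipschitz_on ?X g"
    proof (rule lipschitz_onI)
      fix p q assume pq: "p \<in> ?X" "q \<in> ?X"
      have "norm (g p - g q) \<le> (\<Sum>b\<in>Basis. c b) * norm (p - q)"
        by (rule lipschitz_punctured_ball[OF dim, of a r]) (use diff[OF g] r pq in auto)
      also have "\<dots> \<le> ?K * norm (p - q)" by (intro mult_right_mono) auto
      finally show "dist (g p) (g q) \<le> ?K * dist p q" by (simp add: dist_norm)
    qed auto
    then have "uniformly_continuous_on ?X g" by (rule lipschitz_on_uniformly_continuous)
    moreover have "a \<in> closure ?X"
      using r(1) islimpt_ball[of a a r] by (simp add: islimpt_in_closure ball_def)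
    ultimately obtain l where "(g \<longlongrightarrow> l) (at a within ?X)"
      using uniformly_continuous_on_extension_at_closure by metis
    moreover have "at a within ?X = at a within UNIV"
      by (rule at_within_nhd[of a "ball a r"]) (use r(1) in auto)
    ultimately show ?thesis by auto
  qed
  define ex where "ex g p = (if p = a then Lim (at a) g else g p)" for g :: "'a \<Rightarrow> 'b" and p
  have exlim: "(g \<longlongrightarrow> ex g a) (at a)" if "g \<in> G" for g
    using lim[OF that] by (auto simp: ex_def tendsto_Lim)
  have der: "(ex g has_derivative (\<lambda>h. ex (dder h g) p)) (at p)" if g: "g \<in> G" and p: "p \<in> U" for g p
  proof (cases "p = a")
    case False
    have "(g has_derivative (\<lambda>h. dder h g p)) (at p)"
      using diff[OF g, of p] p False frechet_derivative_works by blast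
    then have "(ex g has_derivative (\<lambda>h. dder h g p)) (at p)"
      by (rule has_derivative_transform_within_open[of _ _ _ _ "- {a}"]) (use False in \<open>auto simp: ex_def\<close>)
    then show ?thesis using False by (simp add: ex_def)
  next
    case True
    let ?L = "\<lambda>h. ex (dder h g) a"
    \<comment> \<open>The candidate derivative at a is a limit of linear maps; comparing it with its
      values on the basis shows that it is linear.\<close>
    have Leq: "?L h = (\<Sum>b\<in>Basis. (h \<bullet> b) *\<^sub>R ?L b)" for h
    proof (rule tendsto_unique[OF _ exlim[OF closed[OF g]]])
      have "((\<lambda>p. \<Sum>b\<in>Basis. (h \<bullet> b) *\<^sub>R dder b g p) \<longlongrightarrow> (\<Sum>b\<in>Basis. (h \<bullet> b) *\<^sub>R ?L b)) (at a)"
        by (intro tendsto_intros exlim closed g)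
      then show "(dder h g \<longlongrightarrow> (\<Sum>b\<in>Basis. (h \<bullet> b) *\<^sub>R ?L b)) (at a)"
        by (rule Lim_transform_eventually)
          (use evU in eventually_elim, use dder_sum_Basis[OF diff[OF g]] in auto)
    qed simp
    have Ll: "linear ?L"
    proof (rule linearI)
      fix h k and c :: real
      show "?L (h + k) = ?L h + ?L k" unfolding Leq[of "h + k"] Leq[of h] Leq[of k]
        by (simp add: inner_add_left scaleR_add_left sum.distrib)
      show "?L (c *\<^sub>R h) = c *\<^sub>R ?L h" unfolding Leq[of "c *\<^sub>R h"] Leq[of h]
        by (simp add: scaleR_sum_right)
    qed
    have "\<exists>d>0. \<forall>y. norm (y - a) < d \<longrightarrow> norm (ex g y - ex g a - ?L (y - a)) \<le> e * norm (y - a)"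
      if e: "e > 0" for e
    proof -
      let ?c = "\<lambda>_::'a. e / real DIM('a)"
      have "\<forall>\<^sub>F p in at a. norm (dder b g p - ?L b) \<le> e / real DIM('a)" for b
      proof -
        have "\<forall>\<^sub>F p in at a. dist (dder b g p) (?L b) < e / real DIM('a)"
          using exlim[OF closed[OF g]] by (rule tendstoD) (use e in simp)
        then show ?thesis by eventually_elim (simp add: dist_norm)
      qed
      from ball[OF uniform[OF g, of ?L ?c, OF this], unfolded Leq[symmetric]]
      obtain r where r: "r > 0" "\<And>p h. p \<in> ball a r - {a} \<Longrightarrow> p \<in> U - {a} \<and> norm (dder h g p - ?L h) \<le> e * norm h"
        by auto
      \<comment> \<open>After subtracting the candidate derivative the remaining derivative has norm
        at most e near a, so \<open>?k\<close> is Lipschitz with constant e on the punctured ball.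
        Moving the second point to a gives the differentiability estimate.\<close>
      let ?k = "\<lambda>q. g q - ?L q"
      have kd: "(?k has_derivative (\<lambda>h. dder h g p - ?L h)) (at p)" if "p \<in> ball a r - {a}" for p
        using diff[OF g, of p] r(2)[OF that] frechet_derivative_works
          linear_imp_has_derivative[OF Ll] by (auto intro!: has_derivative_diff)
      have lip: "norm (?k p - ?k q) \<le> e * norm (p - q)"
        if "p \<in> ball a r - {a}" "q \<in> ball a r - {a}" for p q
        by (rule lipschitz_punctured_ball[OF dim _ _ that])
          (use kd dder_eqI[OF kd] r(2) in \<open>auto simp: differentiable_def\<close>)
      show ?thesis
      proof (intro exI conjI allI impI)
        show "r > 0" by fact
        fix y assume y: "norm (y - a) < r"
        show "norm (ex g y - ex g a - ?L (y - a)) \<le> e * norm (y - a)"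
        proof (cases "y = a")
          case True then show ?thesis using linear_0[OF Ll] by simp
        next
          case False
          have y': "y \<in> ball a r - {a}" using y False by (simp add: dist_norm norm_minus_commute)
          have "((\<lambda>q. norm (?k y - (g q - ?L q))) \<longlongrightarrow> norm (?k y - (ex g a - ?L a))) (at a)"
            by (rule tendsto_norm, rule tendsto_diff[OF tendsto_const],
                rule tendsto_diff[OF exlim[OF g]], rule isContD,
                rule linear_continuous_at[OF linear_conv_bounded_linear[THEN iffD1, OF Ll]])
          moreover have "((\<lambda>q. e * norm (y - q)) \<longlongrightarrow> e * norm (y - a)) (at a)"
            by (intro tendsto_intros)
          moreover have "\<forall>\<^sub>F q in at a. norm (?k y - (g q - ?L q)) \<le> e * norm (y - q)"
            unfolding eventually_at using r(1) lip[OF y']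
            by (intro exI[of _ r]) (auto simp: dist_commute)
          ultimately have "norm (?k y - (ex g a - ?L a)) \<le> e * norm (y - a)"
            by (intro tendsto_le) auto
          moreover have "ex g y = g y" using False by (simp add: ex_def)
          ultimately show ?thesis by (simp add: linear_diff[OF Ll] algebra_simps)
        qed
      qed
    qed
    then show ?thesis
      unfolding True has_derivative_at_alt
      using Ll linear_conv_bounded_linear by blast
  qed
  have "Ck_on k U (ex g)" if "g \<in> G" for g k
    using that
  proof (induction k arbitrary: g)
    case 0
    then show ?case using der[OF 0]
      by (auto intro!: continuous_at_imp_continuous_on has_derivative_continuous)
  next
    case (Suc k)
    show ?case by (rule Ck_on_SucI[OF U(1) der[OF Suc.prems]]) (auto intro: Suc.IH closed Suc.prems)
  qed
  then have "smooth_on U (ex g)" using g by (simp add: smooth_on_def)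
  then show ?thesis using that by (simp add: ex_def)
qed

text \<open>
  The multiplier \<open>q\<close> may vanish off \<open>a\<close>; it clears the denominators of the iterated
  derivatives of \<open>g\<close>.
\<close>

lemma removable_singularity_quotient:
  fixes g :: "'a::euclidean_space \<Rightarrow> 'b::euclidean_space" and q :: "'a \<Rightarrow> real"
  assumes dim: "DIM('a) \<ge> 2" and U: "open U" "a \<in> U" and q: "smooth_on U q"
    and closed: "\<And>f h m. smooth_on U f \<Longrightarrow> P f \<Longrightarrow> P (\<lambda>p. q p *\<^sub>R dder h f p - (real m * dder h q p) *\<^sub>R f p)"
    and bdd: "\<And>f g m. smooth_on U f \<Longrightarrow> P f \<Longrightarrow> smooth_on (U - {a}) g \<Longrightarrow>
      (\<And>p. p \<in> U - {a} \<Longrightarrow> q p ^ m *\<^sub>R g p = f p) \<Longrightarrow> \<exists>K. \<forall>\<^sub>F p in at a. norm (g p) \<le> K"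
    and g: "smooth_on (U - {a}) g" "smooth_on U f" "P f" "\<And>p. p \<in> U - {a} \<Longrightarrow> q p ^ m *\<^sub>R g p = f p"
  obtains g' where "smooth_on U g'" "\<And>p. p \<noteq> a \<Longrightarrow> g' p = g p"
proof -
  have U': "open (U - {a})" using U by auto
  \<comment> \<open>Functions that become smooth with property P after multiplication by some power
    of q. Differentiating \<open>q ^ m *\<^sub>R g = f\<close> and multiplying by q once more shows
    that a derivative of g is of the same kind with exponent m + 1, which explains the numerator in
    the closure hypothesis.\<close>
  define G where "G = {g. smooth_on (U - {a}) g \<and>
    (\<exists>m f. smooth_on U f \<and> P f \<and> (\<forall>p\<in>U - {a}. q p ^ m *\<^sub>R g p = f p))}"
  have "dder h g \<in> G" if gG: "g \<in> G" for g h
  proof -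
    obtain m f where f: "smooth_on (U - {a}) g" "smooth_on U f" "P f"
        "\<And>p. p \<in> U - {a} \<Longrightarrow> q p ^ m *\<^sub>R g p = f p"
      using gG unfolding G_def by blast
    let ?f = "\<lambda>p. q p *\<^sub>R dder h f p - (real m * dder h q p) *\<^sub>R f p"
    have "q p ^ Suc m *\<^sub>R dder h g p = ?f p" if p: "p \<in> U - {a}" for p
    proof -
      have "((\<lambda>p. q p ^ m *\<^sub>R g p) has_derivative
          (\<lambda>h. q p ^ m *\<^sub>R dder h g p + (real m * dder h q p * q p ^ (m - 1)) *\<^sub>R g p)) (at p)"
        by (intro has_derivative_scaleR has_derivative_power smooth_onD(2)[OF q] smooth_onD(2)[OF f(1)])
          (use p in auto)
      then have "dder h (\<lambda>p. q p ^ m *\<^sub>R g p) p = q p ^ m *\<^sub>R dder h g p + (real m * dder h q p * q p ^ (m - 1)) *\<^sub>R g p"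
        by (rule dder_eqI)
      moreover have "dder h (\<lambda>p. q p ^ m *\<^sub>R g p) p = dder h f p"
        using frechet_derivative_cong_open[OF U' p f(4)] by simp
      ultimately have "q p *\<^sub>R dder h f p = q p ^ Suc m *\<^sub>R dder h g p + (real m * dder h q p * (q p * q p ^ (m - 1))) *\<^sub>R g p"
        by (simp add: algebra_simps)
      moreover have "(real m * dder h q p * (q p * q p ^ (m - 1))) *\<^sub>R g p = (real m * dder h q p) *\<^sub>R f p"
        unfolding f(4)[OF p, symmetric] by (cases m) (auto simp: algebra_simps)
      ultimately show ?thesis by simp
    qed
    moreover have "smooth_on U ?f"
      by (intro smooth_intros U q f smooth_onD(3)[OF f(2)] smooth_onD(3)[OF q])
    ultimately show ?thesis
      using closed[OF f(2,3), of h m] smooth_onD(3)[OF f(1)] unfolding G_def by blast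
  qed
  moreover have "g differentiable (at p)" if "g \<in> G" "p \<in> U - {a}" for g p
    using that smooth_onD(1) unfolding G_def by blast
  moreover have "\<exists>K. \<forall>\<^sub>F p in at a. norm (g p) \<le> K" if "g \<in> G" for g
    using that bdd unfolding G_def by blast
  moreover have "g \<in> G" using g unfolding G_def by blast
  ultimately show ?thesis using removable_singularity[OF dim U, of G g] that by blast
qed

subsection \<open>Smooth bump functions\<close>

text \<open>The derivative is again a product of the inverse with smooth functions, so the induction
  hypothesis applies to it.\<close>

lemma Ck_on_inverse:
  fixes g :: "'a::euclidean_space \<Rightarrow> real"
  assumes "open U" "smooth_on U g" "\<And>p. p \<in> U \<Longrightarrow> g p \<noteq> 0"
  shows "Ck_on k U (\<lambda>p. inverse (g p))"
proof (induction k)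
  case 0
  then show ?case using smooth_onD(4)[OF assms(2)] assms(3) by (auto intro: continuous_on_inverse)
next
  case (Suc k)
  have "Ck_on k U (\<lambda>p. - (inverse (g p) * dder h g p * inverse (g p)))" for h
    using smooth_onD(3)[OF assms(2)]
    by (intro Ck_on_bilinear[OF bounded_bilinear_mult assms(1)]
        Ck_on_bounded_linear[OF bounded_linear_minus[OF bounded_linear_ident] assms(1)] Suc.IH)
      (simp add: smooth_on_def)
  then show ?case
    by (rule Ck_on_SucI[OF assms(1), where f' = "\<lambda>p h. - (inverse (g p) * dder h g p * inverse (g p))", rotated])
      (intro Deriv.has_derivative_inverse assms(3) smooth_onD(2)[OF assms(2)])
qed

lemma smooth_on_inverse:
  fixes g :: "'a::euclidean_space \<Rightarrow> real"
  shows "open U \<Longrightarrow> smooth_on U g \<Longrightarrow> (\<And>p. p \<in> U \<Longrightarrow> g p \<noteq> 0) \<Longrightarrow> smooth_on U (\<lambda>p. inverse (g p))"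
  unfolding smooth_on_def[of _ "\<lambda>p. inverse (g p)"] using Ck_on_inverse by blast

lemma smooth_on_union: "smooth_on U f \<Longrightarrow> smooth_on V f \<Longrightarrow> open U \<Longrightarrow> open V \<Longrightarrow> smooth_on (U \<union> V) f"
proof -
  assume *: "smooth_on U f" "smooth_on V f" "open U" "open V"
  have "Ck_on k U f \<Longrightarrow> Ck_on k V f \<Longrightarrow> Ck_on k (U \<union> V) f" for k
    using *(3,4) by (induction k arbitrary: f) (auto simp: continuous_on_open_Un)
  then show ?thesis using * by (simp add: smooth_on_def)
qed

text \<open>The iterated derivatives of \<open>exp (-1/t)\<close> are linear combinations of these functions.\<close>

definition exp_flat :: "nat \<Rightarrow> real \<Rightarrow> real" where
  "exp_flat n t = (if t > 0 then exp (- inverse t) * inverse t ^ n else 0)"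

lemma exp_flat_tendsto_0: "(exp_flat n \<longlongrightarrow> 0) (at 0)"
proof (rule filterlim_split_at)
  show "(exp_flat n \<longlongrightarrow> 0) (at_left 0)"
    by (rule tendsto_eventually) (auto simp: exp_flat_def eventually_at_left_field intro!: exI[of _ "-1"])
  have "((\<lambda>t::real. inverse t ^ n / exp (inverse t)) \<longlongrightarrow> 0) (at_right 0)"
    by (rule filterlim_compose[OF tendsto_power_div_exp_0 filterlim_inverse_at_top_right])
  then show "(exp_flat n \<longlongrightarrow> 0) (at_right 0)"
    by (rule Lim_transform_eventually)
      (auto simp: exp_flat_def eventually_at_right_field exp_minus divide_inverse intro!: exI[of _ 1])
qed

text \<open>At 0 the difference quotient of \<open>exp_flat n\<close> is
  \<open>exp_flat (Suc n)\<close>, which tends to 0; elsewhere this is the product rule. The family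
  is thus closed under differentiation up to linear combinations.\<close>

lemma exp_flat_deriv:
  "(exp_flat n has_real_derivative exp_flat (n + 2) t - real n * exp_flat (Suc n) t) (at t)"
proof -
  consider "t > 0" | "t < 0" | "t = 0" by linarith
  then show ?thesis
  proof cases
    case 1
    have "((\<lambda>t. inverse t ^ n) has_real_derivative - real n * inverse t ^ Suc n) (at t)"
    proof (induction n)
      case (Suc n)
      show ?case using DERIV_mult[OF DERIV_inverse Suc.IH] 1 by (simp add: algebra_simps)
    qed simp
    moreover have "((\<lambda>t. exp (- inverse t)) has_real_derivative exp (- inverse t) * inverse t ^ 2) (at t)"
      using 1 by (auto intro!: derivative_eq_intros simp: power2_eq_square)
    ultimately have "((\<lambda>t. exp (- inverse t) * inverse t ^ n) has_real_derivative
        exp_flat (n + 2) t - real n * exp_flat (Suc n) t) (at t)"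
      using DERIV_mult 1 by (fastforce simp: exp_flat_def power2_eq_square algebra_simps)
    then show ?thesis
      by (rule has_field_derivative_transform_within_open[of _ _ _ "{0<..}"]) (use 1 in \<open>auto simp: exp_flat_def\<close>)
  next
    case 2
    have "((\<lambda>t. 0) has_real_derivative exp_flat (n + 2) t - real n * exp_flat (Suc n) t) (at t)"
      using 2 by (simp add: exp_flat_def)
    then show ?thesis
      by (rule has_field_derivative_transform_within_open[of _ _ _ "{..<0}"]) (use 2 in \<open>auto simp: exp_flat_def\<close>)
  next
    case 3
    have "((\<lambda>h. (exp_flat n h - exp_flat n 0) / (h - 0)) \<longlongrightarrow> 0) (at 0)"
      by (rule Lim_transform_eventually[OF exp_flat_tendsto_0[of "Suc n"]])
        (auto simp: exp_flat_def eventually_at_filter field_simps)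
    then show ?thesis by (simp add: 3 has_field_derivative_iff exp_flat_def)
  qed
qed

lemma smooth_on_exp_flat:
  assumes "open U" "smooth_on U u"
  shows "smooth_on U (\<lambda>p. exp_flat n (u p))"
proof -
  have "Ck_on k U (\<lambda>p. exp_flat n (u p))" for k
  proof (induction k arbitrary: n)
    case 0
    have "continuous_on UNIV (exp_flat n)"
      using DERIV_isCont[OF exp_flat_deriv] by (auto intro: continuous_at_imp_continuous_on)
    then show ?case using continuous_on_compose2[OF _ smooth_onD(4)[OF assms(2)]] by auto
  next
    case (Suc k)
    let ?f = "\<lambda>p. exp_flat (n + 2) (u p) + (- real n) * exp_flat (Suc n) (u p)"
    have "Ck_on k U (\<lambda>p. dder h u p * ?f p)" for h
      using smooth_onD(3)[OF assms(2)]
      by (intro Ck_on_bilinear[OF bounded_bilinear_mult assms(1)] Ck_on_add[OF assms(1)] Suc.IH Ck_on_const)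
        (simp add: smooth_on_def)
    then show ?case
    proof (rule Ck_on_SucI[OF assms(1), rotated])
      fix p assume "p \<in> U"
      have "(exp_flat n has_real_derivative ?f p) (at (u p))"
        using exp_flat_deriv[of n "u p"] by simp
      from has_derivative_compose[OF smooth_onD(2)[OF assms(2) \<open>p \<in> U\<close>] this[unfolded has_field_derivative_def]]
      show "((\<lambda>p. exp_flat n (u p)) has_derivative (\<lambda>h. dder h u p * ?f p)) (at p)"
        by (simp add: mult.commute)
    qed
  qed
  then show ?thesis by (simp add: smooth_on_def)
qed

text \<open>The quotient A / (A + B), where A is positive exactly for norm below 2 and B exactly for
  norm above 1, so that the denominator never vanishes.\<close>

lemma smooth_bump:
  obtains \<beta> :: "'a::euclidean_space \<Rightarrow> real" where "smooth_on UNIV \<beta>"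
    "\<And>p. norm p \<le> 1 \<Longrightarrow> \<beta> p = 1" "\<And>p. norm p \<ge> 2 \<Longrightarrow> \<beta> p = 0"
proof -
  define A B :: "'a \<Rightarrow> real" where "A = (\<lambda>p. exp_flat 0 (4 - (norm p)\<^sup>2))"
    and "B = (\<lambda>p. exp_flat 0 ((norm p)\<^sup>2 - 1))"
  have s: "smooth_on UNIV A" "smooth_on UNIV B"
    unfolding A_def B_def by (intro smooth_on_exp_flat smooth_intros open_UNIV)+
  have "A p + B p > 0" for p
  proof (cases "(norm p)\<^sup>2 < 4")
    case False
    then have "(norm p)\<^sup>2 > 1" by linarith
    then show ?thesis using False by (simp add: A_def B_def exp_flat_def)
  qed (auto simp: A_def B_def exp_flat_def intro: add_pos_nonneg)
  then have ne: "A p + B p \<noteq> 0" for p by (metis less_irrefl)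
  have sm: "smooth_on UNIV (\<lambda>p. A p * inverse (A p + B p))"
    by (intro smooth_intros smooth_on_inverse s open_UNIV ne)
  have b1: "B p = 0" if "norm p \<le> 1" for p
    using that abs_square_le_1[of "norm p"] by (auto simp: B_def exp_flat_def)
  have a2: "A p = 0" if "norm p \<ge> 2" for p
    using power_mono[OF that, of 2] by (auto simp: A_def exp_flat_def)
  show ?thesis
    by (rule that[OF sm]) (use b1 a2 ne in \<open>auto, metis add.right_neutral right_inverse\<close>)
qed

lemma smooth_on_scale_arg:
  assumes "smooth_on UNIV f" shows "smooth_on UNIV (\<lambda>p. f (c *\<^sub>R (p - a)))"
proof -
  have "Ck_on k UNIV (\<lambda>p. f (c *\<^sub>R (p - a)))" for k
    using assms
  proof (induction k arbitrary: f)
    case 0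
    have "continuous_on UNIV f" using smooth_onD(4)[OF 0] .
    then show ?case by (auto intro!: continuous_on_compose2[of UNIV f] continuous_intros)
  next
    case (Suc k)
    have "((\<lambda>p. f (c *\<^sub>R (p - a))) has_derivative (\<lambda>h. c *\<^sub>R dder h f (c *\<^sub>R (p - a)))) (at p)" for p
    proof -
      have "((\<lambda>p. c *\<^sub>R (p - a)) has_derivative (\<lambda>h. c *\<^sub>R h)) (at p)"
        by (auto intro!: derivative_eq_intros)
      from has_derivative_compose[OF this smooth_onD(2)[OF Suc.prems]]
      show ?thesis by (simp add: linear_scale linear_frechet_derivative smooth_onD(1)[OF Suc.prems])
    qed
    then show ?case
      by (rule Ck_on_SucI[OF open_UNIV])
        (intro Ck_on_bounded_linear[OF bounded_linear_scaleR_right open_UNIV] Suc.IH smooth_onD(3) Suc.prems)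
  qed
  then show ?thesis by (simp add: smooth_on_def)
qed

lemma dders_scale_arg:
  assumes "smooth_on UNIV f"
  shows "dders hs (\<lambda>p. f (c *\<^sub>R p)) p = c ^ length hs *\<^sub>R dders hs f (c *\<^sub>R p)"
  using assms
proof (induction hs arbitrary: f)
  case (Cons h hs)
  have "((\<lambda>p. f (c *\<^sub>R p)) has_derivative (\<lambda>h. c *\<^sub>R dder h f (c *\<^sub>R p))) (at p)" for p
  proof -
    have "((\<lambda>p. c *\<^sub>R p) has_derivative (\<lambda>h. c *\<^sub>R h)) (at p)"
      by (auto intro!: derivative_eq_intros)
    from has_derivative_compose[OF this smooth_onD(2)[OF Cons.prems]]
    show ?thesis by (simp add: linear_scale linear_frechet_derivative smooth_onD(1)[OF Cons.prems])
  qed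
  then have "dder h (\<lambda>p. f (c *\<^sub>R p)) = (\<lambda>p. c *\<^sub>R dder h f (c *\<^sub>R p))"
    using dder_eqI by blast
  moreover have sm: "smooth_on UNIV (\<lambda>p. dder h f (c *\<^sub>R p))"
    using smooth_on_scale_arg[OF smooth_onD(3)[OF Cons.prems, of h], where c = c and a = 0] by simp
  ultimately show ?case
    using Cons.IH[OF smooth_onD(3)[OF Cons.prems], of h]
      dders_bounded_linear[OF bounded_linear_scaleR_right[of c] open_UNIV UNIV_I sm, of hs p]
    by (simp add: mult.commute)
qed simp

text \<open>Cuts a local section off to a global one that is unchanged near p, as needed for
  generators that are global sections.\<close>

lemma smooth_local_extension:
  fixes e :: "'a::euclidean_space \<Rightarrow> 'b::euclidean_space"
  assumes U: "open U" "p \<in> U" and e: "smooth_on U e"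
  obtains W \<beta> where "open W" "p \<in> W" "W \<subseteq> U" "\<And>q. q \<in> W \<Longrightarrow> \<beta> q = (1::real)" 
    "smooth_on UNIV (\<lambda>q. if q \<in> U then \<beta> q *\<^sub>R e q else 0)"
proof -
  obtain \<beta> :: "'a \<Rightarrow> real" where \<beta>: "smooth_on UNIV \<beta>" "\<And>p. norm p \<le> 1 \<Longrightarrow> \<beta> p = 1" "\<And>p. norm p \<ge> 2 \<Longrightarrow> \<beta> p = 0"
    using smooth_bump by blast
  obtain r where r: "r > 0" "cball p r \<subseteq> U" using U open_contains_cball by blast
  \<comment> \<open>The scaling 2 / r makes the bump equal to 1 on the ball of radius r / 2 and 0
    outside the ball of radius r. The cut-off function is thus smooth on U and, being zero, on the
    complement of the closed ball; these two open sets cover the space.\<close>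
  let ?\<beta> = "\<lambda>q. \<beta> ((2 / r) *\<^sub>R (q - p))" and ?W = "ball p (r / 2)"
  let ?f = "\<lambda>q. if q \<in> U then ?\<beta> q *\<^sub>R e q else 0"
  have "smooth_on U (\<lambda>q. ?\<beta> q *\<^sub>R e q)"
    by (intro smooth_intros U e smooth_on_subset[OF smooth_on_scale_arg[OF \<beta>(1)]]) simp
  then have 1: "smooth_on U ?f" by (subst smooth_on_cong[OF U(1)]) auto
  have nn: "norm ((2 / r) *\<^sub>R (q - p)) = 2 * dist p q / r" for q
    using r(1) by (simp add: dist_norm norm_minus_commute)
  have z: "?\<beta> q = 0" if "q \<in> - cball p r" for q
    by (rule \<beta>(3), unfold nn) (use that r in \<open>auto simp: pos_le_divide_eq\<close>)
  have 2: "smooth_on (- cball p r) ?f"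
    by (subst smooth_on_cong[of _ _ "\<lambda>_. 0"]) (use z in \<open>auto intro: smooth_intros\<close>)
  have "U \<union> - cball p r = UNIV" using r by auto
  then have "smooth_on UNIV ?f" using smooth_on_union[OF 1 2] U by (simp add: open_Compl)
  moreover have "?\<beta> q = 1" if "q \<in> ?W" for q
    by (rule \<beta>(2), unfold nn) (use that r in \<open>auto simp: pos_divide_le_eq\<close>)
  moreover have "?W \<subseteq> U" using r by (auto simp: subset_eq)
  ultimately show ?thesis using that[of ?W ?\<beta>] r by auto
qed

subsection \<open>Borel's lemma\<close>

text \<open>For each order the derivatives are eventually dominated by a geometric series. This
  property passes to the series of derivatives, so termwise differentiation can be iterated. The
  starting index may depend on the order, which is what Borel's lemma provides.\<close>

lemma smooth_on_series:
  fixes F :: "nat \<Rightarrow> 'a::euclidean_space \<Rightarrow> 'b::euclidean_space"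
  assumes "\<And>k. smooth_on UNIV (F k)"
    and "\<And>m. \<exists>N C. C \<ge> 0 \<and> (\<forall>k\<ge>N. \<forall>hs. length hs = m \<longrightarrow>
      (\<forall>p. norm (dders hs (F k) p) \<le> C * (1/2) ^ k * (\<Prod>h\<leftarrow>hs. norm h)))"
  shows "smooth_on UNIV (\<lambda>p. \<Sum>k. F k p)"
proof -
  define conv where "conv F \<longleftrightarrow> (\<forall>k. smooth_on UNIV (F k)) \<and> (\<forall>m. \<exists>N C. C \<ge> 0 \<and> (\<forall>k\<ge>N. \<forall>hs. length hs = m \<longrightarrow>
      (\<forall>p. norm (dders hs (F k) p) \<le> C * (1/2) ^ k * (\<Prod>h\<leftarrow>hs. norm h))))"
    for F :: "nat \<Rightarrow> 'a \<Rightarrow> 'b"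
  have conv_dder: "conv (\<lambda>k. dder h (F k))" if cF: "conv F" for F h
    unfolding conv_def
  proof (intro conjI allI)
    show "smooth_on UNIV (dder h (F k))" for k using cF smooth_onD(3) by (auto simp: conv_def)
    fix m
    obtain N C where NC: "C \<ge> 0" "\<And>k hs p. k \<ge> N \<Longrightarrow> length hs = Suc m \<Longrightarrow>
        norm (dders hs (F k) p) \<le> C * (1/2) ^ k * (\<Prod>h\<leftarrow>hs. norm h)"
      using cF unfolding conv_def by metis
    have "norm (dders hs (dder h (F k)) p) \<le> (C * norm h) * (1/2) ^ k * (\<Prod>h\<leftarrow>hs. norm h)"
      if "k \<ge> N" "length hs = m" for k hs p
      using NC(2)[of k "h # hs" p] that by (simp add: mult_ac)
    then show "\<exists>N C. C \<ge> 0 \<and> (\<forall>k\<ge>N. \<forall>hs. length hs = m \<longrightarrow>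
      (\<forall>p. norm (dders hs (dder h (F k)) p) \<le> C * (1/2) ^ k * (\<Prod>h\<leftarrow>hs. norm h)))"
      using NC(1) by (intro exI[of _ N] exI[of _ "C * norm h"]) auto
  qed
  have summ: "summable (\<lambda>k. F k p)" if "conv F" for F p
  proof -
    obtain N C where NC: "C \<ge> 0" "\<And>k hs p. k \<ge> N \<Longrightarrow> length hs = 0 \<Longrightarrow>
        norm (dders hs (F k) p) \<le> C * (1/2) ^ k * (\<Prod>h\<leftarrow>hs. norm h)"
      using \<open>conv F\<close> unfolding conv_def by metis
    show ?thesis
      by (rule summable_comparison_test'[of "\<lambda>k. C * (1/2) ^ k" N])
        (use NC(2)[of _ "[]"] in \<open>auto intro: summable_mult summable_geometric\<close>)
  qed
  have der: "((\<lambda>p. \<Sum>k. F k p) has_derivative (\<lambda>h. \<Sum>k. dder h (F k) p)) (at p)" if F: "conv F" for F p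
  proof -
    obtain N C where NC: "C \<ge> 0" "\<And>k hs p. k \<ge> N \<Longrightarrow> length hs = 1 \<Longrightarrow>
        norm (dders hs (F k) p) \<le> C * (1/2) ^ k * (\<Prod>h\<leftarrow>hs. norm h)"
      using F unfolding conv_def by metis
    have b: "norm (dder h (F k) p) \<le> C * norm h * (1/2) ^ k" if "k \<ge> N" for k h p
      using NC(2)[of k "[h]" p] that by (simp add: mult_ac)
    have tail: "norm ((\<Sum>i<n. dder h (F i) p) - (\<Sum>k. dder h (F k) p)) \<le> 2 * C * (1/2) ^ n * norm h"
      if "n \<ge> N" for n h p
    proof -
      have g: "(\<lambda>k. C * norm h * (1/2) ^ (k + n)) sums (C * norm h * (1/2) ^ n * 2)"
        using sums_mult[OF geometric_sums[of "1/2::real"], of "C * norm h * (1/2) ^ n"]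
        by (simp add: power_add mult_ac)
      have n: "norm (dder h (F (k + n)) p) \<le> C * norm h * (1/2) ^ (k + n)" for k
        using b that by simp
      have "norm (\<Sum>k. dder h (F (k + n)) p) \<le> (\<Sum>k. C * norm h * (1/2) ^ (k + n))"
        by (rule norm_suminf_le[OF n sums_summable[OF g]])
      moreover have sm: "summable (\<lambda>k. dder h (F k) p)" using summ[OF conv_dder[OF F]] .
      moreover have "(\<Sum>i<n. dder h (F i) p) - (\<Sum>k. dder h (F k) p) = - (\<Sum>k. dder h (F (k + n)) p)"
        using suminf_minus_initial_segment[OF sm, of n] by simp
      ultimately show ?thesis using sums_unique[OF g] by (simp add: mult_ac)
    qed
    have lim: "\<forall>\<^sub>F n in sequentially. \<forall>x\<in>UNIV. \<forall>h. norm ((\<Sum>i<n. dder h (F i) x) - (\<Sum>k. dder h (F k) x)) \<le> e * norm h"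
      if e: "e > 0" for e
    proof -
      have "(\<lambda>n. 2 * C * (1/2) ^ n) \<longlonglongrightarrow> 2 * C * 0"
        by (intro tendsto_intros LIMSEQ_power_zero) auto
      then have "\<forall>\<^sub>F n in sequentially. 2 * C * (1/2) ^ n < e" using e order_tendstoD(2) by fastforce
      then show ?thesis using eventually_ge_at_top[of N]
      proof eventually_elim
        case (elim n)
        then show ?case
          using tail[of n] mult_right_mono[of "2 * C * (1/2) ^ n" e] by (meson less_imp_le norm_ge_zero order_trans)
      qed
    qed
    obtain g where g: "\<And>x. (\<lambda>n. F n x) sums g x" "\<And>x. (g has_derivative (\<lambda>h. \<Sum>k. dder h (F k) x)) (at x)"
      using has_derivative_series[of UNIV F "\<lambda>n x h. dder h (F n) x" "\<lambda>x h. \<Sum>k. dder h (F k) x", OF convex_UNIV _ lim UNIV_I summable_sums[OF summ[OF F]]]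
        smooth_onD(2)[of UNIV "F _"] F by (auto simp: conv_def)
    have "g = (\<lambda>p. \<Sum>k. F k p)" using g(1) sums_unique by blast
    then show ?thesis using g(2) by simp
  qed
  have "Ck_on k UNIV (\<lambda>p. \<Sum>k. F k p)" if "conv F" for k F
    using that
  proof (induction k arbitrary: F)
    case 0
    then show ?case using der[OF 0] by (auto intro!: continuous_at_imp_continuous_on has_derivative_continuous)
  next
    case (Suc k)
    show ?case by (rule Ck_on_SucI[OF open_UNIV der[OF Suc.prems]]) (rule Suc.IH[OF conv_dder[OF Suc.prems]])
  qed
  moreover have "conv F" using assms by (simp add: conv_def)
  ultimately show ?thesis by (simp add: smooth_on_def)
qed

lemma norm_le_of_diff_add:
  fixes a b d :: "'a::real_normed_vector"
  assumes "norm (a - (b + d)) \<le> c"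
  shows "norm d \<le> c + norm a + norm b"
  using assms norm_triangle_ineq4[of "a - b" "a - (b + d)"] norm_triangle_ineq4[of a b] by simp

lemma dders_zero: "dders hs (\<lambda>_. 0) p = 0"
  by (induction hs) auto

text \<open>The k-th term is cut off at a radius of size \<open>\<epsilon> k\<close>. By homogeneity
  the result is a rescaled copy of one fixed function with prefactor
  \<open>\<epsilon> k ^ k\<close>, so m derivatives still leave the power k - m; for k > m a small
  \<open>\<epsilon> k\<close> therefore makes the series converge with its m-th derivatives.\<close>

lemma borel_homogeneous:
  fixes r :: "nat \<Rightarrow> 'a::euclidean_space \<Rightarrow> 'b::euclidean_space"
  assumes sm: "\<And>k. smooth_on UNIV (r k)"
    and hom: "\<And>k c p. r k (c *\<^sub>R p) = c ^ k *\<^sub>R r k p"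
  obtains f where "smooth_on UNIV f"
    "\<And>N. \<exists>C e. e > 0 \<and> (\<forall>p. norm p < e \<longrightarrow> norm (f p - (\<Sum>k<N. r k p)) \<le> C * norm p ^ N)"
proof -
  obtain \<beta> :: "'a \<Rightarrow> real" where \<beta>: "smooth_on UNIV \<beta>"
      "\<And>p. norm p \<le> 1 \<Longrightarrow> \<beta> p = 1" "\<And>p. norm p \<ge> 2 \<Longrightarrow> \<beta> p = 0"
    using smooth_bump by blast
  define \<phi> where "\<phi> k p = \<beta> p *\<^sub>R r k p" for k p
  have \<phi>: "smooth_on UNIV (\<phi> k)" for k
    unfolding \<phi>_def by (intro smooth_intros \<beta> sm open_UNIV)
  have ex: "\<exists>M\<ge>0. \<forall>hs. length hs = m \<longrightarrow> (\<forall>p. norm (dders hs (\<phi> k) p) \<le> M * (\<Prod>h\<leftarrow>hs. norm h))" for k m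
  proof -
    obtain M where M: "M \<ge> 0" "\<And>hs p. length hs = m \<Longrightarrow> p \<in> cball 0 2 \<Longrightarrow> norm (dders hs (\<phi> k) p) \<le> M * (\<Prod>h\<leftarrow>hs. norm h)"
      using dders_bounded_on_compact[OF open_UNIV _ _ \<phi>, of "cball 0 2" m k] by auto
    have "norm (dders hs (\<phi> k) p) \<le> M * (\<Prod>h\<leftarrow>hs. norm h)" if hs: "length hs = m" for hs p
    proof (cases "p \<in> cball 0 2")
      case False
      have "dders hs (\<phi> k) p = dders hs (\<lambda>_. 0) p"
        by (rule dders_cong[of "- cball 0 2"]) (use False \<beta>(3) in \<open>auto simp: \<phi>_def\<close>)
      moreover have "(\<Prod>h\<leftarrow>hs. norm h) \<ge> 0" by (rule prod_list_nonneg) auto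
      ultimately show ?thesis using M(1) by (simp add: dders_zero)
    qed (use M(2)[OF hs] in auto)
    then show ?thesis using M(1) by blast
  qed
  have "\<exists>M. \<forall>k m. M k m \<ge> 0 \<and>
      (\<forall>hs. length hs = m \<longrightarrow> (\<forall>p. norm (dders hs (\<phi> k) p) \<le> M k m * (\<Prod>h\<leftarrow>hs. norm h)))"
    by (intro choice allI ex)
  then obtain M where M: "\<And>k m. M k m \<ge> 0"
      "\<And>k m hs p. length hs = m \<Longrightarrow> norm (dders hs (\<phi> k) p) \<le> M k m * (\<Prod>h\<leftarrow>hs. norm h)"
    by blast
  have "\<exists>S\<ge>0. \<forall>z. norm (\<phi> k z) \<le> S * norm z ^ k" for k
  proof -
    have "continuous_on A \<beta>" "continuous_on A (r k)" for A
      using continuous_on_subset[OF smooth_onD(4)[OF \<beta>(1)]]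
        continuous_on_subset[OF smooth_onD(4)[OF sm]] by auto
    then have "compact (\<beta> ` cball 0 2)" "compact (r k ` cball 0 1)"
      using compact_continuous_image compact_cball by blast+
    then obtain B R where BR: "\<And>z. z \<in> cball 0 2 \<Longrightarrow> norm (\<beta> z) \<le> B" "\<And>z. z \<in> cball 0 1 \<Longrightarrow> norm (r k z) \<le> R"
      using compact_imp_bounded bounded_iff by (metis imageI)
    have B: "B \<ge> 0" "R \<ge> 0" using order_trans[OF norm_ge_zero BR(1)[of 0]] order_trans[OF norm_ge_zero BR(2)[of 0]] by auto
    have "norm (\<phi> k z) \<le> (B * R) * norm z ^ k" for z
    proof (cases "norm z \<le> 2")
      case True
      have "r k z = norm z ^ k *\<^sub>R r k ((1 / norm z) *\<^sub>R z)" if "z \<noteq> 0"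
        using hom[of k "norm z" "(1 / norm z) *\<^sub>R z"] that by simp
      moreover have "r k 0 = 0" if "k \<noteq> 0" using hom[of k 0 0] that by (simp add: power_0_left)
      ultimately have "norm (r k z) \<le> norm z ^ k * R"
        using BR(2)[of "(1 / norm z) *\<^sub>R z"] BR(2)[of 0] B
        by (cases "z = 0"; cases "k = 0") (auto intro: mult_left_mono)
      then have "norm (\<beta> z) * norm (r k z) \<le> B * (norm z ^ k * R)"
        using BR(1)[of z] True B by (intro mult_mono) auto
      then show ?thesis by (simp add: \<phi>_def mult_ac)
    next
      case False
      then show ?thesis using \<beta>(3)[of z] B by (simp add: \<phi>_def)
    qed
    then show ?thesis using B by (intro exI[of _ "B * R"]) auto
  qed
  then obtain S where S: "\<And>k. S k \<ge> 0" "\<And>k z. norm (\<phi> k z) \<le> S k * norm z ^ k" by metis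
  \<comment> \<open>The denominator collects what \<open>\<epsilon> k\<close> has to beat: the
    bounds \<open>M k m\<close> for the derivatives of order m < k and the growth constant
    \<open>S k\<close>. The summand 1 keeps it positive and \<open>\<epsilon> k\<close> at most
    1.\<close>
  define \<epsilon> where "\<epsilon> k = (1/2) ^ k / (1 + S k + (\<Sum>m<k. M k m))" for k
  have den: "1 + S k + (\<Sum>m<k. M k m) \<ge> 1" for k using S(1) M(1) by (simp add: sum_nonneg)
  have den0: "1 + S k + (\<Sum>m<k. M k m) > 0" for k using den[of k] by linarith
  have \<epsilon>: "\<epsilon> k > 0" "\<epsilon> k \<le> 1" for k
  proof -
    show "\<epsilon> k > 0" unfolding \<epsilon>_def using den0 by simp
    have "(1/2::real) ^ k \<le> 1" by (simp add: power_le_one)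
    then show "\<epsilon> k \<le> 1" unfolding \<epsilon>_def using den[of k] den0[of k] by (simp only: divide_le_eq_1_pos)
  qed
  have \<epsilon>S: "\<epsilon> k * c \<le> (1/2) ^ k" if "c \<le> 1 + S k + (\<Sum>m<k. M k m)" for k c
  proof -
    have "\<epsilon> k * c \<le> \<epsilon> k * (1 + S k + (\<Sum>m<k. M k m))" using \<epsilon> that by (intro mult_left_mono) (auto simp: less_imp_le)
    also have "\<dots> = (1/2) ^ k" using den0[of k] by (simp add: \<epsilon>_def)
    finally show ?thesis .
  qed
  define F where "F k p = \<epsilon> k ^ k *\<^sub>R \<phi> k ((1 / \<epsilon> k) *\<^sub>R p)" for k p
  have F: "F k p = \<beta> ((1 / \<epsilon> k) *\<^sub>R p) *\<^sub>R r k p" for k p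
    using \<epsilon>(1)[of k] by (simp add: F_def \<phi>_def hom power_divide)
  have Fs: "smooth_on UNIV (F k)" for k
    unfolding F_def using smooth_on_scale_arg[OF \<phi>, of k "1 / \<epsilon> k" 0] by (intro smooth_intros) auto
  have Fb: "norm (dders hs (F k) p) \<le> 1 * (1/2) ^ k * (\<Prod>h\<leftarrow>hs. norm h)"
    if k: "k \<ge> Suc m" and hs: "length hs = m" for k m hs p
  proof -
    have pr: "(\<Prod>h\<leftarrow>hs. norm h) \<ge> 0" by (rule prod_list_nonneg) auto
    have s: "smooth_on UNIV (\<lambda>p. \<phi> k ((1 / \<epsilon> k) *\<^sub>R p))"
      using smooth_on_scale_arg[OF \<phi>, of k "1 / \<epsilon> k" 0] by simp
    have "dders hs (F k) p = \<epsilon> k ^ k *\<^sub>R ((1 / \<epsilon> k) ^ m *\<^sub>R dders hs (\<phi> k) ((1 / \<epsilon> k) *\<^sub>R p))"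
      unfolding F_def[abs_def] dders_bounded_linear[OF bounded_linear_scaleR_right open_UNIV UNIV_I s]
      using dders_scale_arg[OF \<phi>, of hs k "1 / \<epsilon> k" p] hs by simp
    also have "\<dots> = \<epsilon> k ^ (k - m) *\<^sub>R dders hs (\<phi> k) ((1 / \<epsilon> k) *\<^sub>R p)"
      using \<epsilon>(1)[of k] k by (simp add: power_divide power_diff)
    finally have "norm (dders hs (F k) p) = \<epsilon> k ^ (k - m) * norm (dders hs (\<phi> k) ((1 / \<epsilon> k) *\<^sub>R p))"
      using \<epsilon>(1)[of k] by simp
    also have "\<dots> \<le> \<epsilon> k * (M k m * (\<Prod>h\<leftarrow>hs. norm h))"
    proof (rule mult_mono)
      show "\<epsilon> k ^ (k - m) \<le> \<epsilon> k" using power_decreasing[of 1 "k - m" "\<epsilon> k"] \<epsilon>[of k] k by simp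
    qed (use M(2)[OF hs] \<epsilon>(1)[of k] in auto)
    also have "\<dots> \<le> (1/2) ^ k * (\<Prod>h\<leftarrow>hs. norm h)"
    proof -
      have "M k m \<le> (\<Sum>m<k. M k m)" using k M(1) by (intro member_le_sum) auto
      then have "\<epsilon> k * M k m \<le> (1/2) ^ k" using S(1)[of k] by (intro \<epsilon>S) auto
      then show ?thesis using pr mult_right_mono by (fastforce simp: mult.assoc[symmetric])
    qed
    finally show ?thesis by simp
  qed
  have "smooth_on UNIV (\<lambda>p. \<Sum>k. F k p)"
  proof (rule smooth_on_series[OF Fs])
    fix m show "\<exists>N C. C \<ge> 0 \<and> (\<forall>k\<ge>N. \<forall>hs. length hs = m \<longrightarrow>
        (\<forall>p. norm (dders hs (F k) p) \<le> C * (1/2) ^ k * (\<Prod>h\<leftarrow>hs. norm h)))"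
      by (rule exI[of _ "Suc m"], rule exI[of _ 1]) (use Fb in auto)
  qed
  moreover have "\<exists>C e. e > 0 \<and> (\<forall>p. norm p < e \<longrightarrow> norm ((\<Sum>k. F k p) - (\<Sum>k<N. r k p)) \<le> C * norm p ^ N)" for N
  proof -
    \<comment> \<open>Below this radius the cut-offs of the terms with k < N are all equal to 1, so
      these terms are exactly \<open>r k\<close>.\<close>
    define e where "e = Min (insert 1 (\<epsilon> ` {..<N}))"
    have e: "e > 0" "e \<le> 1" "\<And>k. k < N \<Longrightarrow> e \<le> \<epsilon> k" using \<epsilon> by (auto simp: e_def)
    \<comment> \<open>The term k = N contributes \<open>S N\<close>, and the later terms contribute
      a geometric series with sum 2 * 2.\<close>
    have "norm ((\<Sum>k. F k p) - (\<Sum>k<N. r k p)) \<le> (S N + 4) * norm p ^ N" if p: "norm p < e" for p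
    proof -
      have p1: "norm p \<le> 1" using p e by auto
      have Fr: "F k p = r k p" if "k < N" for k
      proof -
        have "norm ((1 / \<epsilon> k) *\<^sub>R p) \<le> 1" using p e(3)[OF that] \<epsilon>(1)[of k] by (simp add: divide_le_eq)
        then show ?thesis using \<beta>(2) by (simp add: F)
      qed
      have FS: "norm (F k p) \<le> S k * norm p ^ k" for k
      proof -
        have "norm (F k p) \<le> \<epsilon> k ^ k * (S k * norm ((1 / \<epsilon> k) *\<^sub>R p) ^ k)"
          using S(2)[of k "(1 / \<epsilon> k) *\<^sub>R p"] \<epsilon>(1)[of k] by (simp add: F_def)
        then show ?thesis using \<epsilon>(1)[of k] by (simp add: power_divide power_mult_distrib)
      qed
      \<comment> \<open>Where \<open>F k p\<close> is nonzero, the norm of p is below 2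
        \<open>\<epsilon> k\<close>. One of the surplus factors \<open>norm p\<close> is spent on
        this bound and turns \<open>S k\<close> into a power of 1/2.\<close>
      have Fk: "norm (F k p) \<le> 2 * norm p ^ N * (1/2) ^ k" if k: "k > N" for k
      proof (cases "norm p < 2 * \<epsilon> k")
        case False
        then have "\<beta> ((1 / \<epsilon> k) *\<^sub>R p) = 0" using \<epsilon>(1)[of k] by (intro \<beta>(3)) (simp add: le_divide_eq)
        then show ?thesis by (simp add: F)
      next
        case True
        have "norm p ^ k = norm p ^ N * norm p ^ (k - N)" using k by (simp add: power_add[symmetric])
        also have "\<dots> \<le> norm p ^ N * norm p ^ 1"
          using p1 k by (intro mult_left_mono power_decreasing) auto
        also have "\<dots> \<le> norm p ^ N * (2 * \<epsilon> k)" using True by (intro mult_left_mono) auto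
        finally have "S k * norm p ^ k \<le> S k * (norm p ^ N * (2 * \<epsilon> k))" using S(1) by (intro mult_left_mono)
        also have "\<dots> = 2 * norm p ^ N * (\<epsilon> k * S k)" by (simp add: mult_ac)
        also have "\<dots> \<le> 2 * norm p ^ N * (1/2) ^ k"
          by (intro mult_left_mono \<epsilon>S) (use sum_nonneg[of "{..<k}" "M k"] M(1) in auto)
        finally show ?thesis using FS[of k] by simp
      qed
      have g: "(\<lambda>k. 2 * norm p ^ N * (1/2) ^ k) sums (2 * norm p ^ N * 2)"
        using sums_mult[OF geometric_sums[of "1/2::real"], of "2 * norm p ^ N"] by simp
      have b: "norm (F (k + Suc N) p) \<le> 2 * norm p ^ N * (1/2) ^ k" for k
      proof (rule order_trans[OF Fk])
        show "2 * norm p ^ N * (1/2) ^ (k + Suc N) \<le> 2 * norm p ^ N * (1/2) ^ k"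
          by (intro mult_left_mono power_decreasing) simp_all
      qed simp
      have sumF: "summable (\<lambda>k. F (k + Suc N) p)"
        by (rule summable_comparison_test'[OF sums_summable[OF g], of 0]) (use b in auto)
      then have sumF': "summable (\<lambda>k. F k p)" using summable_iff_shift by blast
      have "(\<Sum>k. F k p) = (\<Sum>k. F (k + Suc N) p) + (\<Sum>k<Suc N. F k p)"
        using suminf_split_initial_segment[OF sumF', of "Suc N"] by simp
      then have "(\<Sum>k. F k p) - (\<Sum>k<N. r k p) = (\<Sum>k. F (k + Suc N) p) + F N p"
        using Fr by simp
      moreover have "norm (\<Sum>k. F (k + Suc N) p) \<le> (\<Sum>k. 2 * norm p ^ N * (1/2) ^ k)"
        by (rule norm_suminf_le[OF b sums_summable[OF g]])
      ultimately have "norm ((\<Sum>k. F k p) - (\<Sum>k<N. r k p)) \<le> 2 * norm p ^ N * 2 + S N * norm p ^ N"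
        using sums_unique[OF g] FS[of N] norm_triangle_ineq[of "\<Sum>k. F (k + Suc N) p" "F N p"] by simp
      then show ?thesis by (simp add: algebra_simps)
    qed
    then show ?thesis using e(1) by blast
  qed
  ultimately show ?thesis using that by blast
qed

subsection \<open>Flat functions\<close>

text \<open>Flatness is stated as decay rather than as vanishing of Taylor coefficients, so that it
  passes through products with functions that are merely continuous at 0. The point p = 0 is
  included, hence N = 1 forces f 0 = 0.\<close>

definition flat_at_0 :: "('a::real_normed_vector \<Rightarrow> 'b::real_normed_vector) \<Rightarrow> bool" where
  "flat_at_0 f \<longleftrightarrow> (\<forall>N. \<exists>C e. e > 0 \<and> (\<forall>p. norm p < e \<longrightarrow> norm (f p) \<le> C * norm p ^ N))"

lemma flat_at_0D:
  assumes "flat_at_0 f"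
  obtains C e where "C \<ge> 0" "e > 0" "\<And>p. norm p < e \<Longrightarrow> norm (f p) \<le> C * norm p ^ N"
proof -
  obtain C e where Ce: "e > 0" "\<And>p. norm p < e \<Longrightarrow> norm (f p) \<le> C * norm p ^ N"
    using assms unfolding flat_at_0_def by metis
  have "norm (f p) \<le> max C 0 * norm p ^ N" if "norm p < e" for p
    using Ce(2)[OF that] mult_right_mono[of C "max C 0" "norm p ^ N"] by simp
  then show ?thesis using that[of "max C 0" e] Ce by simp
qed

lemma flat_at_0_diff:
  assumes "flat_at_0 f" "flat_at_0 g" shows "flat_at_0 (\<lambda>p. f p - g p)"
  unfolding flat_at_0_def
proof
  fix N
  obtain C e C' e' where *: "e > 0" "\<And>p. norm p < e \<Longrightarrow> norm (f p) \<le> C * norm p ^ N"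
      "e' > 0" "\<And>p. norm p < e' \<Longrightarrow> norm (g p) \<le> C' * norm p ^ N"
    using assms unfolding flat_at_0_def by metis
  have "norm (f p - g p) \<le> (C + C') * norm p ^ N" if "norm p < min e e'" for p
    using *(2)[of p] *(4)[of p] that norm_triangle_ineq4[of "f p" "g p"] by (simp add: distrib_right)
  then show "\<exists>C e. e > 0 \<and> (\<forall>p. norm p < e \<longrightarrow> norm (f p - g p) \<le> C * norm p ^ N)"
    using * by (intro exI[of _ "C + C'"] exI[of _ "min e e'"]) auto
qed

lemma flat_at_0_bilinear:
  assumes "bounded_bilinear B" "flat_at_0 g" "isCont f 0"
  shows "flat_at_0 (\<lambda>p. B (f p) (g p))"
  unfolding flat_at_0_def
proof
  fix N
  obtain K where K: "K > 0" "\<And>a b. norm (B a b) \<le> norm a * norm b * K"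
    using bounded_bilinear.pos_bounded[OF assms(1)] by blast
  obtain C e where Ce: "C \<ge> 0" "e > 0" "\<And>p. norm p < e \<Longrightarrow> norm (g p) \<le> C * norm p ^ N"
    using flat_at_0D[OF assms(2)] by metis
  obtain d where d: "d > 0" "\<And>p. dist p 0 < d \<Longrightarrow> dist (f p) (f 0) < 1"
    using assms(3) unfolding continuous_at_eps_delta by (meson zero_less_one)
  have "norm (B (f p) (g p)) \<le> ((norm (f 0) + 1) * C * K) * norm p ^ N" if "norm p < min e d" for p
  proof -
    have "norm (f p) \<le> norm (f 0) + 1"
      using d(2)[of p] that norm_triangle_ineq2[of "f p" "f 0"] by (simp add: dist_norm)
    then have "norm (f p) * norm (g p) \<le> (norm (f 0) + 1) * (C * norm p ^ N)"
      using Ce(3)[of p] that by (intro mult_mono) auto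
    then have "norm (f p) * norm (g p) * K \<le> (norm (f 0) + 1) * (C * norm p ^ N) * K"
      using K(1) by (intro mult_right_mono) auto
    then show ?thesis using K(2)[of "f p" "g p"] by (simp add: mult_ac)
  qed
  then show "\<exists>C e. e > 0 \<and> (\<forall>p. norm p < e \<longrightarrow> norm (B (f p) (g p)) \<le> C * norm p ^ N)"
    using Ce d by (intro exI[of _ "(norm (f 0) + 1) * C * K"] exI[of _ "min e d"]) auto
qed

text \<open>
  Difference quotients with step \<open>\<bar>p\<bar>\<^sup>N\<close> bound the derivative at \<open>p\<close>, since the second
  derivatives are bounded.
\<close>

lemma flat_at_0_dder:
  fixes f :: "'a::euclidean_space \<Rightarrow> 'b::euclidean_space"
  assumes U: "open U" "0 \<in> U" and f: "smooth_on U f" "flat_at_0 f"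
  shows "flat_at_0 (dder h f)"
proof -
  obtain r where r: "r > 0" "cball 0 r \<subseteq> U" using U open_contains_cball by blast
  obtain C where C: "C \<ge> 0" "\<And>a h. (\<And>s. s \<in> {0..1} \<Longrightarrow> a + s *\<^sub>R h \<in> cball 0 r) \<Longrightarrow>
      norm (f (a + h) - (\<Sum>j<2. (1 / fact j) *\<^sub>R dders (replicate j h) f a)) \<le> C * norm h ^ 2"
    using taylor_bound[OF U(1) compact_cball r(2) f(1), of 2] by blast
  have *: "\<exists>C e. e > 0 \<and> (\<forall>p. norm p < e \<longrightarrow> norm (dder h f p) \<le> C * norm p ^ N)" if N: "N \<ge> 1" for N
  proof -
    \<comment> \<open>Decay of order 2 N leaves order N after division by the step size
      \<open>norm p ^ N\<close>.\<close>
    obtain D e where De: "D \<ge> 0" "e > 0" "\<And>p. norm p < e \<Longrightarrow> norm (f p) \<le> D * norm p ^ (2 * N)"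
      using flat_at_0D[OF f(2)] by metis
    let ?H = "1 + norm h"
    have H: "?H > 0" using norm_ge_zero[of h] by linarith
    \<comment> \<open>Keeps p and the displaced point inside both the ball where the decay estimate
      holds and the one where the Taylor estimate holds. The bound 1 gives
      \<open>norm p ^ N \<le> norm p\<close>.\<close>
    define d where "d = Min {1, e / ?H, r / ?H}"
    have d: "d > 0" "d \<le> 1" "d \<le> e / ?H" "d \<le> r / ?H" using De r H by (auto simp: d_def)
    have main: "norm (dder h f p) \<le> (D * ?H ^ (2 * N) + D + C * norm h ^ 2) * norm p ^ N" if p: "norm p < d" "p \<noteq> 0" for p
    proof -
      let ?k = "norm p ^ N *\<^sub>R h"
      have pN: "norm p ^ N > 0" "norm p ^ N \<le> norm p"
        using p d N power_decreasing[of 1 N "norm p"] by auto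
      have "norm p * ?H < d * ?H" using p H by (intro mult_strict_right_mono) auto
      moreover have "d * ?H \<le> e" "d * ?H \<le> r" using d H by (simp_all add: pos_le_divide_eq)
      ultimately have pH: "norm p * ?H < e" "norm p * ?H \<le> r" by auto
      have le: "norm (p + s *\<^sub>R ?k) \<le> norm p * ?H" if "s \<in> {0..1}" for s
      proof -
        have "norm (p + s *\<^sub>R ?k) \<le> norm p + s * (norm p ^ N * norm h)"
          using norm_triangle_ineq[of p "s *\<^sub>R ?k"] that by simp
        also have "s * (norm p ^ N * norm h) \<le> 1 * (norm p * norm h)"
          using that pN by (intro mult_mono) auto
        finally show ?thesis by (simp add: algebra_simps)
      qed
      have T: "norm (f (p + ?k) - (\<Sum>j<2. (1 / fact j) *\<^sub>R dders (replicate j ?k) f p)) \<le> C * norm ?k ^ 2"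
      proof (rule C(2))
        fix s :: real assume "s \<in> {0..1}"
        then show "p + s *\<^sub>R ?k \<in> cball 0 r" using le[of s] pH by simp
      qed
      have pU: "p \<in> U" using le[of 0] pH r by auto
      have T2: "(\<Sum>j<2. (1 / fact j) *\<^sub>R dders (replicate j ?k) f p) = f p + norm p ^ N *\<^sub>R dder h f p"
        by (simp add: numeral_2_eq_2 linear_scale linear_frechet_derivative smooth_onD(1)[OF f(1) pU])
      then have "norm (norm p ^ N *\<^sub>R dder h f p) \<le> C * norm ?k ^ 2 + norm (f (p + ?k)) + norm (f p)"
        using norm_le_of_diff_add[OF T[unfolded T2]] by simp
      also have "norm (f (p + ?k)) \<le> D * (norm p * ?H) ^ (2 * N)"
      proof -
        have "norm (f (p + ?k)) \<le> D * norm (p + ?k) ^ (2 * N)"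
          using le[of 1] pH by (intro De(3)) auto
        also have "\<dots> \<le> D * (norm p * ?H) ^ (2 * N)"
          using le[of 1] De(1) by (intro mult_left_mono power_mono) auto
        finally show ?thesis .
      qed
      also have "norm (f p) \<le> D * norm p ^ (2 * N)"
        using le[of 0] pH by (intro De(3)) auto
      finally have fin: "norm (norm p ^ N *\<^sub>R dder h f p)
          \<le> C * norm ?k ^ 2 + D * (norm p * ?H) ^ (2 * N) + D * norm p ^ (2 * N)" by simp
      have e1: "(norm p * ?H) ^ (2 * N) = norm p ^ N * (norm p ^ N * ?H ^ (2 * N))"
        by (simp add: power_mult_distrib mult_2 power_add mult.assoc)
      have e2: "norm p ^ (2 * N) = norm p ^ N * norm p ^ N" by (simp add: mult_2 power_add)
      have e3: "norm ?k ^ 2 = norm p ^ N * (norm p ^ N * norm h ^ 2)"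
        by (simp add: power2_eq_square mult_ac)
      have "norm p ^ N * norm (dder h f p) \<le> norm p ^ N * ((D * ?H ^ (2 * N) + D + C * norm h ^ 2) * norm p ^ N)"
        using fin unfolding e1 e2 e3 by (simp add: algebra_simps)
      then show ?thesis using pN by simp
    qed
    have "norm (dder h f p) \<le> (D * ?H ^ (2 * N) + D + C * norm h ^ 2) * norm p ^ N" if p: "norm p < d" for p
    proof (cases "p = 0")
      case True
      have "(dder h f \<longlongrightarrow> dder h f 0) (at 0)"
        using smooth_onD(4)[OF smooth_onD(3)[OF f(1)]] U continuous_on_eq_continuous_at isContD by blast
      then have "((\<lambda>p. norm (dder h f p)) \<longlongrightarrow> norm (dder h f 0)) (at 0)" by (rule tendsto_norm)
      moreover have "((\<lambda>p::'a. (D * ?H ^ (2 * N) + D + C * norm h ^ 2) * norm p ^ N) \<longlongrightarrow>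
          (D * ?H ^ (2 * N) + D + C * norm h ^ 2) * norm (0::'a) ^ N) (at 0)"
        by (intro tendsto_intros)
      moreover have "\<forall>\<^sub>F p in at 0. norm (dder h f p) \<le> (D * ?H ^ (2 * N) + D + C * norm h ^ 2) * norm p ^ N"
        unfolding eventually_at using d(1) main by (intro exI[of _ d]) auto
      ultimately show ?thesis unfolding True by (intro tendsto_le) auto
    qed (use main p in auto)
    then show ?thesis using d(1) by blast
  qed
  show ?thesis
    unfolding flat_at_0_def
  proof
    fix N show "\<exists>C e. e > 0 \<and> (\<forall>p. norm p < e \<longrightarrow> norm (dder h f p) \<le> C * norm p ^ N)"
    proof (cases "N = 0")
      case True
      obtain C e where Ce: "e > 0" "\<And>p. norm p < e \<Longrightarrow> norm (dder h f p) \<le> C * norm p ^ 1"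
        using *[of 1] by auto
      have "norm (dder h f p) \<le> max C 0 * norm p ^ 0" if "norm p < min e 1" for p
      proof -
        have "C * norm p ^ 1 \<le> max C 0 * 1" using that by (intro mult_mono) auto
        then show ?thesis using Ce(2)[of p] that by simp
      qed
      then show ?thesis unfolding True using Ce(1) by (intro exI[of _ "max C 0"] exI[of _ "min e 1"]) auto
    qed (use * in auto)
  qed
qed

lemma continuous_on_eq_at_limit:
  fixes f g :: "'a::euclidean_space \<Rightarrow> 'b::t2_space"
  assumes "open U" "continuous_on U f" "continuous_on U g" "a \<in> U" "\<And>p. p \<in> U - {a} \<Longrightarrow> f p = g p"
  shows "f a = g a"
proof (rule tendsto_unique)
  have c: "(f \<longlongrightarrow> f a) (at a)" "(g \<longlongrightarrow> g a) (at a)"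
    using assms continuous_on_eq_continuous_at isContD by blast+
  show "(g \<longlongrightarrow> g a) (at a)" by (rule c)
  have "\<forall>\<^sub>F p in at a. f p = g p"
    using assms(1,4,5) by (auto simp: eventually_at_topological)
  then show "(g \<longlongrightarrow> f a) (at a)" using Lim_transform_eventually[OF c(1)] by simp
qed simp

text \<open>Flat functions are stable under derivatives and under multiplication by smooth
  functions, and they absorb every power of |p|^2 in a denominator. So all iterated derivatives of
  the quotient stay bounded at 0.\<close>

lemma flat_at_0_divide_norm_power2:
  fixes w :: "'a::euclidean_space \<Rightarrow> 'b::euclidean_space"
  assumes dim: "DIM('a) \<ge> 2" and U: "open U" "0 \<in> U" and w: "smooth_on U w" "flat_at_0 w"
  obtains g where "smooth_on U g" "\<And>p. p \<in> U \<Longrightarrow> w p = (norm p)\<^sup>2 *\<^sub>R g p"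
proof -
  let ?q = "\<lambda>p::'a. (norm p)\<^sup>2"
  let ?g = "\<lambda>p. inverse (?q p) *\<^sub>R w p"
  have qs: "smooth_on V ?q" if "open V" for V by (intro smooth_intros that)
  have U': "open (U - {0})" using U by auto
  have gs: "smooth_on (U - {0}) ?g"
    by (intro smooth_intros smooth_on_inverse U' qs smooth_on_subset[OF w(1)]) auto
  have cl: "flat_at_0 (\<lambda>p. ?q p *\<^sub>R dder h f p - (real m * dder h ?q p) *\<^sub>R f p)"
    if f: "smooth_on U f" "flat_at_0 f" for f :: "'a \<Rightarrow> 'b" and h m
  proof (intro flat_at_0_diff flat_at_0_bilinear[OF bounded_bilinear_scaleR] flat_at_0_dder[OF U] f)
    show "isCont ?q 0" by (intro continuous_intros)
    have "continuous_on UNIV (dder h ?q)" by (rule smooth_onD(4)[OF smooth_onD(3)[OF qs]]) simp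
    then show "isCont (\<lambda>p. real m * dder h ?q p) 0"
      by (intro continuous_intros) (simp add: continuous_on_eq_continuous_at)
  qed
  have bd: "\<exists>K. \<forall>\<^sub>F p in at 0. norm (g p) \<le> K"
    if "smooth_on U f" and f1: "flat_at_0 f" and "smooth_on (U - {0}) g"
      and f2: "\<And>p. p \<in> U - {0} \<Longrightarrow> ?q p ^ m *\<^sub>R g p = f p" for f g :: "'a \<Rightarrow> 'b" and m
  proof -
    obtain C e where Ce: "e > 0" "\<And>p. norm p < e \<Longrightarrow> norm (f p) \<le> C * norm p ^ (2 * m)"
      using flat_at_0D[OF f1, of "2 * m"] by metis
    have "\<forall>\<^sub>F p in at 0. p \<in> U - {0}" using U by (auto simp: eventually_at_topological)
    moreover have "\<forall>\<^sub>F p in at 0. norm p < e" using Ce(1) by (auto simp: eventually_at)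
    ultimately have "\<forall>\<^sub>F p in at 0. norm (g p) \<le> C"
    proof eventually_elim
      case (elim p)
      have "norm p ^ (2 * m) * norm (g p) = norm (f p)"
        unfolding f2[OF elim(1), symmetric] by (simp add: power_mult)
      then have "norm p ^ (2 * m) * norm (g p) \<le> norm p ^ (2 * m) * C" using Ce(2)[OF elim(2)] by (simp add: mult.commute)
      moreover have "norm p ^ (2 * m) > 0" using elim by simp
      ultimately show ?case by simp
    qed
    then show ?thesis by blast
  qed
  obtain g where g: "smooth_on U g" "\<And>p. p \<noteq> 0 \<Longrightarrow> g p = ?g p"
  proof (rule removable_singularity_quotient[where P = flat_at_0 and m = 1,
        OF dim U qs[OF U(1)] cl _ gs w])
    show "\<exists>K. \<forall>\<^sub>F p in at 0. norm (g p) \<le> K" if "smooth_on U f" "flat_at_0 f" "smooth_on (U - {0}) g"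
      "\<And>p. p \<in> U - {0} \<Longrightarrow> ?q p ^ m *\<^sub>R g p = f p" for f g :: "'a \<Rightarrow> 'b" and m
      by (rule bd[OF that])
  qed auto
  have "w p = ?q p *\<^sub>R g p" if "p \<in> U" for p
  proof (cases "p = 0")
    case True
    obtain C e where Ce: "e > 0" "\<And>p. norm p < e \<Longrightarrow> norm (w p) \<le> C * norm p ^ 1"
      using flat_at_0D[OF w(2), of 1] by metis
    show ?thesis using True Ce(2)[of 0] Ce(1) by simp
  qed (simp add: g)
  then show ?thesis using that g by blast
qed

subsection \<open>Smooth division by coprime quadratic forms\<close>

lemma add_scaleR_self_neq_0:
  fixes z :: "'a::real_vector"
  assumes "z \<noteq> 0" "t > 0" shows "z + t *\<^sub>R z \<noteq> 0"
  using assms scaleR_left_distrib[of 1 t z] by (metis add_pos_pos less_irrefl scaleR_eq_0_iff scaleR_one zero_less_one)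

text \<open>Fix x \<noteq> 0 and move along s \<mapsto> (x, s y). Here f is |s y|^(2m) times a
  function bounded on the segment, so its Taylor coefficients of order below 2m at (x, 0) vanish,
  and the remainder estimate gives norm (f (x, y)) \<le> C |y|^(2m) with C independent of x and
  y.\<close>

lemma punctured_bound_by_taylor:
  fixes f g :: "'a::euclidean_space \<times> 'b::euclidean_space \<Rightarrow> 'c::euclidean_space"
  assumes U: "open U" "0 \<in> U" and f: "smooth_on U f" and g: "smooth_on (U - {0}) g"
    and fg: "\<And>p. p \<in> U - {0} \<Longrightarrow> ((norm (snd p))\<^sup>2) ^ m *\<^sub>R g p = f p"
  shows "\<exists>K. \<forall>\<^sub>F p in at 0. norm (g p) \<le> K"
proof -
  obtain r where r: "r > 0" "cball 0 r \<subseteq> U" using U open_contains_cball by blast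
  obtain C where C: "C \<ge> 0" "\<And>a h. (\<And>s. s \<in> {0..1} \<Longrightarrow> a + s *\<^sub>R h \<in> cball 0 r) \<Longrightarrow>
      norm (f (a + h) - (\<Sum>j<2 * m. (1 / fact j) *\<^sub>R dders (replicate j h) f a)) \<le> C * norm h ^ (2 * m)"
    using taylor_bound[OF U(1) compact_cball r(2) f, of "2 * m"] by blast
  have gen: "norm (g (x, y)) \<le> C" if x: "x \<noteq> 0" and y: "y \<noteq> 0" and xy: "norm (x, y) < r" for x y
  proof -
    define a h where "a = (x, 0::'b)" and "h = (0::'a, y)"
    have nh: "norm h = norm y" by (simp add: h_def norm_Pair)
    have ah: "a + s *\<^sub>R h = (x, s *\<^sub>R y)" for s by (simp add: a_def h_def)
    have seg: "a + s *\<^sub>R h \<in> cball 0 r" if "s \<in> {0..1}" for s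
    proof -
      have "(norm (s *\<^sub>R y))\<^sup>2 \<le> (norm y)\<^sup>2"
        using that mult_right_mono[of s 1 "norm y"] by (intro power_mono) auto
      then have "norm (x, s *\<^sub>R y) \<le> norm (x, y)" by (simp add: norm_Pair)
      then show ?thesis using xy by (simp add: ah)
    qed
    define c where "c j = (1 / fact j) *\<^sub>R dders (replicate j h) f a" for j
    have aU: "a \<in> U" using seg[of 0] r by auto
    have T: "norm (f (a + s *\<^sub>R h) - (\<Sum>j<2 * m. s ^ j *\<^sub>R c j)) \<le> C * norm (s *\<^sub>R h) ^ (2 * m)" if s: "s \<in> {0..1}" for s
    proof -
      have "a + s' *\<^sub>R (s *\<^sub>R h) \<in> cball 0 r" if "s' \<in> {0..1}" for s'
        using seg[of "s' * s"] s that by (simp add: mult_le_one)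
      from C(2)[OF this] show ?thesis
        using dders_replicate_scaleR[OF U(1) aU f, of _ s h] by (simp add: c_def mult_ac)
    qed
    have inU: "a + s *\<^sub>R h \<in> U - {0}" if "s \<in> {0..1}" for s
      using seg[OF that] r x by (auto simp: ah zero_prod_def)
    have fs: "norm (f (a + s *\<^sub>R h)) = s ^ (2 * m) * norm y ^ (2 * m) * norm (g (a + s *\<^sub>R h))" if "s \<in> {0..1}" for s
    proof -
      from fg[OF inU[OF that], symmetric] show ?thesis
        using that by (simp add: ah power_mult[symmetric] power_mult_distrib)
    qed
    have "continuous_on {0..1} (\<lambda>s. g (a + s *\<^sub>R h))"
    proof (rule continuous_on_compose2[OF smooth_onD(4)[OF g]])
      show "continuous_on {0..1} (\<lambda>s. a + s *\<^sub>R h)" by (intro continuous_intros)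
      show "(\<lambda>s. a + s *\<^sub>R h) ` {0..1} \<subseteq> U - {0}" by (rule image_subsetI) (rule inU)
    qed
    then have "compact ((\<lambda>s. g (a + s *\<^sub>R h)) ` {0..1})" by (intro compact_continuous_image) auto
    \<comment> \<open>This bound depends on x and y and serves only to show that the Taylor
      coefficients vanish; the final estimate is by C alone.\<close>
    from compact_imp_bounded[OF this, unfolded bounded_iff] obtain B where B: "\<And>s. s \<in> {0..1} \<Longrightarrow> norm (g (a + s *\<^sub>R h)) \<le> B"
      by blast
    have "\<forall>j<2 * m. c j = 0"
    proof (rule coefficients_zero_if_small[where c = c and C = "norm y ^ (2 * m) * B + C * norm y ^ (2 * m)"])
      fix s :: real assume "0 < s" "s \<le> 1"
      then have s: "s \<in> {0..1}" by simp
      have "norm (\<Sum>j<2 * m. s ^ j *\<^sub>R c j) \<le> norm (f (a + s *\<^sub>R h)) + C * norm (s *\<^sub>R h) ^ (2 * m)"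
        using norm_le_of_diff_add[of "f (a + s *\<^sub>R h)" 0, simplified, OF T[OF s]] by simp
      also have "\<dots> \<le> s ^ (2 * m) * norm y ^ (2 * m) * B + C * norm (s *\<^sub>R h) ^ (2 * m)"
        unfolding fs[OF s] using B[OF s] s by (intro add_right_mono mult_left_mono) auto
      also have "\<dots> = (norm y ^ (2 * m) * B + C * norm y ^ (2 * m)) * s ^ (2 * m)"
        using s by (simp add: nh power_mult_distrib algebra_simps)
      finally show "norm (\<Sum>j<2 * m. s ^ j *\<^sub>R c j) \<le> (norm y ^ (2 * m) * B + C * norm y ^ (2 * m)) * s ^ (2 * m)" .
    qed
    then have "norm (f (a + 1 *\<^sub>R h)) \<le> C * norm y ^ (2 * m)"
      using T[of 1] by (simp add: h_def norm_Pair)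
    then have "norm y ^ (2 * m) * norm (g (x, y)) \<le> norm y ^ (2 * m) * C"
      using fs[of 1] ah[of 1] by (simp add: mult.commute)
    then show ?thesis using y by simp
  qed
  have "norm (g p) \<le> C" if p: "p \<in> ball 0 r - {0}" for p
  proof -
    obtain x y where pxy: "p = (x, y)" by (cases p)
    have e: "(SOME i. i \<in> Basis) \<noteq> (0::'a)" "(SOME i. i \<in> Basis) \<noteq> (0::'b)"
      using nonzero_Basis[OF SOME_Basis] by blast+
    \<comment> \<open>Shifting along (u, v) makes both coordinates nonzero for all t > 0, so the
      points with x = 0 or y = 0 are reached by continuity.\<close>
    define u v where "u = (if x = 0 then SOME i. i \<in> Basis else x)" and "v = (if y = 0 then SOME i. i \<in> Basis else y)"
    let ?p = "\<lambda>t::real. (x + t *\<^sub>R u, y + t *\<^sub>R v)"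
    have xt: "x + t *\<^sub>R u \<noteq> 0" "y + t *\<^sub>R v \<noteq> 0" if "t > 0" for t
      using that e by (simp_all add: u_def v_def add_scaleR_self_neq_0)
    have lim: "(?p \<longlongrightarrow> p) (at_right 0)"
      unfolding pxy by (auto intro!: tendsto_eq_intros)
    have op: "open (ball 0 r - {0})" by auto
    have "isCont g p" using p r smooth_onD(4)[OF g] U
      by (auto simp: continuous_on_eq_continuous_at open_Diff subset_eq)
    then have "((\<lambda>t. norm (g (?p t))) \<longlongrightarrow> norm (g p)) (at_right 0)"
      by (intro tendsto_norm isCont_tendsto_compose[OF _ lim])
    moreover have "\<forall>\<^sub>F t in at_right 0. norm (g (?p t)) \<le> C"
      using topological_tendstoD[OF lim op p] eventually_at_right_less[of 0]
      by eventually_elim (rule gen, use xt in auto)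
    ultimately show ?thesis by (rule tendsto_upperbound) simp
  qed
  then show ?thesis
    using r(1) by (intro exI[of _ C]) (auto simp: eventually_at intro!: exI[of _ r])
qed

text \<open>Off the origin the quotient is (F + G) / |p|^2. At the origin it extends, because |y|^2
  times it is the smooth function F: derivatives of the quotient have powers of |y|^2 as
  denominators, and \<open>punctured_bound_by_taylor\<close> bounds such functions although |y|^2
  vanishes on a whole subspace.\<close>

lemma smooth_common_quotient:
  fixes F G :: "'a::euclidean_space \<times> 'b::euclidean_space \<Rightarrow> 'c::euclidean_space"
  assumes U: "open U" and F: "smooth_on U F" and G: "smooth_on U G"
    and FG: "\<And>x y. (x, y) \<in> U \<Longrightarrow> (norm x)\<^sup>2 *\<^sub>R F (x, y) = (norm y)\<^sup>2 *\<^sub>R G (x, y)"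
  obtains t where "smooth_on U t"
    "\<And>x y. (x, y) \<in> U \<Longrightarrow> F (x, y) = (norm y)\<^sup>2 *\<^sub>R t (x, y)"
    "\<And>x y. (x, y) \<in> U \<Longrightarrow> G (x, y) = (norm x)\<^sup>2 *\<^sub>R t (x, y)"
proof -
  let ?g = "\<lambda>p. inverse ((norm p)\<^sup>2) *\<^sub>R (F p + G p)"
  have U': "open (U - {0})" using U by auto
  have gs: "smooth_on (U - {0}) ?g"
    by (intro smooth_intros smooth_on_inverse U' smooth_on_subset[OF F] smooth_on_subset[OF G]) auto
  have n: "(norm (x, y))\<^sup>2 = (norm x)\<^sup>2 + (norm y)\<^sup>2" for x :: 'a and y :: 'b by (simp add: norm_Pair)
  have g: "(norm y)\<^sup>2 *\<^sub>R ?g (x, y) = F (x, y)" "(norm x)\<^sup>2 *\<^sub>R ?g (x, y) = G (x, y)"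
    if "(x, y) \<in> U - {0}" for x y
  proof -
    have ne: "(norm (x, y))\<^sup>2 \<noteq> 0" using that by auto
    have "(norm y)\<^sup>2 *\<^sub>R (F (x, y) + G (x, y)) = (norm (x, y))\<^sup>2 *\<^sub>R F (x, y)"
      "(norm x)\<^sup>2 *\<^sub>R (F (x, y) + G (x, y)) = (norm (x, y))\<^sup>2 *\<^sub>R G (x, y)"
      using FG[of x y] that unfolding n by (simp_all add: algebra_simps)
    then show "(norm y)\<^sup>2 *\<^sub>R ?g (x, y) = F (x, y)" "(norm x)\<^sup>2 *\<^sub>R ?g (x, y) = G (x, y)"
      using ne by (metis (no_types, lifting) left_inverse scaleR_left_commute scaleR_one scaleR_scaleR)+
  qed
  show ?thesis
  proof (cases "0 \<in> U")
    case False
    then have "U - {0} = U" by auto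
    then show ?thesis using that[of ?g] gs g by simp
  next
    case True
    have "DIM('a) > 0" "DIM('b) > 0" by simp_all
    then have dim: "DIM('a \<times> 'b) \<ge> 2" unfolding DIM_prod by linarith
    have qs: "smooth_on U (\<lambda>p. (norm (snd p))\<^sup>2)" by (intro smooth_intros U)
    obtain t where t: "smooth_on U t" "\<And>p. p \<noteq> 0 \<Longrightarrow> t p = ?g p"
    proof (rule removable_singularity_quotient[where P = "\<lambda>_. True" and m = 1, OF dim U True qs _ _ gs F])
      show "((norm (snd p))\<^sup>2) ^ 1 *\<^sub>R ?g p = F p" if "p \<in> U - {0}" for p
        using g(1)[of "fst p" "snd p"] that by simp
      show "\<exists>K. \<forall>\<^sub>F p in at 0. norm (g p) \<le> K" if "smooth_on U f" "smooth_on (U - {0}) g"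
        "\<And>p. p \<in> U - {0} \<Longrightarrow> ((norm (snd p))\<^sup>2) ^ m *\<^sub>R g p = f p" for f g :: "'a \<times> 'b \<Rightarrow> 'c" and m
        by (rule punctured_bound_by_taylor[OF U True that])
    qed auto
    have eq: "F p = (norm (snd p))\<^sup>2 *\<^sub>R t p" "G p = (norm (fst p))\<^sup>2 *\<^sub>R t p" if "p \<in> U - {0}" for p
      using g[of "fst p" "snd p"] t(2)[of p] that by auto
    have "continuous_on U (\<lambda>p. (norm (snd p))\<^sup>2 *\<^sub>R t p)" "continuous_on U (\<lambda>p. (norm (fst p))\<^sup>2 *\<^sub>R t p)"
      by (rule smooth_onD(4), intro smooth_intros U t)+
    from continuous_on_eq_at_limit[OF U smooth_onD(4)[OF F] this(1) True eq(1)]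
      continuous_on_eq_at_limit[OF U smooth_onD(4)[OF G] this(2) True eq(2)]
    show ?thesis using that[OF t(1)] eq by (metis Diff_iff fst_conv singletonD snd_conv)
  qed
qed

section \<open>Octonions\<close>

lemma exhaust_8: "x = 0 \<or> x = 1 \<or> x = 2 \<or> x = 3 \<or> x = 4 \<or> x = 5 \<or> x = 6 \<or> x = (7::8)"
proof (induct x)
  case (of_int z)
  then have "0 \<le> z" and "z < 8" by simp_all
  then have "z = 0 \<or> z = 1 \<or> z = 2 \<or> z = 3 \<or> z = 4 \<or> z = 5 \<or> z = 6 \<or> z = 7" by arith
  then show ?case by auto
qed

lemma UNIV_8: "(UNIV :: 8 set) = {0, 1, 2, 3, 4, 5, 6, 7}"
  using exhaust_8 by auto

lemma UNIV_minus_0: "UNIV - {0::8} = {1, 2, 3, 4, 5, 6, 7}"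
  unfolding UNIV_8 by auto

lemma forall_8: "(\<forall>i::8. P i) \<longleftrightarrow> P 0 \<and> P 1 \<and> P 2 \<and> P 3 \<and> P 4 \<and> P 5 \<and> P 6 \<and> P 7"
  by (metis exhaust_8)

lemma sum_8: "(\<Sum>i\<in>(UNIV::8 set). f i) = f 0 + f 1 + f 2 + f 3 + f 4 + f 5 + f 6 + (f 7 :: 'a::comm_monoid_add)"
  unfolding UNIV_8 by (simp add: add_ac)

lemma oct_basis_mult_table:
  "oct_basis_mult 0 j = oct_basis j" "oct_basis_mult i 0 = oct_basis i"
  "oct_basis_mult 1 1 = - oct_basis 0" "oct_basis_mult 1 2 = oct_basis 3" "oct_basis_mult 1 3 = - oct_basis 2"
  "oct_basis_mult 1 4 = oct_basis 5" "oct_basis_mult 1 5 = - oct_basis 4" "oct_basis_mult 1 6 = - oct_basis 7"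
  "oct_basis_mult 1 7 = oct_basis 6" "oct_basis_mult 2 1 = - oct_basis 3" "oct_basis_mult 2 2 = - oct_basis 0"
  "oct_basis_mult 2 3 = oct_basis 1" "oct_basis_mult 2 4 = oct_basis 6" "oct_basis_mult 2 5 = oct_basis 7"
  "oct_basis_mult 2 6 = - oct_basis 4" "oct_basis_mult 2 7 = - oct_basis 5" "oct_basis_mult 3 1 = oct_basis 2"
  "oct_basis_mult 3 2 = - oct_basis 1" "oct_basis_mult 3 3 = - oct_basis 0" "oct_basis_mult 3 4 = oct_basis 7"
  "oct_basis_mult 3 5 = - oct_basis 6" "oct_basis_mult 3 6 = oct_basis 5" "oct_basis_mult 3 7 = - oct_basis 4"
  "oct_basis_mult 4 1 = - oct_basis 5" "oct_basis_mult 4 2 = - oct_basis 6" "oct_basis_mult 4 3 = - oct_basis 7"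
  "oct_basis_mult 4 4 = - oct_basis 0" "oct_basis_mult 4 5 = oct_basis 1" "oct_basis_mult 4 6 = oct_basis 2"
  "oct_basis_mult 4 7 = oct_basis 3" "oct_basis_mult 5 1 = oct_basis 4" "oct_basis_mult 5 2 = - oct_basis 7"
  "oct_basis_mult 5 3 = oct_basis 6" "oct_basis_mult 5 4 = - oct_basis 1" "oct_basis_mult 5 5 = - oct_basis 0"
  "oct_basis_mult 5 6 = - oct_basis 3" "oct_basis_mult 5 7 = oct_basis 2" "oct_basis_mult 6 1 = oct_basis 7"
  "oct_basis_mult 6 2 = oct_basis 4" "oct_basis_mult 6 3 = - oct_basis 5" "oct_basis_mult 6 4 = - oct_basis 2"
  "oct_basis_mult 6 5 = oct_basis 3" "oct_basis_mult 6 6 = - oct_basis 0" "oct_basis_mult 6 7 = - oct_basis 1"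
  "oct_basis_mult 7 1 = - oct_basis 6" "oct_basis_mult 7 2 = oct_basis 5" "oct_basis_mult 7 3 = oct_basis 4"
  "oct_basis_mult 7 4 = - oct_basis 3" "oct_basis_mult 7 5 = - oct_basis 2" "oct_basis_mult 7 6 = oct_basis 1"
  "oct_basis_mult 7 7 = - oct_basis 0"
  by (simp_all add: oct_basis_mult_def oct_eps_def oct_triples_def UNIV_minus_0)

lemma oct_mult_nth:
  "(a \<odot> b) $ 0 = a $ 0 * b $ 0 - a $ 1 * b $ 1 - a $ 2 * b $ 2 - a $ 3 * b $ 3 - a $ 4 * b $ 4 - a $ 5 * b $ 5 - a $ 6 * b $ 6 - a $ 7 * b $ 7"
  "(a \<odot> b) $ 1 = a $ 0 * b $ 1 + a $ 1 * b $ 0 + a $ 2 * b $ 3 - a $ 3 * b $ 2 + a $ 4 * b $ 5 - a $ 5 * b $ 4 - a $ 6 * b $ 7 + a $ 7 * b $ 6"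
  "(a \<odot> b) $ 2 = a $ 0 * b $ 2 - a $ 1 * b $ 3 + a $ 2 * b $ 0 + a $ 3 * b $ 1 + a $ 4 * b $ 6 + a $ 5 * b $ 7 - a $ 6 * b $ 4 - a $ 7 * b $ 5"
  "(a \<odot> b) $ 3 = a $ 0 * b $ 3 + a $ 1 * b $ 2 - a $ 2 * b $ 1 + a $ 3 * b $ 0 + a $ 4 * b $ 7 - a $ 5 * b $ 6 + a $ 6 * b $ 5 - a $ 7 * b $ 4"
  "(a \<odot> b) $ 4 = a $ 0 * b $ 4 - a $ 1 * b $ 5 - a $ 2 * b $ 6 - a $ 3 * b $ 7 + a $ 4 * b $ 0 + a $ 5 * b $ 1 + a $ 6 * b $ 2 + a $ 7 * b $ 3"
  "(a \<odot> b) $ 5 = a $ 0 * b $ 5 + a $ 1 * b $ 4 - a $ 2 * b $ 7 + a $ 3 * b $ 6 - a $ 4 * b $ 1 + a $ 5 * b $ 0 - a $ 6 * b $ 3 + a $ 7 * b $ 2"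
  "(a \<odot> b) $ 6 = a $ 0 * b $ 6 + a $ 1 * b $ 7 + a $ 2 * b $ 4 - a $ 3 * b $ 5 - a $ 4 * b $ 2 + a $ 5 * b $ 3 + a $ 6 * b $ 0 - a $ 7 * b $ 1"
  "(a \<odot> b) $ 7 = a $ 0 * b $ 7 - a $ 1 * b $ 6 + a $ 2 * b $ 5 + a $ 3 * b $ 4 - a $ 4 * b $ 3 - a $ 5 * b $ 2 + a $ 6 * b $ 1 + a $ 7 * b $ 0"
  by (simp_all add: oct_mult_def sum_8 oct_basis_mult_table axis_def)

lemma oct_cnj_nth: "oct_cnj a $ i = (if i = 0 then a $ 0 else - a $ i)"
  by (simp add: oct_cnj_def inner_axis) (simp add: axis_def)

lemma inner_oct: "a \<bullet> b = a $ 0 * b $ 0 + a $ 1 * b $ 1 + a $ 2 * b $ 2 + a $ 3 * b $ 3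
    + a $ 4 * b $ 4 + a $ 5 * b $ 5 + a $ 6 * b $ 6 + a $ 7 * b $ 7" for a b :: oct
  by (simp add: inner_vec_def sum_8)

lemmas oct_coords = vec_eq_iff forall_8 oct_mult_nth oct_cnj_nth inner_oct

lemma bounded_bilinear_oct_mult: "bounded_bilinear (\<odot>)"
proof -
  have "bilinear (\<odot>)"
    by (auto simp: bilinear_def linear_iff oct_coords algebra_simps)
  then show ?thesis by (simp add: bilinear_conv_bounded_bilinear)
qed

interpretation oct: bounded_bilinear "(\<odot>)" by (rule bounded_bilinear_oct_mult)

lemma linear_oct_cnj: "linear oct_cnj"
  by (auto simp: linear_iff oct_coords algebra_simps)

lemma bounded_linear_oct_cnj: "bounded_linear oct_cnj"
  using linear_oct_cnj linear_conv_bounded_linear by blast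

lemma oct_cnj_cnj [simp]: "oct_cnj (oct_cnj a) = a"
  by (simp add: oct_coords)

lemma oct_cnj_mult: "oct_cnj (a \<odot> b) = oct_cnj b \<odot> oct_cnj a"
  by (simp add: oct_coords algebra_simps)

lemma inner_oct_cnj: "oct_cnj a \<bullet> oct_cnj b = a \<bullet> b"
  by (simp add: oct_coords)

lemma oct_adjoint_left: "(a \<odot> b) \<bullet> c = b \<bullet> (oct_cnj a \<odot> c)"
  by (simp add: oct_coords algebra_simps)

lemma oct_adjoint_right: "(a \<odot> b) \<bullet> c = a \<bullet> (c \<odot> oct_cnj b)"
  by (simp add: oct_coords algebra_simps)

text \<open>The polarised form of \<open>oct_cnj a \<odot> (a \<odot> c) = (a \<bullet> a) *\<^sub>R
  c\<close>. With its mirror image and the adjunction rules it takes the place of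
  associativity.\<close>

lemma oct_alternative_left: "oct_cnj a \<odot> (b \<odot> c) + oct_cnj b \<odot> (a \<odot> c) = (2 * (a \<bullet> b)) *\<^sub>R c"
  unfolding vec_eq_iff forall_8
  by (intro conjI; simp only: vector_add_component vector_scaleR_component oct_mult_nth oct_cnj_nth inner_oct simp_thms if_True if_False; simp; algebra)

lemma oct_alternative_right: "(c \<odot> a) \<odot> oct_cnj b + (c \<odot> b) \<odot> oct_cnj a = (2 * (a \<bullet> b)) *\<^sub>R c"
  unfolding vec_eq_iff forall_8
  by (intro conjI; simp only: vector_add_component vector_scaleR_component oct_mult_nth oct_cnj_nth inner_oct simp_thms if_True if_False; simp; algebra)

section \<open>The spinorial structure of the octonionic Hopf foliation\<close>

text \<open>
  \<open>\<real> \<oplus> \<O> \<oplus> \<real>\<close> is the space of Hermitian \<open>2\<times>2\<close> octonionic matrices with the Lorentzian form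
  \<open>\<mu>\<nu> - \<bar>a\<bar>\<^sup>2\<close>; it acts on \<open>\<O>\<^sup>2\<close> through \<open>d\<^sup>(\<^sup>1\<^sup>)\<close>, which is the Clifford action on a half-spin
  representation of \<open>Spin(9,1)\<close>. All the structure maps are expressed by this action, by the
  adjugate \<open>herm_adj\<close>, by the polar form \<open>herm_form\<close>, and by the polarisation \<open>herm_sq\<close> of
  the square \<open>p \<mapsto> 2 (\<bar>y\<bar>\<^sup>2, - x y\<^sup>*, \<bar>x\<bar>\<^sup>2)\<close> of spinors.
\<close>

type_synonym herm = "real \<times> oct \<times> real"

definition herm_adj :: "herm \<Rightarrow> herm" where
  "herm_adj e = (snd (snd e), - fst (snd e), fst e)"

definition herm_form :: "herm \<Rightarrow> herm \<Rightarrow> real" where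
  "herm_form e f = fst e * snd (snd f) + fst f * snd (snd e) - 2 * (fst (snd e) \<bullet> fst (snd f))"

definition herm_sq :: "oct2 \<Rightarrow> oct2 \<Rightarrow> herm" where
  "herm_sq p w = (2 * (snd p \<bullet> snd w), - (fst p \<odot> oct_cnj (snd w) + fst w \<odot> oct_cnj (snd p)),
    2 * (fst p \<bullet> fst w))"

text \<open>Up to sign this is the last component of the contracting homotopy, from
  \<open>E\<^sub>-\<^sub>1\<close> to \<open>E\<^sub>-\<^sub>2\<close>; see \<open>h_d1\<close> and
  \<open>herm_tr_d2\<close>.\<close>

definition herm_tr :: "herm \<Rightarrow> real" where
  "herm_tr e = fst e + snd (snd e)"

abbreviation cl :: "herm \<Rightarrow> oct2 \<Rightarrow> oct2" where
  "cl e p \<equiv> OH_d1 p e"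

lemma cl_eq: "cl e p = (fst e *\<^sub>R fst p + fst (snd e) \<odot> snd p, snd (snd e) *\<^sub>R snd p + oct_cnj (fst (snd e)) \<odot> fst p)"
  by (cases p; cases e; cases "snd e") simp

lemmas oct_linear_simps = oct.add_left oct.add_right oct.diff_left oct.diff_right oct.minus_left
  oct.minus_right oct.zero_left oct.zero_right oct.scaleR_left oct.scaleR_right
  linear_add[OF linear_oct_cnj] linear_diff[OF linear_oct_cnj] linear_neg[OF linear_oct_cnj]
  linear_0[OF linear_oct_cnj] linear_scale[OF linear_oct_cnj]

text \<open>The library multiplication of \<open>real ^ 8\<close> enters when the simplifier turns \<open>v + v\<close> into \<open>2 * v\<close>.\<close>

lemma numeral_mult_oct: "numeral n * v = numeral n *\<^sub>R v" for v :: oct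
  by (simp add: vec_eq_iff)

lemmas inner_linear_simps = inner_add_left inner_add_right inner_diff_left inner_diff_right

lemma bounded_bilinear_cl: "bounded_bilinear cl"
proof -
  have "bilinear cl"
    by (auto simp: bilinear_def linear_iff cl_eq oct_linear_simps algebra_simps)
  then show ?thesis by (simp add: bilinear_conv_bounded_bilinear)
qed

interpretation cl: bounded_bilinear cl by (rule bounded_bilinear_cl)

lemma bounded_bilinear_herm_sq: "bounded_bilinear herm_sq"
proof -
  have "bilinear herm_sq"
    by (auto simp: bilinear_def linear_iff herm_sq_def oct_linear_simps inner_linear_simps algebra_simps)
  then show ?thesis by (simp add: bilinear_conv_bounded_bilinear)
qed

interpretation herm_sq: bounded_bilinear herm_sq by (rule bounded_bilinear_herm_sq)

lemma linear_herm_adj: "linear herm_adj"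
  by (auto simp: linear_iff herm_adj_def)

lemma linear_herm_tr: "linear herm_tr"
  by (auto simp: linear_iff herm_tr_def algebra_simps)

lemma herm_form_linear_simps:
  "herm_form (e + e') f = herm_form e f + herm_form e' f"
  "herm_form (c *\<^sub>R e) f = c * herm_form e f"
  "herm_form e (f + f') = herm_form e f + herm_form e f'"
  "herm_form e (f - f') = herm_form e f - herm_form e f'"
  "herm_form e (c *\<^sub>R f) = c * herm_form e f"
  "herm_form e 0 = 0"
  by (simp_all add: herm_form_def inner_linear_simps algebra_simps)

lemma herm_form_sym: "herm_form e f = herm_form f e"
  by (simp add: herm_form_def inner_commute)

text \<open>Nondegeneracy of the Lorentzian form: identities between Hermitian matrices may be
  tested by pairing.\<close>

lemma herm_form_eqI:
  assumes "\<And>e. herm_form e f = herm_form e g" shows "f = g"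
proof -
  have "fst f = fst g" using assms[of "(0, 0, 1)"] by (simp add: herm_form_def)
  moreover have "snd (snd f) = snd (snd g)" using assms[of "(1, 0, 0)"] by (simp add: herm_form_def)
  moreover have "a \<bullet> fst (snd f) = a \<bullet> fst (snd g)" for a
    using assms[of "(0, a, 0)"] by (simp add: herm_form_def)
  then have "fst (snd f) = fst (snd g)" by (metis vector_eq_ldot)
  ultimately show ?thesis by (simp add: prod_eq_iff)
qed

section \<open>The Clifford relation and the three-spinor identity\<close>

lemma herm_sq_sym: "herm_sq p w = herm_sq w p"
  by (simp add: herm_sq_def inner_commute add.commute)

text \<open>The polarisation of adj(e) e = det(e) acting on spinors: mixed terms cancel between
  diagonal and off-diagonal entries, and the terms quadratic in the octonionic entries combine by
  alternativity.\<close>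

lemma cl_clifford: "cl (herm_adj e) (cl f p) + cl (herm_adj f) (cl e p) = herm_form e f *\<^sub>R p"
proof -
  obtain x y where p: "p = (x, y)" by (cases p)
  obtain \<mu> a \<nu> where e: "e = (\<mu>, a, \<nu>)" by (cases e)
  obtain \<mu>' a' \<nu>' where f: "f = (\<mu>', a', \<nu>')" by (cases f)
  have "a \<odot> (oct_cnj a' \<odot> x) + a' \<odot> (oct_cnj a \<odot> x) = (2 * (a \<bullet> a')) *\<^sub>R x"
    using oct_alternative_left[of "oct_cnj a" "oct_cnj a'" x] by (simp add: inner_oct_cnj)
  moreover have "oct_cnj a \<odot> (a' \<odot> y) + oct_cnj a' \<odot> (a \<odot> y) = (2 * (a \<bullet> a')) *\<^sub>R y"
    by (rule oct_alternative_left)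
  ultimately show ?thesis
    unfolding p e f
    by (simp add: herm_form_def herm_adj_def oct_linear_simps algebra_simps)
qed

lemma cl_sym: "cl e p \<bullet> q = p \<bullet> cl e q"
  using oct_adjoint_left[of "fst (snd e)" "snd p" "fst q"] oct_adjoint_left[of "fst (snd e)" "snd q" "fst p"]
  by (simp add: cl_eq inner_prod_def inner_linear_simps inner_commute)

text \<open>Adjunction between the polarised square and the Clifford action. With
  \<open>herm_form_eqI\<close> it reduces identities for \<open>herm_sq\<close> to Clifford
  relations.\<close>

lemma herm_form_sq: "herm_form e (herm_sq p w) = 2 * (cl e p \<bullet> w)"
proof -
  have "fst (snd e) \<bullet> (fst p \<odot> oct_cnj (snd w)) = (oct_cnj (fst (snd e)) \<odot> fst p) \<bullet> snd w"
    using oct_adjoint_right[of "fst (snd e)" "snd w" "fst p"] oct_adjoint_left[of "fst (snd e)" "snd w" "fst p"]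
    by (simp add: inner_commute)
  moreover have "fst (snd e) \<bullet> (fst w \<odot> oct_cnj (snd p)) = (fst (snd e) \<odot> snd p) \<bullet> fst w"
    by (simp add: oct_adjoint_right)
  ultimately show ?thesis
    by (simp add: herm_form_def herm_sq_def cl_eq inner_prod_def inner_linear_simps algebra_simps)
qed

text \<open>The three-spinor identity for Spin(9,1), known from supersymmetry in ten dimensions.
  Alternativity in the form (a cnj b) c + (a cnj c) b = 2 <b, c> a pairs off the six octonionic
  products in each component.\<close>

lemma cl_herm_sq_cyclic: "cl (herm_sq p q) r + cl (herm_sq q r) p + cl (herm_sq r p) q = 0"
proof -
  have 1: "(a \<odot> oct_cnj b) \<odot> c + (a \<odot> oct_cnj c) \<odot> b = (2 * (b \<bullet> c)) *\<^sub>R a" for a b c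
    using oct_alternative_right[of a "oct_cnj b" "oct_cnj c"] by (simp add: inner_oct_cnj)
  show ?thesis
    unfolding cl_eq herm_sq_def
    apply (simp add: oct_linear_simps oct_cnj_mult algebra_simps zero_prod_def)
    using 1[of "fst p" "snd q" "snd r"] 1[of "fst q" "snd p" "snd r"] 1[of "fst r" "snd p" "snd q"]
      1[of "snd p" "fst q" "fst r"] 1[of "snd q" "fst p" "fst r"] 1[of "snd r" "fst p" "fst q"]
    by (simp add: inner_commute algebra_simps)
qed

lemma cl_herm_sq_self: "cl (herm_sq p p) p = 0"
proof -
  have "3 *\<^sub>R cl (herm_sq p p) p = 0"
    using cl_herm_sq_cyclic[of p p p] scaleR_left_distrib[of 2 1 "cl (herm_sq p p) p"] by (simp add: scaleR_2)
  then show ?thesis by simp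
qed

text \<open>The derivative in direction w of the statement that the square of p annihilates p; it
  trades the mixed square for the square of p.\<close>

lemma cl_herm_sq_self2: "2 *\<^sub>R cl (herm_sq p w) p = - cl (herm_sq p p) w"
  using cl_herm_sq_cyclic[of p w p] herm_sq_sym[of w p]
  by (simp add: scaleR_2 eq_neg_iff_add_eq_0 add_ac)

lemma cl_tr: "cl (herm_adj e) w = herm_tr e *\<^sub>R w - cl e w"
  by (simp add: cl_eq herm_adj_def herm_tr_def oct_linear_simps algebra_simps prod_eq_iff)

lemma herm_tr_sq: "herm_tr (herm_sq p w) = 2 * (p \<bullet> w)"
  by (simp add: herm_tr_def herm_sq_def inner_prod_def)

lemma herm_form_adj: "herm_form (herm_adj e) (herm_adj f) = herm_form e f"
  by (simp add: herm_form_def herm_adj_def)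

lemma herm_adj_adj: "herm_adj (herm_adj e) = e"
  by (simp add: herm_adj_def)

section \<open>The structure maps in spinorial form and their contracting homotopy\<close>

lemma OH_rho0_eq: "OH_rho0 p w = (p \<bullet> p) *\<^sub>R w - (p \<bullet> w) *\<^sub>R p - (1/2) *\<^sub>R cl (herm_sq p p) w"
  by (cases p; cases w)
    (simp add: cl_eq herm_sq_def inner_prod_def power2_norm_eq_inner oct_linear_simps oct_cnj_mult numeral_mult_oct algebra_simps)

lemma OH_d2_eq: "OH_d2 p t = - (t / 2) *\<^sub>R herm_sq p p"
  by (cases p) (simp add: herm_sq_def power2_norm_eq_inner numeral_mult_oct)

lemma OH_br00_eq: "OH_br00 p w w' = (p \<bullet> w) *\<^sub>R w' - (p \<bullet> w') *\<^sub>R w"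
  by (cases p; cases w; cases w') (simp add: inner_prod_def)

lemma OH_br01_eq: "OH_br01 p w e = herm_sq p (cl (herm_adj e) w)"
  by (cases p; cases w; cases e; cases "snd e")
    (simp add: herm_sq_def herm_adj_def oct_linear_simps oct_cnj_mult inner_linear_simps algebra_simps)

lemma OH_br02_eq: "OH_br02 p w t = 2 * (p \<bullet> w) * t"
  by (cases p; cases w) (simp add: inner_prod_def)

lemma OH_br11_eq: "OH_br11 e f = - 2 * herm_form e f"
  by (cases e; cases "snd e"; cases f; cases "snd f") (simp add: herm_form_def)

text \<open>Identifies the anchor, up to a multiple of p, with half the Clifford action of the
  adjugate of the square of p; this is how Clifford relations apply to the anchor.\<close>

lemma cl_adj_eq: "cl (herm_adj (herm_sq p p)) w = 2 *\<^sub>R OH_rho0 p w + (2 * (p \<bullet> w)) *\<^sub>R p"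
  unfolding cl_tr herm_tr_sq OH_rho0_eq by (simp add: algebra_simps flip: mult_2)

text \<open>Paired with e, the claim concerns adj(Q) (e p) for Q the square of p. Since Q
  annihilates p, the Clifford relation leaves only the form of Q and e times p.\<close>

lemma herm_sq_cl_adj: "herm_sq p (cl (herm_adj (herm_sq p p)) w) = (2 * (p \<bullet> w)) *\<^sub>R herm_sq p p"
proof (rule herm_form_eqI)
  fix e
  let ?Q = "herm_sq p p"
  have "cl (herm_adj ?Q) (cl e p) = herm_form ?Q e *\<^sub>R p"
    using cl_clifford[where e = ?Q and f = e and p = p] by (simp add: cl_herm_sq_self cl.zero_right)
  then have "cl e p \<bullet> cl (herm_adj ?Q) w = herm_form ?Q e * (p \<bullet> w)"
    by (simp add: cl_sym[symmetric])
  then show "herm_form e (herm_sq p (cl (herm_adj ?Q) w)) = herm_form e ((2 * (p \<bullet> w)) *\<^sub>R ?Q)"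
    by (simp add: herm_form_sq herm_form_linear_simps herm_form_sym[of ?Q e])
qed

text \<open>The derivative of the Hopf map, the square of p, vanishes in the directions of the
  foliation: its components are constant along the leaves.\<close>

lemma herm_sq_rho: "herm_sq p (OH_rho0 p w) = 0"
proof -
  have "OH_rho0 p w = (1/2) *\<^sub>R (cl (herm_adj (herm_sq p p)) w - (2 * (p \<bullet> w)) *\<^sub>R p)"
    unfolding cl_adj_eq by simp
  then show ?thesis
    by (simp add: herm_sq.scaleR_right herm_sq.diff_right herm_sq_cl_adj)
qed

lemma rho_sym: "OH_rho0 p w \<bullet> z = w \<bullet> OH_rho0 p z"
  using cl_sym[where e = "herm_sq p p" and p = w and q = z]
  unfolding OH_rho0_eq by (simp add: inner_linear_simps inner_commute)

lemma rho_self: "OH_rho0 p p = 0"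
  by (simp add: OH_rho0_eq cl_herm_sq_self)

lemma inner_rho: "p \<bullet> OH_rho0 p w = 0"
  using rho_sym[of p p w] rho_self by simp

lemma d1_d2: "OH_d1 p (OH_d2 p t) = 0"
  by (simp add: OH_d2_eq cl.scaleR_left cl.minus_left cl_herm_sq_self)

text \<open>A contracting homotopy for multiplication by \<open>\<bar>p\<bar>\<^sup>2\<close> on the linear part.\<close>

definition OH_h :: "oct2 \<Rightarrow> oct2 \<Rightarrow> herm" where
  "OH_h p w = (p \<bullet> w) *\<^sub>R (1, 0, 1) - herm_sq p w"

lemma cl_one: "cl (c, 0, c) p = c *\<^sub>R p"
  by (simp add: cl_eq oct_linear_simps prod_eq_iff)

lemma d1_h: "OH_d1 p (OH_h p w) = (p \<bullet> p) *\<^sub>R w - OH_rho0 p w"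
proof -
  have "cl (herm_sq p w) p = - (1/2) *\<^sub>R cl (herm_sq p p) w"
    using arg_cong[OF cl_herm_sq_self2[of p w], of "\<lambda>z. (1/2) *\<^sub>R z"] by simp
  then show ?thesis
    by (simp add: OH_h_def cl.diff_left cl.scaleR_left cl_one OH_rho0_eq algebra_simps)
qed

text \<open>Tested against f, the left side is governed by <f p, e p>. Symmetry of the action writes
  twice this number with f e + e f, and replacing adjugates by tr - id turns the Clifford relation
  into a formula for this anticommutator.\<close>

lemma h_d1: "OH_h p (OH_d1 p e) = (p \<bullet> p) *\<^sub>R e + OH_d2 p (herm_tr e)"
proof (rule herm_form_eqI)
  fix f
  have 1: "herm_form f (c, 0, c) = c * herm_tr f" for f c by (simp add: herm_form_def herm_tr_def algebra_simps)
  have c: "cl (herm_adj f) (cl e p) + cl (herm_adj e) (cl f p) = herm_form f e *\<^sub>R p"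
    by (rule cl_clifford)
  have "cl f p \<bullet> cl e p = cl f (cl e p) \<bullet> p" "cl f p \<bullet> cl e p = cl e (cl f p) \<bullet> p"
    using cl_sym[where e = f and p = p and q = "cl e p"] cl_sym[where e = e and p = p and q = "cl f p"]
    by (simp_all add: inner_commute)
  then have "2 * (cl f p \<bullet> cl e p) = (cl f (cl e p) + cl e (cl f p)) \<bullet> p"
    by (simp add: inner_add_left)
  also have "cl f (cl e p) + cl e (cl f p) = herm_tr f *\<^sub>R cl e p + herm_tr e *\<^sub>R cl f p - herm_form f e *\<^sub>R p"
    unfolding c[symmetric] cl_tr by (simp add: algebra_simps)
  finally have "2 * (cl f p \<bullet> cl e p) = herm_tr f * (cl e p \<bullet> p) + herm_tr e * (cl f p \<bullet> p) - herm_form f e * (p \<bullet> p)"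
    by (simp add: inner_linear_simps)
  then show "herm_form f (OH_h p (OH_d1 p e)) = herm_form f ((p \<bullet> p) *\<^sub>R e + OH_d2 p (herm_tr e))"
    by (simp add: OH_h_def OH_d2_eq herm_form_linear_simps herm_form_sq 1 inner_commute)
qed

text \<open>A formal consequence of the homotopy: evaluating d1 h d1 in both ways leaves only d1 d2,
  which is zero.\<close>

lemma rho_d1: "OH_rho0 p (OH_d1 p e) = 0"
proof -
  have "OH_rho0 p (OH_d1 p e) = (p \<bullet> p) *\<^sub>R OH_d1 p e - OH_d1 p (OH_h p (OH_d1 p e))"
    by (simp add: d1_h)
  then show ?thesis unfolding h_d1 by (simp add: cl.add_left cl.scaleR_left d1_d2)
qed

lemma herm_tr_d2: "herm_tr (OH_d2 p t) = - (p \<bullet> p) * t"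
  by (simp add: OH_d2_eq linear_scale[OF linear_herm_tr] linear_neg[OF linear_herm_tr] herm_tr_sq)

text \<open>With \<open>rho_sym\<close>, off the origin the anchor is |p|^2 times an orthogonal
  projection.\<close>

lemma rho_rho: "OH_rho0 p (OH_rho0 p w) = (p \<bullet> p) *\<^sub>R OH_rho0 p w"
proof -
  have "OH_rho0 p w = (p \<bullet> p) *\<^sub>R w - OH_d1 p (OH_h p w)" by (simp add: d1_h)
  then have "OH_rho0 p (OH_rho0 p w) = OH_rho0 p ((p \<bullet> p) *\<^sub>R w - OH_d1 p (OH_h p w))" by simp
  also have "\<dots> = (p \<bullet> p) *\<^sub>R OH_rho0 p w - OH_rho0 p (OH_d1 p (OH_h p w))"
    unfolding OH_rho0_eq by (simp add: cl.diff_right cl.scaleR_right inner_linear_simps algebra_simps)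
  finally show ?thesis by (simp add: rho_d1)
qed

subsection \<open>The structure equations on constant sections\<close>

lemma OH_rho0_linear_simps:
  "OH_rho0 p (w + w') = OH_rho0 p w + OH_rho0 p w'"
  "OH_rho0 p (w - w') = OH_rho0 p w - OH_rho0 p w'"
  "OH_rho0 p (c *\<^sub>R w) = c *\<^sub>R OH_rho0 p w"
  "OH_rho0 p 0 = 0"
  by (simp_all add: OH_rho0_eq cl.add_right cl.diff_right cl.scaleR_right cl.zero_right inner_linear_simps algebra_simps)

text \<open>The derivative of \<open>p \<mapsto> OH_rho0 p w\<close> in direction \<open>z\<close>.\<close>

definition OH_drho :: "oct2 \<Rightarrow> oct2 \<Rightarrow> oct2 \<Rightarrow> oct2" where
  "OH_drho p z w = (2 * (p \<bullet> z)) *\<^sub>R w - (z \<bullet> w) *\<^sub>R p - (p \<bullet> w) *\<^sub>R z - cl (herm_sq p z) w"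

text \<open>The anchor respects brackets of constant sections; the right side is the Lie bracket of
  the two vector fields. Most terms of \<open>OH_drho\<close> vanish because the image of the anchor
  is orthogonal to p and is annihilated by \<open>herm_sq p\<close>.\<close>

lemma rho_br00:
  "OH_rho0 p (OH_br00 p w w') = OH_drho p (OH_rho0 p w) w' - OH_drho p (OH_rho0 p w') w"
proof -
  have "OH_rho0 p w \<bullet> w' = OH_rho0 p w' \<bullet> w" using rho_sym[of p w w'] by (simp add: inner_commute)
  then show ?thesis
    unfolding OH_drho_def inner_rho herm_sq_rho OH_br00_eq
    by (simp add: OH_rho0_linear_simps cl.zero_left)
qed

text \<open>Here d1 e is linear in p even for constant e, and the last term is its derivative along
  the anchor. The identity is the Clifford relation for the adjugates of e and of the square of p,
  applied to w.\<close>

lemma d1_br01: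
  "OH_d1 p (OH_br01 p w e) = OH_br00 p w (OH_d1 p e) + OH_d1 (OH_rho0 p w) e"
proof -
  let ?Q = "herm_sq p p" and ?g = "cl (herm_adj e) w"
  have 1: "cl (herm_sq p ?g) p = - (1/2) *\<^sub>R cl ?Q ?g"
    using arg_cong[OF cl_herm_sq_self2[of p ?g], of "\<lambda>z. (1/2) *\<^sub>R z"] by simp
  have "cl ?Q ?g + cl e (cl (herm_adj ?Q) w) = herm_form (herm_adj ?Q) (herm_adj e) *\<^sub>R w"
    using cl_clifford[where e = "herm_adj ?Q" and f = "herm_adj e" and p = w] by (simp add: herm_adj_adj)
  also have "herm_form (herm_adj ?Q) (herm_adj e) = 2 * (cl e p \<bullet> p)"
    by (simp add: herm_form_adj herm_form_sym[of ?Q e] herm_form_sq)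
  finally have fin: "cl ?Q ?g = (2 * (cl e p \<bullet> p)) *\<^sub>R w - (2 *\<^sub>R cl e (OH_rho0 p w) + (2 * (p \<bullet> w)) *\<^sub>R cl e p)"
    unfolding cl_adj_eq by (simp add: cl.add_right cl.scaleR_right algebra_simps)
  have "(1/2) *\<^sub>R cl ?Q ?g = (cl e p \<bullet> p) *\<^sub>R w - (cl e (OH_rho0 p w) + (p \<bullet> w) *\<^sub>R cl e p)"
    unfolding fin by (simp add: algebra_simps)
  then show ?thesis
    unfolding OH_br01_eq OH_br00_eq 1 by (simp add: inner_commute algebra_simps)
qed

text \<open>The last term is the derivative of d2 t along the anchor. It is zero by
  \<open>herm_sq_rho\<close>, but in this shape the formula matches the Leibniz rule for nonconstant
  sections.\<close>

lemma d2_br02: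
  "OH_d2 p (OH_br02 p w t) = OH_br01 p w (OH_d2 p t) - t *\<^sub>R herm_sq p (OH_rho0 p w)"
  unfolding herm_sq_rho OH_br02_eq OH_br01_eq OH_d2_eq
  by (simp add: linear_scale[OF linear_herm_adj] linear_neg[OF linear_herm_adj] cl.scaleR_left cl.minus_left
      herm_sq.scaleR_right herm_sq.minus_right herm_sq_cl_adj)

text \<open>After applying \<open>herm_sq p\<close> the two brackets add up to the left side of the
  Clifford relation on p.\<close>

lemma d2_br11:
  "OH_d2 p (OH_br11 e f) = OH_br01 p (OH_d1 p e) f + OH_br01 p (OH_d1 p f) e"
proof -
  have "OH_br01 p (OH_d1 p e) f + OH_br01 p (OH_d1 p f) e
      = herm_sq p (cl (herm_adj e) (cl f p) + cl (herm_adj f) (cl e p))"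
    by (simp add: OH_br01_eq herm_sq.add_right)
  also have "\<dots> = herm_form e f *\<^sub>R herm_sq p p"
    unfolding cl_clifford by (simp add: herm_sq.scaleR_right)
  finally show ?thesis by (simp add: OH_d2_eq OH_br11_eq)
qed

lemma br02_d1: "OH_br02 p (OH_d1 p f) t = OH_br11 (OH_d2 p t) f"
  unfolding OH_br02_eq OH_br11_eq OH_d2_eq herm_form_linear_simps(2) herm_form_sym[of "herm_sq p p"] herm_form_sq
  by (simp add: inner_commute)

lemma rho_polar: "OH_rho0 (p + a) w = OH_rho0 p w + OH_rho0 a w + OH_drho p a w"
proof -
  have "(1/2) *\<^sub>R cl (herm_sq (p + a) (p + a)) w = (1/2) *\<^sub>R cl (herm_sq p p) w + (1/2) *\<^sub>R cl (herm_sq a a) w + cl (herm_sq p a) w"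
    by (simp add: herm_sq.add_left herm_sq.add_right herm_sq_sym[of a p] cl.add_left algebra_simps flip: scaleR_add_left)
  then show ?thesis
    unfolding OH_rho0_eq OH_drho_def
    by (simp add: inner_linear_simps inner_commute[of a p] algebra_simps)
qed

text \<open>All terms of \<open>d1_br01\<close> are quadratic in the base point, so the identity can
  be polarised.\<close>

lemma d1_br01_polar:
  "OH_d1 a (OH_br01 p w e) + OH_d1 p (OH_br01 a w e)
    = OH_br00 a w (OH_d1 p e) + OH_br00 p w (OH_d1 a e) + OH_d1 (OH_drho p a w) e"
proof -
  have "OH_br01 (p + a) w e = OH_br01 p w e + OH_br01 a w e"
    by (simp add: OH_br01_eq herm_sq.add_left)
  moreover have "OH_br00 (p + a) w z = OH_br00 p w z + OH_br00 a w z" for z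
    by (simp add: OH_br00_eq inner_add_left algebra_simps)
  moreover have "OH_br00 p w (z + z') = OH_br00 p w z + OH_br00 p w z'" for p z z'
    by (simp add: OH_br00_eq inner_add_right algebra_simps)
  ultimately show ?thesis
    using d1_br01[of "p + a" w e] d1_br01[of p w e] d1_br01[of a w e]
    by (simp add: rho_polar cl.add_left cl.add_right)
qed

text \<open>Brackets of constant sections have coefficients linear in p; the last three terms are
  the derivatives of these coefficients along the anchor and cancel by its symmetry.\<close>

lemma jacobi_000_const:
  "OH_br00 p w (OH_br00 p w' z) - OH_br00 p w' (OH_br00 p w z) - OH_br00 p (OH_br00 p w w') z
    + OH_br00 (OH_rho0 p w) w' z - OH_br00 (OH_rho0 p w') w z + OH_br00 (OH_rho0 p z) w w' = 0"
proof -
  have "OH_rho0 p w' \<bullet> w = OH_rho0 p w \<bullet> w'" "OH_rho0 p z \<bullet> w = OH_rho0 p w \<bullet> z"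
    "OH_rho0 p z \<bullet> w' = OH_rho0 p w' \<bullet> z"
    using rho_sym[of p] by (simp_all add: inner_commute)
  then show ?thesis
    unfolding OH_br00_eq by (simp add: inner_linear_simps algebra_simps)
qed

text \<open>Rather than expanding octonionic products, one shows that the trace of J and d1 J
  vanish. Then \<open>h_d1\<close> gives |p|^2 J = 0, and at p = 0 every term is zero.\<close>

lemma jacobi_001_const:
  "OH_br01 p w (OH_br01 p w' e) - OH_br01 p w' (OH_br01 p w e) - OH_br01 p (OH_br00 p w w') e
    + OH_br01 (OH_rho0 p w) w' e - OH_br01 (OH_rho0 p w') w e = 0" (is "?J = 0")
proof (cases "p = 0")
  case True
  then show ?thesis
    by (simp add: OH_br01_eq OH_rho0_eq OH_br00_eq herm_sq.zero_left herm_sq.zero_right cl.zero_left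
        cl.zero_right linear_0[OF linear_herm_adj])
next
  case False
  \<comment> \<open>The terms with the square of p cancel between the iterated bracket and the
    derivative term. Of the rest, the part symmetric in w and w' drops out of J, and the other part
    is the trace of the bracket of [w, w'] with e.\<close>
  have tr: "herm_tr (OH_br01 p w (OH_br01 p w' e)) + herm_tr (OH_br01 (OH_rho0 p w) w' e)
      = 2 * (p \<bullet> cl (herm_adj e) w') * (p \<bullet> w) + 2 * (p \<bullet> p) * (w \<bullet> cl (herm_adj e) w')" for w w'
  proof -
    let ?g = "cl (herm_adj e) w'"
    have "herm_tr (OH_br01 p w (OH_br01 p w' e)) = 2 * (cl (herm_adj (herm_sq p ?g)) p \<bullet> w)"
      by (simp add: OH_br01_eq herm_tr_sq cl_sym)
    also have "cl (herm_adj (herm_sq p ?g)) p = (2 * (p \<bullet> ?g)) *\<^sub>R p + (1/2) *\<^sub>R cl (herm_sq p p) ?g"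
      using arg_cong[OF cl_herm_sq_self2[of p ?g], of "\<lambda>z. (1/2) *\<^sub>R z"]
      by (simp add: cl_tr herm_tr_sq)
    finally have "herm_tr (OH_br01 p w (OH_br01 p w' e)) = 4 * (p \<bullet> ?g) * (p \<bullet> w) + cl (herm_sq p p) ?g \<bullet> w"
      by (simp add: inner_linear_simps)
    moreover have "herm_tr (OH_br01 (OH_rho0 p w) w' e) = 2 * ((p \<bullet> p) * (w \<bullet> ?g) - (p \<bullet> w) * (p \<bullet> ?g)) - cl (herm_sq p p) ?g \<bullet> w"
      by (simp add: OH_br01_eq herm_tr_sq OH_rho0_eq inner_linear_simps cl_sym[where p = w] inner_commute[of w])
    ultimately show ?thesis by (simp add: algebra_simps)
  qed
  have "herm_tr ?J = (herm_tr (OH_br01 p w (OH_br01 p w' e)) + herm_tr (OH_br01 (OH_rho0 p w) w' e))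
      - (herm_tr (OH_br01 p w' (OH_br01 p w e)) + herm_tr (OH_br01 (OH_rho0 p w') w e))
      - herm_tr (OH_br01 p (OH_br00 p w w') e)"
    by (simp add: linear_add[OF linear_herm_tr] linear_diff[OF linear_herm_tr])
  also have "\<dots> = 0"
    using cl_sym[where e = "herm_adj e" and p = w and q = w'] unfolding tr
    by (simp add: OH_br01_eq OH_br00_eq herm_tr_sq cl.diff_right cl.scaleR_right inner_linear_simps
        inner_commute[of _ w'] algebra_simps)
  finally have tr0: "herm_tr ?J = 0" .
  let ?z = "cl e p"
  have add: "OH_br00 p w (z + z') = OH_br00 p w z + OH_br00 p w z'" for w z z'
    by (simp add: OH_br00_eq inner_add_right algebra_simps)
  have d: "OH_d1 p (OH_br01 p w (OH_br01 p w' e) + OH_br01 (OH_rho0 p w) w' e)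
      = OH_br00 p w (OH_br00 p w' ?z) + OH_br00 p w (cl e (OH_rho0 p w')) + OH_br00 p w' (cl e (OH_rho0 p w))
        + OH_br00 (OH_rho0 p w) w' ?z + cl e (OH_drho p (OH_rho0 p w) w')" for w w'
    using d1_br01_polar[of "OH_rho0 p w" p w' e]
    by (simp add: cl.add_left d1_br01[of p w] d1_br01[of p w'] add)
  \<comment> \<open>Applying d1 moves all brackets to \<open>E\<^sub>0\<close>, where the Jacobi
    identity for w, w' and d1 e is available.\<close>
  have "OH_d1 p ?J = OH_d1 p (OH_br01 p w (OH_br01 p w' e) + OH_br01 (OH_rho0 p w) w' e)
      - OH_d1 p (OH_br01 p w' (OH_br01 p w e) + OH_br01 (OH_rho0 p w') w e) - OH_d1 p (OH_br01 p (OH_br00 p w w') e)"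
    by (simp add: cl.add_left cl.diff_left)
  also have "\<dots> = 0"
    unfolding d d1_br01[of p "OH_br00 p w w'"] rho_br00
    using jacobi_000_const[of p w w' ?z]
    by (simp add: rho_d1 cl.diff_right OH_br00_eq[of 0]) (simp add: algebra_simps)
  finally have d1: "OH_d1 p ?J = 0" .
  have "(p \<bullet> p) *\<^sub>R ?J = OH_h p (OH_d1 p ?J) - OH_d2 p (herm_tr ?J)" by (simp add: h_d1)
  also have "\<dots> = 0" unfolding d1 tr0
    by (simp add: OH_h_def OH_d2_eq herm_sq.zero_right) (simp add: zero_prod_def)
  finally show ?thesis using False by simp
qed

lemma jacobi_002_const:
  "OH_br02 p w (OH_br02 p w' t) - OH_br02 p w' (OH_br02 p w t) - OH_br02 p (OH_br00 p w w') t
    + OH_br02 (OH_rho0 p w) w' t - OH_br02 (OH_rho0 p w') w t = 0"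
  using rho_sym[of p w w'] by (simp add: OH_br02_eq OH_br00_eq inner_linear_simps inner_commute)

text \<open>Pairing e with the bracket of w and f produces <w, adj(f) (e p)>; the sum over both
  orders is the Clifford relation.\<close>

lemma jacobi_011_const:
  "OH_br02 p w (OH_br11 e f) = OH_br11 (OH_br01 p w e) f + OH_br11 e (OH_br01 p w f)"
proof -
  have 1: "herm_form e (OH_br01 p w f) = 2 * (w \<bullet> cl (herm_adj f) (cl e p))" for e f
    using cl_sym[where e = "herm_adj f" and p = "cl e p" and q = w]
    by (simp add: OH_br01_eq herm_form_sq inner_commute)
  have "herm_form e (OH_br01 p w f) + herm_form f (OH_br01 p w e)
      = 2 * (w \<bullet> (cl (herm_adj e) (cl f p) + cl (herm_adj f) (cl e p)))"
    unfolding 1 by (simp add: inner_linear_simps)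
  also have "\<dots> = 2 * (herm_form e f * (w \<bullet> p))" by (simp add: cl_clifford)
  finally have "herm_form e (OH_br01 p w f) + herm_form f (OH_br01 p w e) = 2 * (herm_form e f * (w \<bullet> p))" .
  then have "- 2 * (herm_form e (OH_br01 p w f) + herm_form f (OH_br01 p w e)) = - 2 * (2 * (herm_form e f * (w \<bullet> p)))"
    by (rule arg_cong)
  then show ?thesis
    unfolding OH_br02_eq OH_br11_eq herm_form_sym[of "OH_br01 p w e" f] inner_commute[of p w]
    by (simp add: algebra_simps)
qed

section \<open>The Lie 3-algebroid\<close>

subsection \<open>The bracket with sections of degree 0\<close>

definition in_E0 :: "oct2 \<Rightarrow> OH_fibre" where
  "in_E0 w = (w, 0, 0)"

text \<open>The bracket with a constant section of degree 0, acting on all degrees at once, so that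
  identities with degree 0 arguments can be proved for inhomogeneous s.\<close>

definition ad0 :: "oct2 \<Rightarrow> oct2 \<Rightarrow> OH_fibre \<Rightarrow> OH_fibre" where
  "ad0 p w s = (OH_br00 p w (fst s), OH_br01 p w (fst (snd s)), OH_br02 p w (snd (snd s)))"

lemma in_E0_simps [simp]: "fst (in_E0 w) = w" "snd (in_E0 w) = 0"
  by (simp_all add: in_E0_def zero_prod_def)

lemma in_E0_linear:
  "in_E0 (w + w') = in_E0 w + in_E0 w'" "in_E0 (w - w') = in_E0 w - in_E0 w'"
  "in_E0 (c *\<^sub>R w) = c *\<^sub>R in_E0 w" "in_E0 (- w) = - in_E0 w" "in_E0 0 = 0"
  by (simp_all add: in_E0_def zero_prod_def)

lemma bounded_linear_in_E0: "bounded_linear in_E0"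
  by (rule linear_conv_bounded_linear[THEN iffD1]) (simp add: linear_iff in_E0_linear)

lemma ad0_linear:
  "ad0 p w (s + s') = ad0 p w s + ad0 p w s'" "ad0 p w (s - s') = ad0 p w s - ad0 p w s'"
  "ad0 p w (c *\<^sub>R s) = c *\<^sub>R ad0 p w s" "ad0 p w 0 = 0"
  "ad0 p (w + w') s = ad0 p w s + ad0 p w' s" "ad0 p (w - w') s = ad0 p w s - ad0 p w' s"
  "ad0 p (c *\<^sub>R w) s = c *\<^sub>R ad0 p w s" "ad0 p 0 s = 0"
  by (simp_all add: ad0_def OH_br00_eq OH_br01_eq OH_br02_eq inner_linear_simps prod_eq_iff
      linear_add[OF linear_herm_adj] linear_diff[OF linear_herm_adj] linear_scale[OF linear_herm_adj] linear_0[OF linear_herm_adj]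
      cl.add_left cl.add_right cl.diff_left cl.diff_right cl.scaleR_left cl.scaleR_right cl.zero_left cl.zero_right
      herm_sq.add_right herm_sq.diff_right herm_sq.scaleR_right herm_sq.zero_right algebra_simps)

lemma ad0_in_E0: "ad0 p w (in_E0 w') = in_E0 (OH_br00 p w w')"
  by (simp add: ad0_def OH_br01_eq OH_br02_eq in_E0_def linear_0[OF linear_herm_adj] cl.zero_left herm_sq.zero_right zero_prod_def[symmetric])

lemma ad0_zero_snd: "snd v = 0 \<Longrightarrow> ad0 p w v = in_E0 (OH_br00 p w (fst v))"
proof -
  assume "snd v = 0"
  then have "v = in_E0 (fst v)" by (cases v) (simp add: in_E0_def zero_prod_def)
  then show ?thesis using ad0_in_E0 by metis
qed

lemma OH_br00_skew: "OH_br00 p w w' = - OH_br00 p w' w"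
  by (simp add: OH_br00_eq)

lemma OH_br_const_zero_snd:
  assumes "snd e = 0"
  shows "OH_br_const p e s = ad0 p (fst e) s" "OH_br_const p s e = - ad0 p (fst e) s"
proof -
  obtain w where e: "e = (w, 0, 0)" using assms by (cases e) (auto simp: zero_prod_def)
  obtain w' f t where s: "s = (w', f, t)" by (cases s)
  have z: "OH_br01 p v 0 = 0" "OH_br02 p v 0 = 0" "OH_br11 0 f = 0" "OH_br11 f 0 = 0" for v f
    by (simp_all add: OH_br01_eq OH_br02_eq OH_br11_eq linear_0[OF linear_herm_adj] cl.zero_left herm_sq.zero_right
        herm_form_linear_simps herm_form_sym[of 0])
  show "OH_br_const p e s = ad0 p (fst e) s" "OH_br_const p s e = - ad0 p (fst e) s"
    unfolding e s by (simp_all add: ad0_def z OH_br00_skew[of p w w'])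
qed

text \<open>The three constant Jacobi identities in one. The final term differentiates the bracket
  of w and w' along the anchor of s and sees only the degree 0 part of s.\<close>

lemma jacobi_const:
  "ad0 p w (ad0 p w' s) - ad0 p w' (ad0 p w s) - ad0 p (OH_br00 p w w') s
    + ad0 (OH_rho0 p w) w' s - ad0 (OH_rho0 p w') w s + in_E0 (OH_br00 (OH_rho p s) w w') = 0"
  using jacobi_000_const[of p w w' "fst s"] jacobi_001_const[of p w w' "fst (snd s)"]
    jacobi_002_const[of p w w' "snd (snd s)"]
  by (simp add: ad0_def in_E0_def OH_rho_def prod_eq_iff)

lemma OH_rho_in_E0: "OH_rho p s = OH_rho0 p (fst s)"
  by (simp add: OH_rho_def)

lemma OH_rho_linear:
  "OH_rho p (s + s') = OH_rho p s + OH_rho p s'" "OH_rho p (s - s') = OH_rho p s - OH_rho p s'"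
  "OH_rho p (c *\<^sub>R s) = c *\<^sub>R OH_rho p s" "OH_rho p 0 = 0" "OH_rho p (- s) = - OH_rho p s"
  using OH_rho0_linear_simps(3)[of p "-1"] by (simp_all add: OH_rho_def OH_rho0_linear_simps)

lemma OH_bracket_E0_left:
  assumes "\<And>p. snd (e p) = 0"
  shows "OH_bracket e s p = ad0 p (fst (e p)) (s p) + dder (OH_rho p (e p)) s p - dder (OH_rho p (s p)) e p"
  by (simp add: OH_bracket_def OH_br_const_zero_snd assms)

lemma OH_bracket_E0_right:
  assumes "\<And>p. snd (e p) = 0"
  shows "OH_bracket s e = (\<lambda>p. - OH_bracket e s p)"
  by (rule ext) (simp add: OH_bracket_def OH_br_const_zero_snd assms)

subsection \<open>Smoothness and derivatives\<close>

lemma bounded_linear_herm_adj: "bounded_linear herm_adj"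
  using linear_herm_adj linear_conv_bounded_linear by blast

lemmas [smooth_intros] =
  smooth_on_bilinear[OF bounded_bilinear_cl] smooth_on_bilinear[OF bounded_bilinear_herm_sq]
  smooth_on_bilinear[OF bounded_bilinear_oct_mult] smooth_on_bounded_linear[OF bounded_linear_oct_cnj]
  smooth_on_bounded_linear[OF bounded_linear_herm_adj] smooth_on_bounded_linear[OF bounded_linear_in_E0]

lemma smooth_on_OH_rho0 [smooth_intros]:
  "open U \<Longrightarrow> smooth_on U w \<Longrightarrow> smooth_on U (\<lambda>p. OH_rho0 p (w p))"
  unfolding OH_rho0_eq by (intro smooth_intros)

lemma smooth_on_OH_rho [smooth_intros]:
  "open U \<Longrightarrow> smooth_on U s \<Longrightarrow> smooth_on U (\<lambda>p. OH_rho p (s p))"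
  unfolding OH_rho_def by (intro smooth_intros)

lemma smooth_on_OH_d [smooth_intros]:
  assumes "open U" "smooth_on U s" shows "smooth_on U (\<lambda>p. OH_d p (s p))"
proof -
  have "OH_d p a = (cl (fst (snd a)) p, (- (1/2) * snd (snd a)) *\<^sub>R herm_sq p p, 0)" for p a
    by (cases a) (simp add: OH_d2_eq)
  then show ?thesis by (simp only:) (intro smooth_intros assms)
qed

lemma smooth_on_OH_br_const [smooth_intros]:
  assumes "open U" "smooth_on U s" "smooth_on U s'"
  shows "smooth_on U (\<lambda>p. OH_br_const p (s p) (s' p))"
proof -
  have "OH_br_const p a b = (OH_br00 p (fst a) (fst b), OH_br01 p (fst a) (fst (snd b)) - OH_br01 p (fst b) (fst (snd a)),
      OH_br02 p (fst a) (snd (snd b)) - OH_br02 p (fst b) (snd (snd a)) + OH_br11 (fst (snd a)) (fst (snd b)))" for p a b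
    by (cases a; cases b) simp
  then show ?thesis
    unfolding OH_br00_eq OH_br01_eq OH_br02_eq OH_br11_eq herm_form_def
    by (simp only:) (intro smooth_intros assms)
qed

lemma smooth_on_OH_bracket:
  assumes "open U" "smooth_on U s" "smooth_on U s'"
  shows "smooth_on U (OH_bracket s s')"
  unfolding OH_bracket_def[abs_def]
  by (intro smooth_intros smooth_on_dder_vary assms)

text \<open>The product rule after expanding the direction in the basis; symmetry of second
  derivatives puts the second-order term into the stated order.\<close>

lemma has_derivative_dder_vary:
  fixes s :: "'a::euclidean_space \<Rightarrow> 'b::euclidean_space"
  assumes U: "open U" "p \<in> U" and s: "smooth_on U s" and v: "(v has_derivative v') (at p)"
  shows "((\<lambda>q. dder (v q) s q) has_derivative (\<lambda>h. dder h (dder (v p) s) p + dder (v' h) s p)) (at p)"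
proof -
  have e: "dder k s q = (\<Sum>b\<in>Basis. (k \<bullet> b) *\<^sub>R dder b s q)" if "q \<in> U" for k q
    by (rule dder_sum_Basis[OF smooth_onD(1)[OF s that]])
  have "((\<lambda>q. \<Sum>b\<in>Basis. (v q \<bullet> b) *\<^sub>R dder b s q) has_derivative
      (\<lambda>h. \<Sum>b\<in>Basis. (v p \<bullet> b) *\<^sub>R dder h (dder b s) p + (v' h \<bullet> b) *\<^sub>R dder b s p)) (at p)"
    by (intro has_derivative_sum has_derivative_scaleR has_derivative_inner_left v smooth_onD(2)[OF smooth_onD(3)[OF s] U(2)])
  moreover have "dder h (dder (v p) s) p = (\<Sum>b\<in>Basis. (v p \<bullet> b) *\<^sub>R dder h (dder b s) p)" for h
  proof -
    have com: "dder h (dder k s) p = dder k (dder h s) p" for k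
      by (rule dder_commute[OF U s])
    have "dder h (dder (v p) s) p = dder (v p) (dder h s) p" by (rule com)
    also have "\<dots> = (\<Sum>b\<in>Basis. (v p \<bullet> b) *\<^sub>R dder b (dder h s) p)"
      by (rule dder_sum_Basis[OF smooth_onD(1)[OF smooth_onD(3)[OF s] U(2)]])
    finally show ?thesis unfolding com .
  qed
  ultimately have "((\<lambda>q. \<Sum>b\<in>Basis. (v q \<bullet> b) *\<^sub>R dder b s q) has_derivative
      (\<lambda>h. dder h (dder (v p) s) p + dder (v' h) s p)) (at p)"
    by (simp only: e[OF U(2), of "v' _"] sum.distrib)
  then show ?thesis
    by (rule has_derivative_transform_within_open[OF _ U]) (rule e[symmetric])
qed

lemma has_derivative_OH_rho0:
  assumes "(w has_derivative w') (at p)"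
  shows "((\<lambda>q. OH_rho0 q (w q)) has_derivative (\<lambda>h. OH_drho p h (w p) + OH_rho0 p (w' h))) (at p)"
proof -
  have "((\<lambda>q. (q \<bullet> q) *\<^sub>R w q - (q \<bullet> w q) *\<^sub>R q - (1/2) *\<^sub>R cl (herm_sq q q) (w q)) has_derivative
    (\<lambda>h. ((p \<bullet> p) *\<^sub>R w' h + (p \<bullet> h + h \<bullet> p) *\<^sub>R w p) - ((p \<bullet> w p) *\<^sub>R h + (p \<bullet> w' h + h \<bullet> w p) *\<^sub>R p)
      - (1/2) *\<^sub>R (cl (herm_sq p p) (w' h) + cl (herm_sq p h + herm_sq h p) (w p)))) (at p)"
    by (intro has_derivative_diff has_derivative_scaleR has_derivative_scaleR_right has_derivative_inner
        cl.FDERIV herm_sq.FDERIV has_derivative_ident assms)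
  moreover have "(1/2) *\<^sub>R (cl (herm_sq p p) (w' h) + cl (herm_sq p h + herm_sq h p) (w p))
      = (1/2) *\<^sub>R cl (herm_sq p p) (w' h) + cl (herm_sq p h) (w p)" for h
    by (simp add: herm_sq_sym[of h p] cl.add_left scaleR_add_right flip: scaleR_add_left)
  ultimately show ?thesis
    by (simp add: OH_rho0_eq OH_drho_def inner_commute algebra_simps)
qed

lemma has_derivative_OH_rho:
  assumes "(s has_derivative s') (at p)"
  shows "((\<lambda>q. OH_rho q (s q)) has_derivative (\<lambda>h. OH_drho p h (fst (s p)) + OH_rho p (s' h))) (at p)"
  unfolding OH_rho_def by (rule has_derivative_OH_rho0[OF has_derivative_fst[OF assms]])

lemma has_derivative_ad0:
  assumes w: "(w has_derivative w') (at p)" and s: "(s has_derivative s') (at p)"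
  shows "((\<lambda>q. ad0 q (w q) (s q)) has_derivative
    (\<lambda>h. ad0 h (w p) (s p) + ad0 p (w' h) (s p) + ad0 p (w p) (s' h))) (at p)"
proof -
  have 0: "((\<lambda>q. (q \<bullet> w q) *\<^sub>R fst (s q) - (q \<bullet> fst (s q)) *\<^sub>R w q) has_derivative
      (\<lambda>h. ((p \<bullet> w p) *\<^sub>R fst (s' h) + (p \<bullet> w' h + h \<bullet> w p) *\<^sub>R fst (s p))
        - ((p \<bullet> fst (s p)) *\<^sub>R w' h + (p \<bullet> fst (s' h) + h \<bullet> fst (s p)) *\<^sub>R w p))) (at p)"
    by (intro has_derivative_diff has_derivative_scaleR has_derivative_inner has_derivative_fst has_derivative_ident w s)
  have 1: "((\<lambda>q. herm_sq q (cl (herm_adj (fst (snd (s q)))) (w q))) has_derivative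
      (\<lambda>h. herm_sq p (cl (herm_adj (fst (snd (s p)))) (w' h) + cl (herm_adj (fst (snd (s' h)))) (w p))
        + herm_sq h (cl (herm_adj (fst (snd (s p)))) (w p)))) (at p)"
    by (intro herm_sq.FDERIV cl.FDERIV bounded_linear.has_derivative[OF bounded_linear_herm_adj]
        has_derivative_fst has_derivative_snd has_derivative_ident w s)
  have 2: "((\<lambda>q. 2 * (q \<bullet> w q) * snd (snd (s q))) has_derivative
      (\<lambda>h. 2 * (p \<bullet> w p) * snd (snd (s' h)) + 2 * (p \<bullet> w' h + h \<bullet> w p) * snd (snd (s p)))) (at p)"
    by (intro has_derivative_mult has_derivative_mult_right has_derivative_inner has_derivative_fst has_derivative_snd has_derivative_ident w s)
  have "((\<lambda>q. ad0 q (w q) (s q)) has_derivative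
      (\<lambda>h. (((p \<bullet> w p) *\<^sub>R fst (s' h) + (p \<bullet> w' h + h \<bullet> w p) *\<^sub>R fst (s p))
        - ((p \<bullet> fst (s p)) *\<^sub>R w' h + (p \<bullet> fst (s' h) + h \<bullet> fst (s p)) *\<^sub>R w p),
        herm_sq p (cl (herm_adj (fst (snd (s p)))) (w' h) + cl (herm_adj (fst (snd (s' h)))) (w p))
        + herm_sq h (cl (herm_adj (fst (snd (s p)))) (w p)),
        2 * (p \<bullet> w p) * snd (snd (s' h)) + 2 * (p \<bullet> w' h + h \<bullet> w p) * snd (snd (s p))))) (at p)"
    unfolding ad0_def OH_br00_eq OH_br01_eq OH_br02_eq by (intro has_derivative_Pair 0 1 2)
  then show ?thesis
    by (rule has_derivative_eq_rhs)
      (simp add: ad0_def OH_br00_eq OH_br01_eq OH_br02_eq fun_eq_iff herm_sq.add_right algebra_simps)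
qed

lemma has_derivative_OH_d:
  assumes s: "(s has_derivative s') (at p)"
  shows "((\<lambda>q. OH_d q (s q)) has_derivative
    (\<lambda>h. OH_d p (s' h) + (OH_d1 h (fst (snd (s p))), - snd (snd (s p)) *\<^sub>R herm_sq p h, 0))) (at p)"
proof -
  have 1: "OH_d p a = (cl (fst (snd a)) p, (- (1/2) * snd (snd a)) *\<^sub>R herm_sq p p, 0)" for p a
    by (cases a) (simp add: OH_d2_eq)
  have "((\<lambda>q. (cl (fst (snd (s q))) q, (- (1/2) * snd (snd (s q))) *\<^sub>R herm_sq q q, 0::real)) has_derivative
    (\<lambda>h. (cl (fst (snd (s p))) h + cl (fst (snd (s' h))) p,
      (- (1/2) * snd (snd (s p))) *\<^sub>R (herm_sq p h + herm_sq h p) + (- (1/2) * snd (snd (s' h))) *\<^sub>R herm_sq p p, 0))) (at p)"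
    by (intro has_derivative_Pair cl.FDERIV herm_sq.FDERIV has_derivative_scaleR has_derivative_mult_right
        has_derivative_fst has_derivative_snd has_derivative_ident has_derivative_const s)
  then show ?thesis
    unfolding 1
  proof (rule has_derivative_eq_rhs, intro ext)
    fix h
    have "(- (1/2) * c) *\<^sub>R (herm_sq p h + herm_sq h p) = - c *\<^sub>R herm_sq p h" for c
      by (simp add: herm_sq_sym[of h p] flip: scaleR_2)
    then show "(cl (fst (snd (s p))) h + cl (fst (snd (s' h))) p,
        (- (1/2) * snd (snd (s p))) *\<^sub>R (herm_sq p h + herm_sq h p) + (- (1/2) * snd (snd (s' h))) *\<^sub>R herm_sq p p, 0::real)
      = (cl (fst (snd (s' h))) p, (- (1/2) * snd (snd (s' h))) *\<^sub>R herm_sq p p, 0)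
        + (cl (fst (snd (s p))) h, - snd (snd (s p)) *\<^sub>R herm_sq p h, 0)"
      by simp
  qed
qed

subsection \<open>The Jacobi identities\<close>

text \<open>The anchor sends the bracket to the Lie bracket of vector fields: e' and s' are the
  derivatives of the fields \<open>\<rho> e\<close> and \<open>\<rho> s\<close>, given by formulas,
  so that the lemma serves global and local sections alike.\<close>

lemma anchor_bracket:
  assumes e: "snd (e p) = 0"
    and e': "\<And>h. e' h = OH_drho p h (fst (e p)) + OH_rho p (dder h e p)"
    and s': "\<And>h. s' h = OH_drho p h (fst (s p)) + OH_rho p (dder h s p)"
  shows "OH_rho p (OH_bracket e s p) = s' (OH_rho p (e p)) - e' (OH_rho p (s p))"
  unfolding OH_bracket_def OH_br_const_zero_snd(1)[OF e] e' s'
  by (simp add: OH_rho_linear) (simp add: OH_rho_in_E0 ad0_def rho_br00)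

text \<open>
  The second derivatives cancel by symmetry, the first derivatives by \<open>rho_br00\<close>, and what
  remains is the identity for constant sections.
\<close>

lemma jacobi_E0_E0:
  assumes e1: "\<And>p. snd (e1 p) = 0" "smooth_on UNIV e1" and e2: "\<And>p. snd (e2 p) = 0" "smooth_on UNIV e2"
    and s: "smooth_on UNIV s"
  shows "OH_bracket (OH_bracket e1 e2) s p
    = OH_bracket e1 (OH_bracket e2 s) p - OH_bracket e2 (OH_bracket e1 s) p"
proof -
  have hd: "(f has_derivative (\<lambda>h. dder h f p)) (at p)" if "smooth_on UNIV f" for f :: "oct2 \<Rightarrow> OH_fibre"
    using smooth_onD(2)[OF that] by simp
  \<comment> \<open>The derivative at p of the vector field obtained from f by the anchor.\<close>
  define dr where "dr f h = OH_drho p h (fst (f p)) + OH_rho p (dder h f p)" for f :: "oct2 \<Rightarrow> OH_fibre" and h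
  have br: "dder h (OH_bracket e f) p = ad0 h (fst (e p)) (f p) + ad0 p (fst (dder h e p)) (f p) + ad0 p (fst (e p)) (dder h f p)
      + (dder h (dder (OH_rho p (e p)) f) p + dder (dr e h) f p)
      - (dder h (dder (OH_rho p (f p)) e) p + dder (dr f h) e p)"
    if "\<And>p. snd (e p) = 0" "smooth_on UNIV e" "smooth_on UNIV f" for e f h
    unfolding OH_bracket_E0_left[of e, OF that(1), abs_def] dr_def
    by (rule dder_eqI, intro has_derivative_diff has_derivative_add has_derivative_ad0 has_derivative_fst
        has_derivative_dder_vary[OF open_UNIV UNIV_I] has_derivative_OH_rho hd that)
  have snd: "snd (dder h e p) = 0" if "\<And>p. snd (e p) = 0" "smooth_on UNIV e" for e :: "oct2 \<Rightarrow> OH_fibre" and h p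
    using dder_bounded_linear[OF bounded_linear_snd smooth_onD(1)[OF that(2) UNIV_I[of p]], of h] that(1) by simp
  have bs: "snd (OH_bracket e1 e2 p) = 0" for p
    unfolding OH_bracket_E0_left[of e1, OF e1(1)] by (simp add: ad0_zero_snd e2(1) snd[OF e1] snd[OF e2])
  let ?a1 = "OH_rho p (e1 p)" and ?a2 = "OH_rho p (e2 p)" and ?\<sigma> = "OH_rho p (s p)"
  have ar: "OH_rho p (OH_bracket e1 e2 p) = dr e2 ?a1 - dr e1 ?a2"
    "OH_rho p (OH_bracket e1 s p) = dr s ?a1 - dr e1 ?\<sigma>"
    "OH_rho p (OH_bracket e2 s p) = dr s ?a2 - dr e2 ?\<sigma>"
    by (intro anchor_bracket e1 e2 dr_def)+
  have D: "dder (k - k') f p = dder k f p - dder k' f p" if "smooth_on UNIV f" for f :: "oct2 \<Rightarrow> OH_fibre" and k k'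
    by (rule linear_diff[OF linear_frechet_derivative[OF smooth_onD(1)[OF that UNIV_I]]])
  have W: "fst (OH_bracket e1 e2 p) = OH_br00 p (fst (e1 p)) (fst (e2 p)) + fst (dder ?a1 e2 p) - fst (dder ?a2 e1 p)"
    unfolding OH_bracket_E0_left[of e1, OF e1(1)] by (simp add: ad0_def)
  have a0: "ad0 p w (dder h e2 p) = in_E0 (OH_br00 p w (fst (dder h e2 p)))"
    "ad0 p w (dder h e1 p) = in_E0 (OH_br00 p w (fst (dder h e1 p)))"
    "ad0 h w (e2 p) = in_E0 (OH_br00 h w (fst (e2 p)))"
    "ad0 p w (e2 p) = in_E0 (OH_br00 p w (fst (e2 p)))" for w h
    by (intro ad0_zero_snd snd e1 e2)+
  have c: "dder ?a1 (dder ?a2 s) p = dder ?a2 (dder ?a1 s) p"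
    "dder ?a1 (dder ?\<sigma> e2) p = dder ?\<sigma> (dder ?a1 e2) p"
    "dder ?a2 (dder ?\<sigma> e1) p = dder ?\<sigma> (dder ?a2 e1) p"
    using dder_commute[OF open_UNIV UNIV_I] s e1 e2 by blast+
  have J1: "OH_bracket (OH_bracket e1 e2) s p = ad0 p (fst (OH_bracket e1 e2 p)) (s p)
      + dder (dr e2 ?a1 - dr e1 ?a2) s p - dder ?\<sigma> (OH_bracket e1 e2) p"
    unfolding OH_bracket_E0_left[of "OH_bracket e1 e2", OF bs] ar ..
  have J2: "OH_bracket e1 (OH_bracket e2 s) p = ad0 p (fst (e1 p)) (OH_bracket e2 s p)
      + dder ?a1 (OH_bracket e2 s) p - dder (dr s ?a2 - dr e2 ?\<sigma>) e1 p"
    unfolding OH_bracket_E0_left[of e1, OF e1(1)] ar ..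
  have J3: "OH_bracket e2 (OH_bracket e1 s) p = ad0 p (fst (e2 p)) (OH_bracket e1 s p)
      + dder ?a2 (OH_bracket e1 s) p - dder (dr s ?a1 - dr e1 ?\<sigma>) e2 p"
    unfolding OH_bracket_E0_left[of e2, OF e2(1)] ar ..
  have K: "OH_bracket e1 s p = ad0 p (fst (e1 p)) (s p) + dder ?a1 s p - dder ?\<sigma> e1 p"
    "OH_bracket e2 s p = ad0 p (fst (e2 p)) (s p) + dder ?a2 s p - dder ?\<sigma> e2 p"
    by (rule OH_bracket_E0_left[OF e1(1)] OH_bracket_E0_left[OF e2(1)])+
  have sk: "OH_br00 p (fst (dder ?\<sigma> e1 p)) (fst (e2 p)) = - OH_br00 p (fst (e2 p)) (fst (dder ?\<sigma> e1 p))"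
    by (rule OH_br00_skew)
  have "OH_bracket e1 (OH_bracket e2 s) p - OH_bracket e2 (OH_bracket e1 s) p - OH_bracket (OH_bracket e1 e2) s p
    = ad0 p (fst (e1 p)) (ad0 p (fst (e2 p)) (s p)) - ad0 p (fst (e2 p)) (ad0 p (fst (e1 p)) (s p))
      - ad0 p (OH_br00 p (fst (e1 p)) (fst (e2 p))) (s p) + ad0 ?a1 (fst (e2 p)) (s p)
      - ad0 ?a2 (fst (e1 p)) (s p) + in_E0 (OH_br00 ?\<sigma> (fst (e1 p)) (fst (e2 p)))"
    unfolding J1 J2 J3 K W br[OF e1 e2(2)] br[OF e1 s] br[OF e2 s] D[OF s] D[OF e1(2)] D[OF e2(2)] c
    by (simp add: ad0_linear a0 sk in_E0_linear algebra_simps)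
  also have "\<dots> = 0" unfolding OH_rho_in_E0[of p "e1 p"] OH_rho_in_E0[of p "e2 p"] by (rule jacobi_const)
  finally show ?thesis by (simp add: algebra_simps)
qed

subsection \<open>Degrees and skew-symmetry\<close>

lemma mem_OH_E: "v \<in> OH_E i \<longleftrightarrow>
  (i \<noteq> 0 \<longrightarrow> fst v = 0) \<and> (i \<noteq> 1 \<longrightarrow> fst (snd v) = 0) \<and> (i \<noteq> 2 \<longrightarrow> snd (snd v) = 0)"
  by (cases v) (auto simp: OH_E_def zero_prod_def)

lemma OH_E_ge3: "i \<ge> 3 \<Longrightarrow> OH_E i = {0}"
  by (simp add: OH_E_def)

lemma sections_OH_ED:
  assumes "s \<in> sections UNIV (OH_E i)"
  shows "smooth_on UNIV s" "i \<noteq> 0 \<Longrightarrow> fst (s p) = 0" "i \<noteq> 1 \<Longrightarrow> fst (snd (s p)) = 0"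
    "i \<noteq> 2 \<Longrightarrow> snd (snd (s p)) = 0"
  using assms unfolding sections_def mem_OH_E by auto

lemma sections_OH_E0D: "s \<in> sections UNIV (OH_E 0) \<Longrightarrow> snd (s p) = 0"
  using sections_OH_ED(3,4)[of s 0 p] by (simp add: prod_eq_iff)

lemma sections_UNIV_iff: "s \<in> sections UNIV UNIV \<longleftrightarrow> smooth_on UNIV s"
  by (simp add: sections_def)

lemma subspace_OH_E: "subspace (OH_E i)"
  by (auto simp: subspace_def mem_OH_E)

lemma graded_fibre_OH_E: "graded_fibre OH_E"
  unfolding graded_fibre_def
proof (intro conjI allI subspace_OH_E)
  have sum: "(\<Sum>i | c i \<noteq> 0. c i) = c 0 + c 1 + c (2::nat)" if "\<And>i. c i \<in> OH_E i" for c :: "nat \<Rightarrow> OH_fibre"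
  proof -
    have "c i = 0" if "i \<notin> {0, 1, 2}" for i
      using \<open>\<And>i. c i \<in> OH_E i\<close>[of i] OH_E_ge3[of i] that by force
    then have "(\<Sum>i | c i \<noteq> 0. c i) = (\<Sum>i\<in>{0, 1, 2}. c i)"
      by (intro sum.mono_neutral_left) auto
    then show ?thesis by (simp add: add.assoc)
  qed
  fix v :: OH_fibre
  define c0 where "c0 i = (if i = 0 then (fst v, 0, 0) else if i = 1 then (0, fst (snd v), 0)
      else if i = 2 then (0, 0, snd (snd v)) else 0)" for i :: nat
  have c: "c0 i \<in> OH_E i" for i by (simp add: mem_OH_E c0_def)
  have "c0 i = 0" if "i \<notin> {0, 1, 2}" for i using that by (simp add: c0_def)
  then have "{i. c0 i \<noteq> 0} \<subseteq> {0, 1, 2}" by blast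
  then have fin: "finite {i. c0 i \<noteq> 0}" by (rule finite_subset) simp
  have "c0 0 + c0 1 + c0 2 = v" by (simp add: c0_def prod_eq_iff)
  then have v0: "v = (\<Sum>i | c0 i \<noteq> 0. c0 i)" unfolding sum[of c0, OF c] by simp
  show "\<exists>!c. (\<forall>i. c i \<in> OH_E i) \<and> finite {i. c i \<noteq> 0} \<and> v = (\<Sum>i | c i \<noteq> 0. c i)"
  proof (rule ex1I[of _ c0])
    show "(\<forall>i. c0 i \<in> OH_E i) \<and> finite {i. c0 i \<noteq> 0} \<and> v = (\<Sum>i | c0 i \<noteq> 0. c0 i)"
      using c fin v0 by blast
  next
    fix c assume a: "(\<forall>i. c i \<in> OH_E i) \<and> finite {i. c i \<noteq> 0} \<and> v = (\<Sum>i | c i \<noteq> 0. c i)"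
    then have v: "v = c 0 + c 1 + c 2" using sum[of c] by simp
    have m: "c i \<in> OH_E i" for i using a by blast
    show "c = c0"
    proof
      fix i :: nat
      consider "i = 0" | "i = 1" | "i = 2" | "i \<ge> 3" by linarith
      then show "c i = c0 i"
      proof cases
        case 4 then show ?thesis using m[of i] OH_E_ge3[of i] by (simp add: c0_def)
      qed (use m[of 0] m[of 1] m[of 2] in \<open>simp_all add: c0_def v mem_OH_E prod_eq_iff\<close>)
    qed
  qed
qed

lemma linear_OH_d: "linear (OH_d p)"
proof -
  have "OH_d p a = (cl (fst (snd a)) p, (- (1/2) * snd (snd a)) *\<^sub>R herm_sq p p, 0)" for a
    by (cases a) (simp add: OH_d2_eq)
  then show ?thesis
    by (simp add: linear_iff cl.add_left cl.scaleR_left add_divide_distrib algebra_simps)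
qed

lemma OH_d_eq: "OH_d p a = (cl (fst (snd a)) p, OH_d2 p (snd (snd a)), 0)"
  by (cases a) simp

lemma OH_br_const_eq: "OH_br_const p a b = (OH_br00 p (fst a) (fst b),
    OH_br01 p (fst a) (fst (snd b)) - OH_br01 p (fst b) (fst (snd a)),
    OH_br02 p (fst a) (snd (snd b)) - OH_br02 p (fst b) (snd (snd a)) + OH_br11 (fst (snd a)) (fst (snd b)))"
  by (cases a; cases b) simp

lemma bilinear_OH_br_const: "bilinear (OH_br_const p)"
  unfolding bilinear_def
  by (simp add: linear_iff OH_br_const_eq OH_br00_eq OH_br01_eq OH_br02_eq OH_br11_eq herm_form_def inner_linear_simps
      prod_eq_iff linear_add[OF linear_herm_adj] linear_scale[OF linear_herm_adj]
      cl.add_left cl.add_right cl.scaleR_left cl.scaleR_right herm_sq.add_right herm_sq.scaleR_right algebra_simps)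

lemma dder_zero_component:
  assumes "bounded_linear L" "smooth_on UNIV s" "\<And>p. L (s p) = 0"
  shows "L (dder h s p) = 0"
  using dder_bounded_linear[OF assms(1) smooth_onD(1)[OF assms(2) UNIV_I[of p]], of h] assms(3) by simp

lemmas dder_fst_0 = dder_zero_component[OF bounded_linear_fst]
lemmas dder_fst_snd_0 = dder_zero_component[OF bounded_linear_fst_comp[OF bounded_linear_snd]]
lemmas dder_snd_snd_0 = dder_zero_component[OF bounded_linear_snd_comp[OF bounded_linear_snd]]

lemma dder_direction_0: "smooth_on UNIV s \<Longrightarrow> dder 0 s p = 0"
  using linear_0[OF linear_frechet_derivative[OF smooth_onD(1)[of UNIV s p]]] by simp

lemma OH_rho_pos: "fst s = 0 \<Longrightarrow> OH_rho p s = 0"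
  by (simp add: OH_rho_def OH_rho0_linear_simps)

lemma OH_br_zero:
  "OH_br00 p 0 w = 0" "OH_br00 p w 0 = 0" "OH_br01 p 0 e = 0" "OH_br01 p w 0 = 0"
  "OH_br02 p 0 t = 0" "OH_br02 p w 0 = 0" "OH_br11 0 e = 0" "OH_br11 e 0 = 0"
  by (simp_all add: OH_br00_eq OH_br01_eq OH_br02_eq OH_br11_eq linear_0[OF linear_herm_adj] cl.zero_left cl.zero_right
      herm_sq.zero_right herm_form_linear_simps herm_form_sym[of 0])

lemma OH_bracket_pos:
  assumes "smooth_on UNIV s" "smooth_on UNIV s'" "\<And>p. fst (s p) = 0" "\<And>p. fst (s' p) = 0"
  shows "OH_bracket s s' p = (0, 0, OH_br11 (fst (snd (s p))) (fst (snd (s' p))))"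
  unfolding OH_bracket_def OH_br_const_eq
  by (simp add: assms OH_br_zero OH_rho_pos dder_direction_0)

lemma OH_bracket_degree:
  assumes s: "s \<in> sections UNIV (OH_E i)" and s': "s' \<in> sections UNIV (OH_E j)"
  shows "OH_bracket s s' \<in> sections UNIV (OH_E (i + j))"
proof -
  note D = sections_OH_ED[OF s] and D' = sections_OH_ED[OF s']
  have "OH_bracket s s' p \<in> OH_E (i + j)" for p
  proof (cases "i = 0")
    case False
    then have r: "fst (s p) = 0" for p using D by blast
    show ?thesis
    proof (cases "j = 0")
      case False
      then have r': "fst (s' p) = 0" for p using D' by blast
      have "OH_br11 (fst (snd (s p))) (fst (snd (s' p))) = 0" if "i + j \<noteq> 2"
        using that \<open>i \<noteq> 0\<close> \<open>j \<noteq> 0\<close> D(3)[of p] D'(3)[of p]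
        by (cases "i = 1") (auto simp: OH_br_zero)
      then show ?thesis unfolding OH_bracket_pos[OF D(1) D'(1) r r'] by (simp add: mem_OH_E)
    next
      case True
      have e: "snd (s' p) = 0" for p using s' True sections_OH_E0D by blast
      show ?thesis
        unfolding OH_bracket_E0_right[of s', OF e] OH_bracket_E0_left[of s', OF e] mem_OH_E
        using True False D D' dder_fst_0[OF D(1)] dder_fst_snd_0[OF D(1)] dder_snd_snd_0[OF D(1)]
        by (auto simp: ad0_def OH_br_zero OH_rho_pos dder_direction_0)
    qed
  next
    case True
    have e: "snd (s p) = 0" for p using s True sections_OH_E0D by blast
    have e': "snd (dder h s p) = 0" for h p
      by (rule dder_zero_component[OF bounded_linear_snd D(1) e])
    show ?thesis
      unfolding OH_bracket_E0_left[of s, OF e] mem_OH_E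
      using True D D' dder_fst_0[OF D'(1)] dder_fst_snd_0[OF D'(1)] dder_snd_snd_0[OF D'(1)] e'
      by (cases "j = 0") (auto simp: ad0_def OH_br_zero OH_rho_pos dder_direction_0)
  qed
  then show ?thesis using smooth_on_OH_bracket[OF open_UNIV D(1) D'(1)] by (simp add: sections_def)
qed

text \<open>Among arguments of negative degree only two of degree -1 have a nonzero bracket; it is
  symmetric, in accordance with the sign -(-1)^1 = 1.\<close>

lemma OH_bracket_skew:
  assumes x: "x \<in> sections UNIV (OH_E i)" and y: "y \<in> sections UNIV (OH_E j)"
  shows "OH_bracket y x = (\<lambda>p. - ((-1) ^ (i * j)) *\<^sub>R OH_bracket x y p)"
proof -
  note D = sections_OH_ED[OF x] and D' = sections_OH_ED[OF y]
  consider "i = 0" | "j = 0" | "i \<noteq> 0" "j \<noteq> 0" by blast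
  then show ?thesis
  proof cases
    case 1
    then have "\<And>p. snd (x p) = 0" using sections_OH_E0D x by blast
    from OH_bracket_E0_right[of x y, OF this] show ?thesis using 1 by simp
  next
    case 2
    then have "\<And>p. snd (y p) = 0" using sections_OH_E0D y by blast
    from OH_bracket_E0_right[of y x, OF this] show ?thesis using 2 by simp
  next
    case 3
    show ?thesis
    proof
      fix p
      let ?B = "OH_br11 (fst (snd (x p))) (fst (snd (y p)))"
      have "OH_bracket x y p = (0, 0, ?B)" "OH_bracket y x p = (0, 0, ?B)"
        using OH_bracket_pos[OF D(1) D'(1) D(2) D'(2)] OH_bracket_pos[OF D'(1) D(1) D'(2) D(2)] 3
        by (simp_all add: OH_br11_eq herm_form_sym)
      moreover have "i = 1 \<and> j = 1 \<or> ?B = 0"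
        using D(3)[of p] D'(3)[of p] by (cases "i = 1"; cases "j = 1") (simp_all add: OH_br_zero)
      ultimately show "OH_bracket y x p = - ((-1) ^ (i * j)) *\<^sub>R OH_bracket x y p"
        by (cases "?B = 0") simp_all
    qed
  qed
qed

text \<open>For i = 0 truncated subtraction places the image in \<open>OH_E 0\<close>; this is
  harmless because the image is zero there.\<close>

lemma OH_d_degree:
  assumes "s \<in> sections UNIV (OH_E i)"
  shows "(\<lambda>p. OH_d p (s p)) \<in> sections UNIV (OH_E (i - 1))" "i = 0 \<Longrightarrow> OH_d p (s p) = 0"
proof -
  note D = sections_OH_ED[OF assms]
  show "(\<lambda>p. OH_d p (s p)) \<in> sections UNIV (OH_E (i - 1))"
    using D smooth_on_OH_d[OF open_UNIV D(1)] unfolding sections_def mem_OH_E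
    by (auto simp: OH_d_eq cl.zero_left OH_d2_eq)
  show "OH_d p (s p) = 0" if "i = 0"
    using D that by (simp add: OH_d_eq cl.zero_left OH_d2_eq) (simp add: zero_prod_def)
qed

lemma OH_l_long: "length xs \<ge> 3 \<Longrightarrow> OH_l xs = (\<lambda>_. 0)"
  by (cases xs rule: OH_l.cases) auto

lemma OH_l_smooth: "set xs \<subseteq> sections UNIV UNIV \<Longrightarrow> smooth_on UNIV (OH_l xs)"
  by (cases xs rule: OH_l.cases)
    (auto simp: sections_UNIV_iff smooth_on_OH_d smooth_on_OH_bracket smooth_on_const)

lemma dder_linear_combination:
  assumes "smooth_on UNIV x" "smooth_on UNIV y"
  shows "dder h (\<lambda>p. a *\<^sub>R x p + b *\<^sub>R y p) p = a *\<^sub>R dder h x p + b *\<^sub>R dder h y p"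
  by (rule dder_eqI, intro has_derivative_add has_derivative_scaleR_right smooth_onD(2)[OF assms(1)]
      smooth_onD(2)[OF assms(2)] UNIV_I)

lemma OH_bracket_bilinear:
  assumes x: "smooth_on UNIV x" and y: "smooth_on UNIV y" and z: "smooth_on UNIV z"
  shows "OH_bracket (\<lambda>p. a *\<^sub>R x p + b *\<^sub>R y p) z p = a *\<^sub>R OH_bracket x z p + b *\<^sub>R OH_bracket y z p"
    "OH_bracket z (\<lambda>p. a *\<^sub>R x p + b *\<^sub>R y p) p = a *\<^sub>R OH_bracket z x p + b *\<^sub>R OH_bracket z y p"
proof -
  note B = bilinear_OH_br_const[of p]
  have l: "linear (frechet_derivative z (at p))" by (rule linear_frechet_derivative[OF smooth_onD(1)[OF z UNIV_I]])
  show "OH_bracket (\<lambda>p. a *\<^sub>R x p + b *\<^sub>R y p) z p = a *\<^sub>R OH_bracket x z p + b *\<^sub>R OH_bracket y z p"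
    "OH_bracket z (\<lambda>p. a *\<^sub>R x p + b *\<^sub>R y p) p = a *\<^sub>R OH_bracket z x p + b *\<^sub>R OH_bracket z y p"
    unfolding OH_bracket_def dder_linear_combination[OF x y] OH_rho_linear
      bilinear_ladd[OF B] bilinear_lmul[OF B] bilinear_radd[OF B] bilinear_rmul[OF B]
      linear_add[OF l] linear_scale[OF l]
    by (simp_all add: algebra_simps)
qed

lemma OH_bracket_function_right:
  assumes y: "smooth_on UNIV y" and x: "smooth_on UNIV x" and f: "smooth_on UNIV f"
  shows "OH_bracket x (\<lambda>p. f p *\<^sub>R y p) p
    = f p *\<^sub>R OH_bracket x y p + frechet_derivative f (at p) (OH_rho p (x p)) *\<^sub>R y p"
proof -
  note B = bilinear_OH_br_const[of p]
  have l: "linear (frechet_derivative x (at p))" by (rule linear_frechet_derivative[OF smooth_onD(1)[OF x UNIV_I]])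
  have "dder h (\<lambda>p. f p *\<^sub>R y p) p = f p *\<^sub>R dder h y p + dder h f p *\<^sub>R y p" for h
    by (rule dder_eqI, intro has_derivative_scaleR smooth_onD(2)[OF f] smooth_onD(2)[OF y] UNIV_I)
  then show ?thesis
    unfolding OH_bracket_def OH_rho_linear bilinear_rmul[OF B] linear_scale[OF l]
    by (simp add: algebra_simps)
qed

subsection \<open>The higher Jacobi identities\<close>

lemma unshuffles_1_1: "unshuffles 1 1 = {id, Transposition.transpose 0 1}"
proof (intro set_eqI)
  fix \<sigma> :: "nat \<Rightarrow> nat"
  have "\<sigma> \<in> unshuffles 1 1 \<longleftrightarrow> \<sigma> permutes {..<2}"
    unfolding unshuffles_def strict_mono_on_def one_add_one by auto
  also have "{..<2} = {0, 1::nat}" by auto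
  also have "\<sigma> permutes {0, 1} \<longleftrightarrow> \<sigma> \<in> {id, Transposition.transpose 0 1}"
    using permutes_doubleton_iff[of \<sigma> 0 1] by simp
  finally show "\<sigma> \<in> unshuffles 1 1 \<longleftrightarrow> \<sigma> \<in> {id, Transposition.transpose 0 1}" .
qed

lemma unshuffles_2_0: "unshuffles 2 0 = {id}"
proof (intro set_eqI)
  fix \<sigma> :: "nat \<Rightarrow> nat"
  have "{..<2} = {0, 1::nat}" by auto
  then have "\<sigma> \<in> unshuffles 2 0 \<longleftrightarrow> \<sigma> permutes {0, 1} \<and> \<sigma> 0 < \<sigma> 1"
    unfolding unshuffles_def strict_mono_on_def add_0_right by auto
  also have "\<dots> \<longleftrightarrow> \<sigma> \<in> {id}"
    using permutes_doubleton_iff[of \<sigma> 0 1] by (auto simp: permutes_id)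
  finally show "\<sigma> \<in> unshuffles 2 0 \<longleftrightarrow> \<sigma> \<in> {id}" .
qed

text \<open>The cycle with values 1, 2, 0 on 0, 1, 2; it is the unshuffle that places the first
  argument last.\<close>

definition cyc3 :: "nat \<Rightarrow> nat" where
  "cyc3 = Transposition.transpose 0 1 \<circ> Transposition.transpose 1 2"

lemma cyc3_simps: "cyc3 0 = 1" "cyc3 1 = 2" "cyc3 (Suc 0) = 2" "cyc3 2 = 0" "i \<ge> 3 \<Longrightarrow> cyc3 i = i"
  by (simp_all add: cyc3_def Transposition.transpose_def)

lemma unshuffles_2_1: "unshuffles 2 1 = {id, Transposition.transpose 1 2, cyc3}"
proof -
  have eq: "\<sigma> = \<tau>" if "\<sigma> permutes {..<3}" "\<sigma> 0 = \<tau> 0" "\<sigma> 1 = \<tau> 1" "\<sigma> 2 = \<tau> 2" "\<And>i. i \<ge> 3 \<Longrightarrow> \<tau> i = i" for \<sigma> \<tau> :: "nat \<Rightarrow> nat"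
  proof
    fix i :: nat
    consider "i = 0" | "i = 1" | "i = 2" | "i \<ge> 3" by linarith
    then show "\<sigma> i = \<tau> i" using that permutes_not_in[OF that(1), of i] by cases auto
  qed
  have "\<sigma> = id \<or> \<sigma> = Transposition.transpose 1 2 \<or> \<sigma> = cyc3" if p: "\<sigma> permutes {..<3}" and m: "strict_mono_on {..<2} \<sigma>" for \<sigma>
  proof -
    have "\<sigma> 0 < \<sigma> 1" using m by (simp add: strict_mono_on_def)
    moreover have "\<sigma> 0 < 3" "\<sigma> 1 < 3" "\<sigma> 2 < 3" using permutes_in_image[OF p] by auto
    moreover have "\<sigma> 2 \<noteq> \<sigma> 0" "\<sigma> 2 \<noteq> \<sigma> 1" using inj_eq[OF permutes_inj[OF p]] by simp_all
    ultimately have "\<sigma> 0 = 0 \<and> \<sigma> 1 = 1 \<and> \<sigma> 2 = 2 \<or> \<sigma> 0 = 0 \<and> \<sigma> 1 = 2 \<and> \<sigma> 2 = 1 \<or> \<sigma> 0 = 1 \<and> \<sigma> 1 = 2 \<and> \<sigma> 2 = 0"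
      by linarith
    then show ?thesis
      using eq[OF p, of id] eq[OF p, of "Transposition.transpose 1 2"] eq[OF p, of cyc3]
      by (auto simp: cyc3_simps Transposition.transpose_def)
  qed
  moreover have "Transposition.transpose 1 2 permutes {..<3::nat}" by (rule permutes_swap_id) auto
  moreover have "cyc3 permutes {..<3}"
    unfolding cyc3_def by (intro permutes_compose permutes_swap_id) auto
  moreover have "\<sigma> \<in> unshuffles 2 1 \<longleftrightarrow> \<sigma> permutes {..<3} \<and> strict_mono_on {..<2} \<sigma>" for \<sigma>
  proof -
    have "2 + 1 = (3::nat)" by simp
    then show ?thesis unfolding unshuffles_def by (auto simp: strict_mono_on_def)
  qed
  moreover have "strict_mono_on {..<2} \<sigma> \<longleftrightarrow> \<sigma> 0 < \<sigma> 1" for \<sigma> :: "nat \<Rightarrow> nat"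
  proof -
    have "{..<2} = {0, 1::nat}" by auto
    then show ?thesis by (auto simp: strict_mono_on_def)
  qed
  ultimately show ?thesis
    by (intro set_eqI) (auto simp: permutes_id cyc3_simps Transposition.transpose_def)
qed

lemma koszul_sign_id: "koszul_sign ds id = 1"
  unfolding koszul_sign_def by (rule prod.neutral) auto

lemma koszul_sign_2:
  assumes "length ds = 2"
  shows "koszul_sign ds (Transposition.transpose 0 1) = - ((-1) ^ (ds ! 0 * ds ! 1))"
proof -
  have "{(a, b). a < b \<and> b < length ds \<and> Transposition.transpose 0 1 b < Transposition.transpose 0 (1::nat) a} = {(0, 1)}"
    using assms by (auto simp: Transposition.transpose_def)
  then show "koszul_sign ds (Transposition.transpose 0 1) = - ((-1) ^ (ds ! 0 * ds ! 1))"
    unfolding koszul_sign_def by (simp add: mult.commute)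
qed

text \<open>The cycle has the two inversions (0, 2) and (1, 2), so the minus signs cancel and only
  the degree-dependent signs remain.\<close>

lemma koszul_sign_3:
  assumes "length ds = 3"
  shows "koszul_sign ds (Transposition.transpose 1 2) = - ((-1) ^ (ds ! 1 * ds ! 2))"
    "koszul_sign ds cyc3 = (-1) ^ (ds ! 0 * ds ! 1 + ds ! 0 * ds ! 2)"
proof -
  have "{(a, b). a < b \<and> b < length ds \<and> Transposition.transpose 1 2 b < Transposition.transpose 1 (2::nat) a} = {(1, 2)}"
    using assms by (auto simp: Transposition.transpose_def)
  then show "koszul_sign ds (Transposition.transpose 1 2) = - ((-1) ^ (ds ! 1 * ds ! 2))"
    unfolding koszul_sign_def by (simp add: mult.commute)
  have "(a, b) \<in> {(0, 2), (1, 2)}" if "a < b" "b < 3" "cyc3 b < cyc3 a" for a b :: nat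
  proof -
    have "a = 0 \<and> b = 1 \<or> a = 0 \<and> b = 2 \<or> a = 1 \<and> b = 2" using that(1,2) by linarith
    then show ?thesis using that(3) by (auto simp: cyc3_simps)
  qed
  then have "{(a, b). a < b \<and> b < length ds \<and> cyc3 b < cyc3 a} = {(0, 2), (1, 2)}"
    using assms by (auto simp: cyc3_simps)
  then show "koszul_sign ds cyc3 = (-1) ^ (ds ! 0 * ds ! 1 + ds ! 0 * ds ! 2)"
    unfolding koszul_sign_def by (simp add: cyc3_simps mult.commute power_add)
qed

lemma OH_bracket_zero:
  "smooth_on UNIV s \<Longrightarrow> OH_bracket (\<lambda>_. 0) s p = 0" "smooth_on UNIV s \<Longrightarrow> OH_bracket s (\<lambda>_. 0) p = 0"
  using OH_bracket_bilinear[of s s s 0 0] by simp_all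

lemma OH_bracket_minus:
  "smooth_on UNIV s \<Longrightarrow> smooth_on UNIV z \<Longrightarrow> OH_bracket (\<lambda>p. - s p) z p = - OH_bracket s z p"
  "smooth_on UNIV s \<Longrightarrow> smooth_on UNIV z \<Longrightarrow> OH_bracket z (\<lambda>p. - s p) p = - OH_bracket z s p"
  using OH_bracket_bilinear[of s s z "-1" 0 p] by simp_all

lemma sections_ge3_zero: "s \<in> sections UNIV (OH_E i) \<Longrightarrow> i \<ge> 3 \<Longrightarrow> s = (\<lambda>_. 0)"
  using OH_E_ge3[of i] by (auto simp: sections_def)

text \<open>Reduces to \<open>d1_br01\<close> and \<open>d2_br02\<close>: their extra terms are
  exactly the derivatives of the coefficients of d along the anchor of e. The derivatives of e drop
  out because the anchor annihilates the image of d and d annihilates degree 0.\<close>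

lemma d_bracket_E0:
  assumes e: "e \<in> sections UNIV (OH_E 0)" and s: "smooth_on UNIV s"
  shows "OH_d p (OH_bracket e s p) = OH_bracket e (\<lambda>p. OH_d p (s p)) p"
proof -
  have e0: "snd (e p) = 0" for p using sections_OH_E0D[OF e] .
  have es: "smooth_on UNIV e" using sections_OH_ED(1)[OF e] .
  have sd: "snd (dder h e p) = 0" for h by (rule dder_zero_component[OF bounded_linear_snd es e0])
  let ?w = "fst (e p)" and ?f = "fst (snd (s p))" and ?t = "snd (snd (s p))"
  have D: "dder h (\<lambda>q. OH_d q (s q)) p = OH_d p (dder h s p) + (OH_d1 h ?f, - ?t *\<^sub>R herm_sq p h, 0)" for h
    by (rule dder_eqI[OF has_derivative_OH_d[OF smooth_onD(2)[OF s UNIV_I]]])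
  have r: "OH_rho p (OH_d p (s p)) = 0" by (simp add: OH_rho_def OH_d_eq rho_d1)
  have z: "OH_d p v = 0" if "snd v = 0" for v
    using that by (simp add: OH_d_eq cl.zero_left OH_d2_eq) (simp add: zero_prod_def)
  have l: "OH_d p (a + b) = OH_d p a + OH_d p b" "OH_d p (a - b) = OH_d p a - OH_d p b" for a b
    using linear_add[OF linear_OH_d] linear_diff[OF linear_OH_d] by blast+
  have "OH_d p (ad0 p ?w (s p)) = ad0 p ?w (OH_d p (s p)) + (OH_d1 (OH_rho p (e p)) ?f, - ?t *\<^sub>R herm_sq p (OH_rho p (e p)), 0)"
    using d1_br01[of p ?w ?f] d2_br02[of p ?w ?t]
    by (simp add: OH_d_eq ad0_def OH_rho_def OH_br_zero)
  then show ?thesis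
    unfolding OH_bracket_E0_left[of e, OF e0] D r l z[OF sd] dder_direction_0[OF es] by simp
qed

lemma d_bracket_E1:
  assumes f: "f \<in> sections UNIV (OH_E 1)" and g: "g \<in> sections UNIV (OH_E 1)"
  shows "OH_d p (OH_bracket f g p) = OH_bracket (\<lambda>p. OH_d p (f p)) g p + OH_bracket (\<lambda>p. OH_d p (g p)) f p"
proof -
  have E: "OH_bracket (\<lambda>p. OH_d p (f p)) g p = (0, OH_br01 p (OH_d1 p (fst (snd (f p)))) (fst (snd (g p))), 0)"
    if f: "f \<in> sections UNIV (OH_E 1)" and g: "g \<in> sections UNIV (OH_E 1)" for f g
  proof -
    note F = sections_OH_ED[OF f] and G = sections_OH_ED[OF g]
    have s: "snd (OH_d p (f p)) = 0" for p using F by (simp add: OH_d_eq OH_d2_eq zero_prod_def)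
    have "OH_rho p (OH_d p (f p)) = 0" by (simp add: OH_rho_def OH_d_eq rho_d1)
    moreover have "OH_rho p (g p) = 0" using G by (simp add: OH_rho_pos)
    ultimately show ?thesis
      unfolding OH_bracket_E0_left[of "\<lambda>p. OH_d p (f p)", OF s]
      using G dder_direction_0[OF smooth_on_OH_d[OF open_UNIV F(1)]] dder_direction_0[OF G(1)]
      by (simp add: ad0_def OH_d_eq OH_br_zero)
  qed
  note F = sections_OH_ED[OF f] and G = sections_OH_ED[OF g]
  have "OH_bracket f g p = (0, 0, OH_br11 (fst (snd (f p))) (fst (snd (g p))))"
    using F G by (intro OH_bracket_pos) auto
  then show ?thesis
    unfolding E[OF f g] E[OF g f] using d2_br11[of p "fst (snd (f p))" "fst (snd (g p))"]
    by (simp add: cl.zero_left)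
qed

lemma d_bracket_E1_E2:
  assumes f: "f \<in> sections UNIV (OH_E 1)" and t: "t \<in> sections UNIV (OH_E 2)"
  shows "OH_bracket (\<lambda>p. OH_d p (f p)) t p = OH_bracket (\<lambda>p. OH_d p (t p)) f p"
proof -
  note F = sections_OH_ED[OF f] and T = sections_OH_ED[OF t]
  have s: "snd (OH_d p (f p)) = 0" for p using F by (simp add: OH_d_eq OH_d2_eq zero_prod_def)
  have r: "OH_rho p (OH_d p (f p)) = 0" "OH_rho p (t p) = 0"
    using T by (simp_all add: OH_rho_def OH_d_eq rho_d1 OH_rho0_linear_simps)
  have "OH_bracket (\<lambda>p. OH_d p (f p)) t p = (0, 0, OH_br02 p (OH_d1 p (fst (snd (f p)))) (snd (snd (t p))))"
    unfolding OH_bracket_E0_left[of "\<lambda>p. OH_d p (f p)", OF s] r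
    using T dder_direction_0[OF smooth_on_OH_d[OF open_UNIV F(1)]] dder_direction_0[OF T(1)]
    by (simp add: ad0_def OH_d_eq OH_br_zero)
  also have "\<dots> = OH_bracket (\<lambda>p. OH_d p (t p)) f p"
    by (subst OH_bracket_pos[OF smooth_on_OH_d[OF open_UNIV T(1)] F(1)])
      (use F T in \<open>auto simp: OH_d_eq cl.zero_left br02_d1\<close>)
  finally show ?thesis .
qed

lemma jacobi_E0_E1_E1:
  assumes e: "e \<in> sections UNIV (OH_E 0)" and f: "f \<in> sections UNIV (OH_E 1)" and g: "g \<in> sections UNIV (OH_E 1)"
  shows "OH_bracket e (OH_bracket f g) p = OH_bracket (OH_bracket e f) g p + OH_bracket (OH_bracket e g) f p"
proof -
  have e0: "snd (e p) = 0" for p using sections_OH_E0D[OF e] .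
  note F = sections_OH_ED[OF f] and G = sections_OH_ED[OF g] and es = sections_OH_ED(1)[OF e]
  have F0: "fst (f p) = 0" and G0: "fst (g p) = 0" for p using F G by auto
  have fg: "OH_bracket f g = (\<lambda>p. (0, 0, OH_br11 (fst (snd (f p))) (fst (snd (g p)))))"
    using OH_bracket_pos[OF F(1) G(1) F0 G0] by blast
  let ?a = "OH_rho p (e p)"
  have 1: "fst (snd (OH_bracket e f p)) = OH_br01 p (fst (e p)) (fst (snd (f p))) + fst (snd (dder ?a f p))"
    if "f \<in> sections UNIV (OH_E 1)" for f
    using sections_OH_ED[OF that] dder_direction_0[OF es] unfolding OH_bracket_E0_left[of e, OF e0]
    by (simp add: ad0_def OH_rho_pos)
  have 2: "OH_bracket (OH_bracket e f) g p
      = (0, 0, OH_br11 (fst (snd (OH_bracket e f p))) (fst (snd (g p))))"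
    if f: "f \<in> sections UNIV (OH_E 1)" and g: "g \<in> sections UNIV (OH_E 1)" for f g
    using sections_OH_ED[OF g] sections_OH_ED[OF OH_bracket_degree[OF e f]] by (intro OH_bracket_pos) auto
  have "((\<lambda>p. (0::oct2, 0::herm, - 2 * herm_form (fst (snd (f p))) (fst (snd (g p))))) has_derivative
      (\<lambda>h. (0, 0, - 2 * (herm_form (fst (snd (f p))) (fst (snd (dder h g p)))
        + herm_form (fst (snd (dder h f p))) (fst (snd (g p))))))) (at p)"
  proof -
    have "bilinear herm_form"
      by (auto simp: bilinear_def linear_iff herm_form_linear_simps)
    then have B: "bounded_bilinear herm_form" by (simp add: bilinear_conv_bounded_bilinear)
    show ?thesis
      by (intro has_derivative_Pair has_derivative_const has_derivative_mult_right bounded_bilinear.FDERIV[OF B]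
          has_derivative_fst has_derivative_snd smooth_onD(2)[OF F(1)] smooth_onD(2)[OF G(1)] UNIV_I)
  qed
  then have D: "dder h (OH_bracket f g) p = (0, 0, OH_br11 (fst (snd (f p))) (fst (snd (dder h g p)))
      + OH_br11 (fst (snd (dder h f p))) (fst (snd (g p))))" for h
    unfolding fg OH_br11_eq using dder_eqI by fastforce
  have rfg: "OH_rho p (OH_bracket f g p) = 0" unfolding fg by (simp add: OH_rho_pos)
  have br11_add: "OH_br11 (x + y) z = OH_br11 x z + OH_br11 y z" "OH_br11 x y = OH_br11 y x" for x y z
    by (simp_all add: OH_br11_eq herm_form_linear_simps herm_form_sym)
  have "OH_bracket e (OH_bracket f g) p = ad0 p (fst (e p)) (OH_bracket f g p) + dder ?a (OH_bracket f g) p"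
    unfolding OH_bracket_E0_left[of e, OF e0] rfg dder_direction_0[OF es] by simp
  then show ?thesis
    unfolding 2[OF f g] 2[OF g f] 1[OF f] 1[OF g] D
    using jacobi_011_const[of p "fst (e p)" "fst (snd (f p))" "fst (snd (g p))"]
    by (simp add: fg ad0_def OH_br_zero br11_add(1)) (simp add: br11_add(2)[of _ "fst (snd (f p))"])
qed

text \<open>The Jacobi identity for two arguments with its two (1,1)-unshuffles written out. Either
  an argument has degree 0 and \<open>d_bracket_E0\<close> applies, or only the degrees 1 and 2
  matter.\<close>

lemma jacobi_2:
  assumes x: "x \<in> sections UNIV (OH_E i)" and y: "y \<in> sections UNIV (OH_E j)"
  shows "OH_d p (OH_bracket x y p) - OH_bracket (\<lambda>p. OH_d p (x p)) y p
    + (-1) ^ (i * j) *\<^sub>R OH_bracket (\<lambda>p. OH_d p (y p)) x p = 0"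
proof -
  note X = sections_OH_ED[OF x] and Y = sections_OH_ED[OF y]
  note dx = smooth_on_OH_d[OF open_UNIV X(1)] and dy = smooth_on_OH_d[OF open_UNIV Y(1)]
  have d0: "OH_d p 0 = 0" for p by (rule linear_0[OF linear_OH_d])
  consider "i = 0" | "i \<noteq> 0" "j = 0" | "i \<ge> 3 \<or> j \<ge> 3" | "i \<in> {1, 2}" "j \<in> {1, 2}"
    by force
  then show ?thesis
  proof cases
    case 1
    have x0: "x \<in> sections UNIV (OH_E 0)" using x 1 by simp
    have "(\<lambda>p. OH_d p (x p)) = (\<lambda>_. 0)" using OH_d_degree(2)[OF x 1] by blast
    moreover have "OH_bracket (\<lambda>p. OH_d p (y p)) x p = - OH_bracket x (\<lambda>p. OH_d p (y p)) p"
      by (rule fun_cong[OF OH_bracket_E0_right]) (rule sections_OH_E0D[OF x0])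
    ultimately show ?thesis using d_bracket_E0[OF x0 Y(1)] 1 by (simp add: OH_bracket_zero(1)[OF Y(1)])
  next
    case 2
    have y0: "y \<in> sections UNIV (OH_E 0)" using y 2 by simp
    have "(\<lambda>p. OH_d p (y p)) = (\<lambda>_. 0)" using OH_d_degree(2)[OF y 2(2)] by blast
    moreover have "OH_bracket (\<lambda>p. OH_d p (x p)) y p = - OH_bracket y (\<lambda>p. OH_d p (x p)) p"
      "OH_bracket x y p = - OH_bracket y x p"
      by (rule fun_cong[OF OH_bracket_E0_right], rule sections_OH_E0D[OF y0])+
    ultimately show ?thesis
      using d_bracket_E0[OF y0 X(1)] 2 by (simp add: OH_bracket_zero(1)[OF X(1)] linear_neg[OF linear_OH_d])
  next
    case 3
    then have "x = (\<lambda>_. 0) \<or> y = (\<lambda>_. 0)" using sections_ge3_zero x y by blast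
    then show ?thesis
      by (elim disjE) (simp_all add: OH_bracket_zero[OF X(1)] OH_bracket_zero[OF Y(1)]
          OH_bracket_zero[OF dx] OH_bracket_zero[OF dy] d0)
  next
    case 4
    have z: "OH_bracket u v p = 0" if "u \<in> sections UNIV (OH_E a)" "v \<in> sections UNIV (OH_E b)" "a + b \<ge> 3" for u v a b p
      using sections_ge3_zero[OF OH_bracket_degree[OF that(1,2)] that(3)] by simp
    from 4 consider "i = 1" "j = 1" | "i = 1" "j = 2" | "i = 2" "j = 1" | "i = 2" "j = 2" by blast
    then show ?thesis
    proof cases
      case 1
      then show ?thesis using d_bracket_E1[of x y p] x y by simp
    next
      case 2
      have "OH_bracket x y p = 0" using z[OF x y] 2 by simp
      then show ?thesis using d_bracket_E1_E2[of x y p] x y 2 d0 by simp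
    next
      case 3
      have "OH_bracket x y p = 0" using z[OF x y] 3 by simp
      then show ?thesis using d_bracket_E1_E2[of y x p] x y 3 d0 by simp
    next
      case 4
      then show ?thesis
        using z[OF x y, of p] z[OF OH_d_degree(1)[OF x] y, of p] z[OF OH_d_degree(1)[OF y] x, of p] d0 by simp
    qed
  qed
qed

text \<open>Only brackets of brackets occur, since the ternary bracket is zero. They preserve the
  total degree, so everything vanishes once i + j + k is at least 3. Otherwise two arguments have
  degree 0, or one has degree 0 and the other two have degree 1.\<close>

lemma jacobi_3:
  assumes x: "x \<in> sections UNIV (OH_E i)" and y: "y \<in> sections UNIV (OH_E j)" and z: "z \<in> sections UNIV (OH_E k)"
  shows "OH_bracket (OH_bracket x y) z p - (-1) ^ (j * k) *\<^sub>R OH_bracket (OH_bracket x z) y p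
    + (-1) ^ (i * j + i * k) *\<^sub>R OH_bracket (OH_bracket y z) x p = 0"
proof -
  note X = sections_OH_ED(1)[OF x] and Y = sections_OH_ED(1)[OF y] and Z = sections_OH_ED(1)[OF z]
  note br = smooth_on_OH_bracket[OF open_UNIV]
  have right: "OH_bracket s e = (\<lambda>p. - OH_bracket e s p)" if "e \<in> sections UNIV (OH_E 0)" for e s
    using OH_bracket_E0_right sections_OH_E0D[OF that] by blast
  have J: "OH_bracket (OH_bracket e e') s p = OH_bracket e (OH_bracket e' s) p - OH_bracket e' (OH_bracket e s) p"
    if e: "e \<in> sections UNIV (OH_E 0)" and e': "e' \<in> sections UNIV (OH_E 0)" and s: "smooth_on UNIV s" for e e' s
    by (rule jacobi_E0_E0[OF sections_OH_E0D[OF e] sections_OH_ED(1)[OF e] sections_OH_E0D[OF e'] sections_OH_ED(1)[OF e'] s])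
  have "i + j + k \<ge> 3 \<or> i = 0 \<and> j = 0 \<or> i = 0 \<and> k = 0 \<or> j = 0 \<and> k = 0
    \<or> i = 0 \<and> j = 1 \<and> k = 1 \<or> i = 1 \<and> j = 0 \<and> k = 1 \<or> i = 1 \<and> j = 1 \<and> k = 0"
    by (cases "i = 0"; cases "j = 0"; cases "k = 0") auto
  then consider "i + j + k \<ge> 3" | "i = 0" "j = 0" | "i = 0" "k = 0" | "j = 0" "k = 0"
    | "i = 0" "j = 1" "k = 1" | "i = 1" "j = 0" "k = 1" | "i = 1" "j = 1" "k = 0" by blast
  then show ?thesis
  proof cases
    case 1
    have "OH_bracket (OH_bracket u v) w p = 0"
      if "u \<in> sections UNIV (OH_E a)" "v \<in> sections UNIV (OH_E b)" "w \<in> sections UNIV (OH_E c)" "a + b + c \<ge> 3" for u v w a b c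
      using sections_ge3_zero[OF OH_bracket_degree[OF OH_bracket_degree[OF that(1,2)] that(3)] that(4)] by simp
    from this[OF x y z] this[OF x z y] this[OF y z x] 1 show ?thesis by simp
  next
    case 2
    have x0: "x \<in> sections UNIV (OH_E 0)" and y0: "y \<in> sections UNIV (OH_E 0)" using x y 2 by auto
    show ?thesis
      using J[OF x0 y0 Z] right[OF x0, of "OH_bracket y z"] right[OF y0, of "OH_bracket x z"] 2 by simp
  next
    case 3
    have x0: "x \<in> sections UNIV (OH_E 0)" and z0: "z \<in> sections UNIV (OH_E 0)" using x z 3 by auto
    show ?thesis
      using J[OF x0 z0 Y] right[OF z0, of "OH_bracket x y"] right[OF z0, of y] right[OF x0, of "OH_bracket y z"]
        OH_bracket_minus(2)[OF br[OF Z Y] X, of p] 3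
      by simp
  next
    case 4
    have y0: "y \<in> sections UNIV (OH_E 0)" and z0: "z \<in> sections UNIV (OH_E 0)" using y z 4 by auto
    show ?thesis
      using J[OF y0 z0 X] right[OF y0, of x] right[OF z0, of x]
        right[OF z0, of "OH_bracket x y"] right[OF y0, of "OH_bracket x z"]
        OH_bracket_minus(2)[OF br[OF Y X] Z, of p] OH_bracket_minus(2)[OF br[OF Z X] Y, of p] 4
      by simp
  next
    case 5
    then show ?thesis using jacobi_E0_E1_E1[of x y z p] right[of x "OH_bracket y z"] x y z by simp
  next
    case 6
    then show ?thesis using jacobi_E0_E1_E1[of y x z p] right[of y "OH_bracket x z"] right[of y x] x y z
      OH_bracket_minus(1)[OF br[OF Y X] Z, of p] by simp
  next
    case 7
    then show ?thesis using jacobi_E0_E1_E1[of z x y p] right[of z "OH_bracket x y"] right[of z x] right[of z y] x y z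
      OH_bracket_minus(1)[OF br[OF Z X] Y, of p] OH_bracket_minus(1)[OF br[OF Z Y] X, of p] by simp
  qed
qed

lemma OH_higher_jacobi:
  assumes n: "n \<ge> 1" "length xs = n" "length ds = n"
    and xs: "\<And>j. j < n \<Longrightarrow> xs ! j \<in> sections UNIV (OH_E (ds ! j))"
  shows "(\<Sum>i = 1..n. (-1) ^ (i * (n - i)) *\<^sub>R
    (\<Sum>\<sigma>\<in>unshuffles i (n - i). koszul_sign ds \<sigma> *\<^sub>R
      OH_l (OH_l (map (\<lambda>j. xs ! \<sigma> j) [0..<i]) # map (\<lambda>j. xs ! \<sigma> j) [i..<n]) p)) = 0"
proof -
  have d0: "OH_d p 0 = 0" for p by (rule linear_0[OF linear_OH_d])
  consider "n = 1" | "n = 2" | "n = 3" | "n \<ge> 4" using n(1) by linarith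
  then show ?thesis
  proof cases
    case 1
    have "OH_d p (OH_d p v) = 0" for v
      by (simp add: OH_d_eq d1_d2) (simp add: OH_d2_eq zero_prod_def)
    then show ?thesis using 1 by simp
  next
    case 2
    have m: "[0..<2] = [0, 1]" "[Suc 0..<2] = [Suc 0]" "{Suc 0..2} = {Suc 0, 2}" by (auto simp: upt_rec)
    have ne: "id \<noteq> Transposition.transpose 0 (Suc 0)"
      by (metis id_apply transpose_apply_first zero_neq_one One_nat_def)
    show ?thesis
      using jacobi_2[OF xs[of 0] xs[of 1], of p] 2 n ne
      by (simp add: unshuffles_1_1[unfolded One_nat_def] unshuffles_2_0 koszul_sign_id
          koszul_sign_2[unfolded One_nat_def] m algebra_simps)
  next
    case 3
    have m: "[0..<2] = [0, 1]" "[0..<3] = [0, 1, 2]" "[Suc 0..<3] = [Suc 0, 2]" "[2..<3] = [2]"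
      "{Suc 0..3} = {Suc 0, 2, 3}" by (auto simp: upt_rec)
    have "id 1 \<noteq> Transposition.transpose 1 (2::nat) 1" "id 0 \<noteq> cyc3 0" "Transposition.transpose 1 2 0 \<noteq> cyc3 0"
      by (simp_all add: cyc3_simps Transposition.transpose_def)
    then have ne: "id \<noteq> Transposition.transpose 1 (2::nat)" "id \<noteq> cyc3" "Transposition.transpose 1 2 \<noteq> cyc3"
      by metis+
    have t: "Transposition.transpose (Suc 0) 2 0 = 0" by (simp add: Transposition.transpose_def)
    show ?thesis
      using jacobi_3[OF xs[of 0] xs[of 1] xs[of 2], of p] 3 n ne
      by (simp add: unshuffles_2_1[unfolded One_nat_def] koszul_sign_id koszul_sign_3[unfolded One_nat_def]
          m d0 cyc3_simps t algebra_simps)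
  next
    case 4
    \<comment> \<open>With at least four arguments either the inner or the outer bracket has three
      or more entries. If it is the inner one, the outer bracket must also be seen to send the zero
      section to zero, which for the binary bracket uses smoothness of the other entry.\<close>
    have "OH_l (OH_l (map (\<lambda>j. xs ! \<sigma> j) [0..<i]) # map (\<lambda>j. xs ! \<sigma> j) [i..<n]) p = 0"
      if i: "i \<in> {1..n}" and s: "\<sigma> \<in> unshuffles i (n - i)" for i \<sigma>
    proof (cases "i \<ge> 3")
      case True
      then have 1: "OH_l (map (\<lambda>j. xs ! \<sigma> j) [0..<i]) = (\<lambda>_. 0)" by (intro OH_l_long) simp
      consider "i = n" | "i = n - 1" "i < n" | "i < n - 1" using i by fastforce
      then show ?thesis
      proof cases
        case 1
        then show ?thesis using \<open>OH_l _ = _\<close> d0 by simp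
      next
        case 2
        have "\<sigma> permutes {..<n}" using s i by (simp add: unshuffles_def)
        then have "\<sigma> i < n" using permutes_in_image 2 by fastforce
        from sections_OH_ED(1)[OF xs[OF this]] have "smooth_on UNIV (xs ! \<sigma> i)" .
        moreover have "[i..<n] = [i]" using 2 by (simp add: upt_rec)
        ultimately show ?thesis using \<open>OH_l _ = _\<close> OH_bracket_zero(1) by simp
      next
        case 3
        show ?thesis by (subst OH_l_long) (use 3 in auto)
      qed
    next
      case False
      show ?thesis by (subst OH_l_long) (use False 4 in auto)
    qed
    then show ?thesis by simp
  qed
qed

section \<open>Verification of the algebroid axioms\<close>

lemma length_3_cases:
  obtains "xs = []" "ys = []" | z where "xs = [z]" "ys = []" | z where "xs = []" "ys = [z]"
    | "length xs + length ys \<ge> 2"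
  by (cases xs; cases ys; cases "tl xs"; cases "tl ys") auto

theorem OH_lie_3_algebroid: "lie_n_algebroid 3 OH_E OH_l OH_rho"
proof unfold_locales
  show "graded_fibre OH_E" by (rule graded_fibre_OH_E)
  show "bundle_morphism (OH_E 0) UNIV OH_rho"
    unfolding bundle_morphism_def by (auto simp: OH_rho_linear intro!: smooth_intros)
  show "OH_l xs \<in> sections UNIV UNIV" if "xs \<noteq> []" "set xs \<subseteq> sections UNIV UNIV" for xs
    using OH_l_smooth[OF that(2)] by (simp add: sections_def)
  show "OH_l (xs @ (\<lambda>p. a *\<^sub>R x p + b *\<^sub>R y p) # ys) = (\<lambda>p. a *\<^sub>R OH_l (xs @ x # ys) p + b *\<^sub>R OH_l (xs @ y # ys) p)"
    if s: "set xs \<union> {x, y} \<union> set ys \<subseteq> sections UNIV UNIV" for xs x y ys a b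
  proof (cases rule: length_3_cases[of xs ys])
    case 1
    then show ?thesis by (simp add: linear_add[OF linear_OH_d] linear_scale[OF linear_OH_d])
  next
    case 4
    have "OH_l (xs @ z # ys) = (\<lambda>_. 0)" for z by (rule OH_l_long) (use 4 in simp)
    then show ?thesis by simp
  qed (use s in \<open>simp_all add: sections_UNIV_iff OH_bracket_bilinear fun_eq_iff\<close>)
  show "OH_l xs \<in> sections UNIV (graded_part OH_E (2 - int (length xs) - int (sum_list ds)))"
    if ne: "xs \<noteq> []" and len: "length ds = length xs" and s: "\<And>j. j < length xs \<Longrightarrow> xs ! j \<in> sections UNIV (OH_E (ds ! j))" for xs ds
  proof (cases xs rule: OH_l.cases)
    case (1 x)
    then obtain i where ds: "ds = [i]" using len by (cases ds) auto
    have x: "x \<in> sections UNIV (OH_E i)" using s[of 0] 1 ds by simp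
    show ?thesis
    proof (cases "i = 0")
      case True
      then show ?thesis using OH_d_degree(2)[OF x] 1 ds
        by (simp add: graded_part_def sections_def smooth_on_const)
    next
      case False
      then have "nat (int i - 1) = i - 1" by simp
      then show ?thesis using OH_d_degree(1)[OF x] 1 ds False by (simp add: graded_part_def)
    qed
  next
    case (2 x y)
    then obtain i j where ds: "ds = [i, j]" using len by (cases ds; cases "tl ds") auto
    have "x \<in> sections UNIV (OH_E i)" "y \<in> sections UNIV (OH_E j)" using s[of 0] s[of 1] 2 ds by simp_all
    from OH_bracket_degree[OF this] show ?thesis using 2 ds by (simp add: graded_part_def nat_add_distrib add.commute[of j i])
  next
    case "3_1"
    then show ?thesis using ne by simp
  next
    case ("3_2" x y z zs)
    have "0 \<in> graded_part OH_E k" for k by (simp add: graded_part_def mem_OH_E)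
    then show ?thesis using "3_2" by (simp add: sections_def smooth_on_const)
  qed
  show "OH_l (xs @ y # x # ys) = (\<lambda>p. - ((-1) ^ (i * j)) *\<^sub>R OH_l (xs @ x # y # ys) p)"
    if "x \<in> sections UNIV (OH_E i)" "y \<in> sections UNIV (OH_E j)" for xs ys x y i j
  proof (cases "xs = [] \<and> ys = []")
    case True
    then show ?thesis using OH_bracket_skew[OF that] by simp
  next
    case False
    then have l: "length (xs @ u # v # ys) \<ge> 3" for u v :: "oct2 \<Rightarrow> OH_fibre" by (cases xs; cases ys) auto
    show ?thesis unfolding OH_l_long[OF l] by simp
  qed
  show "OH_l (xs @ (\<lambda>p. f p *\<^sub>R x p) # ys) = (\<lambda>p. f p *\<^sub>R OH_l (xs @ x # ys) p)"
    if "length xs + length ys \<noteq> 1" for xs ys x and f :: "oct2 \<Rightarrow> real"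
  proof (cases rule: length_3_cases[of xs ys])
    case 1
    then show ?thesis by (simp add: linear_scale[OF linear_OH_d])
  next
    case 4
    have "OH_l (xs @ z # ys) = (\<lambda>_. 0)" for z by (rule OH_l_long) (use 4 in simp)
    then show ?thesis by simp
  qed (use that in simp_all)
  show "OH_l [x, \<lambda>p. f p *\<^sub>R y p] = (\<lambda>p. f p *\<^sub>R OH_l [x, y] p)"
    if x: "x \<in> sections UNIV (OH_E (Suc i))" and y: "y \<in> sections UNIV UNIV" and f: "smooth_on UNIV f" for x i y f
  proof -
    have "OH_rho p (x p) = 0" for p using sections_OH_ED(2)[OF x] by (simp add: OH_rho_pos)
    moreover have "frechet_derivative f (at p) 0 = 0" for p
      by (rule linear_0[OF linear_frechet_derivative[OF smooth_onD(1)[OF f UNIV_I]]])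
    ultimately show ?thesis
      using OH_bracket_function_right[OF _ sections_OH_ED(1)[OF x] f, of y] y by (simp add: sections_UNIV_iff fun_eq_iff)
  qed
  show "OH_l [x, \<lambda>p. f p *\<^sub>R y p] = (\<lambda>p. f p *\<^sub>R OH_l [x, y] p + frechet_derivative f (at p) (OH_rho p (x p)) *\<^sub>R y p)"
    if x: "x \<in> sections UNIV (OH_E 0)" and y: "y \<in> sections UNIV UNIV" and f: "smooth_on UNIV f" for x y f
    using OH_bracket_function_right[OF _ sections_OH_ED(1)[OF x] f, of y] y by (simp add: sections_UNIV_iff fun_eq_iff)
  show "OH_rho p (OH_l [x] p) = 0" for x p by (simp add: OH_rho_def OH_d_eq rho_d1)
  show "OH_E i = {0}" if "3 \<le> i" for i using OH_E_ge3[OF that] .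
qed (rule OH_higher_jacobi)

section \<open>A regular sequence of quadratic polynomials\<close>

lemma real_polynomial_function_inner:
  fixes f g :: "'a::real_normed_vector \<Rightarrow> 'b::euclidean_space"
  assumes "polynomial_function f" "polynomial_function g"
  shows "real_polynomial_function (\<lambda>p. f p \<bullet> g p)"
proof -
  have "real_polynomial_function (\<lambda>p. f p \<bullet> b)" "real_polynomial_function (\<lambda>p. g p \<bullet> b)" if "b \<in> Basis" for b
    using assms that by (auto simp: polynomial_function_iff_Basis_inner)
  then have "real_polynomial_function (\<lambda>p. \<Sum>b\<in>Basis. (f p \<bullet> b) * (g p \<bullet> b))"
    by (intro real_polynomial_function_sum real_polynomial_function.intros(4)) auto
  then show ?thesis by (simp add: euclidean_inner[symmetric])
qed

text \<open>Restriction to lines makes degrees and the absence of zero divisors available from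
  univariate polynomials.\<close>

lemma real_polynomial_function_on_line:
  assumes "real_polynomial_function f"
  obtains P :: "real poly" where "\<And>s. f (a + s *\<^sub>R v) = poly P s"
proof -
  have "\<exists>P :: real poly. \<forall>s. f (a + s *\<^sub>R v) = poly P s"
    using assms
  proof induction
    case (linear f)
    have "f (a + s *\<^sub>R v) = poly [:f a, f v:] s" for s
      using linear by (simp add: linear_add linear_scale bounded_linear.linear)
    then show ?case by blast
  next
    case (const c)
    have "c = poly [:c:] s" for s by simp
    then show ?case by blast
  next
    case (add f g)
    then show ?case by (metis poly_add)
  next
    case (mult f g)
    then show ?case by (metis poly_mult)
  qed
  then show ?thesis using that by blast
qed

text \<open>
  \<open>q\<close> is monic of degree \<open>2\<close> in the coordinate \<open>L\<close>; \<open>f \<circ> \<pi> = f\<close> says that \<open>f\<close> does not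
  depend on this coordinate.
\<close>

locale monic_quadratic =
  fixes L :: "'a::euclidean_space \<Rightarrow> real" and e :: 'a and R q :: "'a \<Rightarrow> real"
  assumes L: "bounded_linear L" and Le: "L e = 1"
    and R: "real_polynomial_function R" and Rinv: "\<And>p. R (p - L p *\<^sub>R e) = R p"
    and q: "\<And>p. q p = (L p)\<^sup>2 + R p"
begin

abbreviation \<pi> :: "'a \<Rightarrow> 'a" where "\<pi> p \<equiv> p - L p *\<^sub>R e"

lemma L_\<pi>: "L (\<pi> p) = 0"
  using Le by (simp add: linear_diff[OF bounded_linear.linear[OF L]] linear_scale[OF bounded_linear.linear[OF L]])

lemma \<pi>_\<pi>: "\<pi> (\<pi> p) = \<pi> p"
  by (simp add: L_\<pi>)

lemma polynomial_L: "real_polynomial_function L"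
  using L by blast

lemma polynomial_comp_\<pi>: "real_polynomial_function f \<Longrightarrow> real_polynomial_function (\<lambda>p. f (\<pi> p))"
proof -
  assume f: "real_polynomial_function f"
  have "bounded_linear \<pi>"
    using L by (intro bounded_linear_sub bounded_linear_ident bounded_linear_scaleR_const)
  then have "polynomial_function \<pi>" by (rule polynomial_function_bounded_linear)
  from real_polynomial_function_compose[OF this f] show ?thesis by (simp add: o_def)
qed

text \<open>Division with remainder by q in the variable L, by induction over the construction of
  polynomial functions.\<close>

lemma division:
  assumes "real_polynomial_function f"
  obtains f0 f1 g where "real_polynomial_function f0" "real_polynomial_function f1" "real_polynomial_function g"
    "\<And>p. f0 (\<pi> p) = f0 p" "\<And>p. f1 (\<pi> p) = f1 p" "\<And>p. f p = f0 p + L p * f1 p + q p * g p"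
proof -
  have "\<exists>f0 f1 g. real_polynomial_function f0 \<and> real_polynomial_function f1 \<and> real_polynomial_function g
    \<and> (\<forall>p. f0 (\<pi> p) = f0 p) \<and> (\<forall>p. f1 (\<pi> p) = f1 p) \<and> (\<forall>p. f p = f0 p + L p * f1 p + q p * g p)"
    using assms
  proof induction
    case (linear f)
    have "f p = f (\<pi> p) + L p * f e + q p * 0" for p
      using linear by (simp add: linear_diff linear_scale bounded_linear.linear)
    moreover have "f (\<pi> (\<pi> p)) = f (\<pi> p)" for p by (simp add: L_\<pi>)
    moreover have "real_polynomial_function (\<lambda>p. f (\<pi> p))"
      using linear by (intro polynomial_comp_\<pi>) auto
    moreover have "real_polynomial_function (\<lambda>_. f e)" "real_polynomial_function (\<lambda>_. 0)"
      by (rule real_polynomial_function.intros(2))+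
    ultimately show ?case
      by (intro exI[of _ "\<lambda>p. f (\<pi> p)"] exI[of _ "\<lambda>_. f e"] exI[of _ "\<lambda>_. 0"] conjI allI refl)
  next
    case (const c)
    show ?case by (intro exI[of _ "\<lambda>_. c"] exI[of _ "\<lambda>_. 0"]) auto
  next
    case (add f g)
    then obtain f0 f1 k g0 g1 l where
      "real_polynomial_function f0" "real_polynomial_function f1" "real_polynomial_function k"
      "\<forall>p. f0 (\<pi> p) = f0 p" "\<forall>p. f1 (\<pi> p) = f1 p" "\<forall>p. f p = f0 p + L p * f1 p + q p * k p"
      "real_polynomial_function g0" "real_polynomial_function g1" "real_polynomial_function l"
      "\<forall>p. g0 (\<pi> p) = g0 p" "\<forall>p. g1 (\<pi> p) = g1 p" "\<forall>p. g p = g0 p + L p * g1 p + q p * l p"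
      by blast
    then show ?case
      by (intro exI[of _ "\<lambda>p. f0 p + g0 p"] exI[of _ "\<lambda>p. f1 p + g1 p"] exI[of _ "\<lambda>p. k p + l p"])
        (auto simp: algebra_simps)
  next
    case (mult f g)
    then obtain f0 f1 k g0 g1 l where
      *: "real_polynomial_function f0" "real_polynomial_function f1" "real_polynomial_function k"
      "\<forall>p. f0 (\<pi> p) = f0 p" "\<forall>p. f1 (\<pi> p) = f1 p" "\<forall>p. f p = f0 p + L p * f1 p + q p * k p"
      "real_polynomial_function g0" "real_polynomial_function g1" "real_polynomial_function l"
      "\<forall>p. g0 (\<pi> p) = g0 p" "\<forall>p. g1 (\<pi> p) = g1 p" "\<forall>p. g p = g0 p + L p * g1 p + q p * l p"
      by blast
    \<comment> \<open>In a product of remainders the term with L^2 is rewritten by L^2 = q - R: it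
      contributes -R f1 g1 to the remainder and f1 g1 to the quotient.\<close>
    let ?h0 = "\<lambda>p. f0 p * g0 p - R p * (f1 p * g1 p)"
    let ?h1 = "\<lambda>p. f0 p * g1 p + f1 p * g0 p"
    let ?m = "\<lambda>p. f1 p * g1 p + k p * g p + (f0 p + L p * f1 p) * l p"
    have "f p * g p = ?h0 p + L p * ?h1 p + q p * ?m p" for p
      unfolding *(6)[rule_format, of p] *(12)[rule_format, of p] q[of p]
      by (simp add: algebra_simps power2_eq_square)
    moreover have "real_polynomial_function ?h0" "real_polynomial_function ?h1" "real_polynomial_function ?m"
      by (intro real_polynomial_function_diff real_polynomial_function.intros(3,4) * R polynomial_L mult.hyps)+
    moreover have "?h0 (\<pi> p) = ?h0 p" "?h1 (\<pi> p) = ?h1 p" for p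
      using * Rinv by auto
    ultimately show ?case by blast
  qed
  then show ?thesis using that by blast
qed

text \<open>On the line through \<pi> p in direction e the factor q is monic of degree 2, while the
  left side has degree at most 1; so the quotient vanishes on this line.\<close>

lemma remainder_unique:
  assumes inv: "\<And>p. f0 (\<pi> p) = f0 p" "\<And>p. f1 (\<pi> p) = f1 p" and g: "real_polynomial_function g"
    and eq: "\<And>p. f0 p + L p * f1 p = q p * g p"
  shows "f0 p = 0" "f1 p = 0"
proof -
  obtain P :: "real poly" where P: "\<And>s. g (\<pi> p + s *\<^sub>R e) = poly P s"
    using real_polynomial_function_on_line[OF g] by blast
  have "poly [:f0 p, f1 p:] s = poly ([:R p, 0, 1:] * P) s" for s
  proof -
    obtain z where z: "z = \<pi> p + s *\<^sub>R e" by blast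
    have Lz: "L z = s"
      unfolding z using Le L_\<pi>[of p] by (simp only: linear_add[OF bounded_linear.linear[OF L]]
          linear_scale[OF bounded_linear.linear[OF L]]) simp
    have \<pi>z: "\<pi> z = \<pi> p" unfolding Lz by (simp add: z)
    have fz: "f0 z = f0 p" "f1 z = f1 p" "R z = R p"
      using inv(1)[of z] inv(2)[of z] Rinv[of z] inv(1)[of p] inv(2)[of p] Rinv[of p] unfolding \<pi>z by simp_all
    have "g z = poly P s" unfolding z by (rule P)
    then show ?thesis
      using eq[of z] unfolding q Lz fz by (simp add: power2_eq_square algebra_simps)
  qed
  then have e: "[:f0 p, f1 p:] = [:R p, 0, 1:] * P" by (rule poly_eq_poly_eq_iff[THEN iffD1, OF ext])
  have "P = 0"
  proof (rule ccontr)
    assume "P \<noteq> 0"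
    then have "degree [:f0 p, f1 p:] = 2 + degree P" unfolding e by (subst degree_mult_eq) auto
    moreover have "degree [:f0 p, f1 p:] \<le> 1" using degree_pCons_le[of "f0 p" "[:f1 p:]"] by simp
    ultimately show False by simp
  qed
  then show "f0 p = 0" "f1 p = 0" using e by auto
qed

end

interpretation quad_x: monic_quadratic "\<lambda>p::oct2. fst p $ 0" "(axis 0 1, 0)"
  "\<lambda>p. fst p \<bullet> fst p - (fst p $ 0)\<^sup>2" "\<lambda>p. fst p \<bullet> fst p"
proof -
  have l: "bounded_linear (\<lambda>p::oct2. fst p $ 0)"
    by (intro bounded_linear_compose[OF bounded_linear_vec_nth] bounded_linear_fst)
  have "real_polynomial_function (\<lambda>p::oct2. fst p \<bullet> fst p)"
    by (intro real_polynomial_function_inner polynomial_function_bounded_linear bounded_linear_fst)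
  then have r: "real_polynomial_function (\<lambda>p::oct2. fst p \<bullet> fst p - (fst p $ 0)\<^sup>2)"
    by (intro real_polynomial_function_diff real_polynomial_function_power real_polynomial_function.intros(1)[OF l])
  show "monic_quadratic (\<lambda>p::oct2. fst p $ 0) (axis 0 1, 0) (\<lambda>p. fst p \<bullet> fst p - (fst p $ 0)\<^sup>2) (\<lambda>p. fst p \<bullet> fst p)"
    by (rule monic_quadratic.intro, rule l, simp add: axis_def, rule r)
      (simp_all add: inner_diff_left inner_diff_right inner_axis inner_axis' power2_eq_square algebra_simps)
qed

interpretation quad_y: monic_quadratic "\<lambda>p::oct2. snd p $ 0" "(0, axis 0 1)"
  "\<lambda>p. snd p \<bullet> snd p - (snd p $ 0)\<^sup>2" "\<lambda>p. snd p \<bullet> snd p"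
proof -
  have l: "bounded_linear (\<lambda>p::oct2. snd p $ 0)"
    by (intro bounded_linear_compose[OF bounded_linear_vec_nth] bounded_linear_snd)
  have "real_polynomial_function (\<lambda>p::oct2. snd p \<bullet> snd p)"
    by (intro real_polynomial_function_inner polynomial_function_bounded_linear bounded_linear_snd)
  then have r: "real_polynomial_function (\<lambda>p::oct2. snd p \<bullet> snd p - (snd p $ 0)\<^sup>2)"
    by (intro real_polynomial_function_diff real_polynomial_function_power real_polynomial_function.intros(1)[OF l])
  show "monic_quadratic (\<lambda>p::oct2. snd p $ 0) (0, axis 0 1) (\<lambda>p. snd p \<bullet> snd p - (snd p $ 0)\<^sup>2) (\<lambda>p. snd p \<bullet> snd p)"
    by (rule monic_quadratic.intro, rule l, simp add: axis_def, rule r)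
      (simp_all add: inner_diff_left inner_diff_right inner_axis inner_axis' power2_eq_square algebra_simps)
qed

section \<open>The Gram determinant and regularity of the inner product modulo the squares\<close>

definition gram :: "oct2 \<Rightarrow> real" where
  "gram p = (fst p \<bullet> fst p - (fst p $ 0)\<^sup>2) * (snd p \<bullet> snd p - (snd p $ 0)\<^sup>2)
    - (fst p \<bullet> snd p - fst p $ 0 * snd p $ 0)\<^sup>2"

text \<open>On the line through p in direction \<open>?v\<close> the Gram determinant is monic of
  degree 4 in s: the imaginary parts grow along two orthonormal units, and the subtracted square has
  degree at most 2. Univariate polynomials have no zero divisors, so c vanishes on this
  line.\<close>

lemma gram_not_zero_divisor:
  assumes c: "real_polynomial_function c" and 0: "\<And>p. gram p * c p = 0"
  shows "c p = 0"
proof -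
  let ?v = "(axis 1 1, axis 2 1) :: oct2"
  obtain P :: "real poly" where P: "\<And>s. c (p + s *\<^sub>R ?v) = poly P s"
    using real_polynomial_function_on_line[OF c] by blast
  let ?D = "[:fst p \<bullet> fst p - (fst p $ 0)\<^sup>2, 2 * fst p $ 1, 1:] * [:snd p \<bullet> snd p - (snd p $ 0)\<^sup>2, 2 * snd p $ 2, 1:]
    - [:fst p \<bullet> snd p - fst p $ 0 * snd p $ 0, fst p $ 2 + snd p $ 1:] * [:fst p \<bullet> snd p - fst p $ 0 * snd p $ 0, fst p $ 2 + snd p $ 1:]"
  have ax: "oct_basis 1 $ 0 = 0" "oct_basis 2 $ 0 = 0" "oct_basis 1 $ 2 = 0" "oct_basis 2 $ 1 = 0"
    by (simp_all add: axis_def)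
  have "gram (p + s *\<^sub>R ?v) = poly ?D s" for s
    unfolding gram_def
    by (simp add: inner_add_left inner_add_right inner_axis inner_axis' inner_axis_axis ax power2_eq_square algebra_simps)
  then have "poly (?D * P) s = poly 0 s" for s
    using 0[of "p + s *\<^sub>R ?v"] P[of s] by (simp only: poly_mult poly_0)
  then have "?D * P = 0" by (rule poly_eq_poly_eq_iff[THEN iffD1, OF ext])
  moreover have "coeff ?D 4 = 1" by (simp add: numeral_eq_Suc)
  then have "?D \<noteq> 0" by (metis coeff_0 zero_neq_one)
  ultimately have "P = 0" using mult_eq_0_iff by blast
  then show ?thesis using P[of 0] by (simp add: zero_prod_def[symmetric])
qed

text \<open>
  Modulo the two squares, multiplication by the conjugate factor \<open>x\<^sub>0 y\<^sub>0 - Q\<close> turns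
  \<open>x \<bullet> y = x\<^sub>0 y\<^sub>0 + Q\<close> into the Gram determinant of the imaginary parts, which involves
  neither \<open>x\<^sub>0\<close> nor \<open>y\<^sub>0\<close>.
\<close>

lemma inner_not_zero_divisor_mod_squares:
  assumes \<mu>: "real_polynomial_function \<mu>" and \<alpha>: "real_polynomial_function \<alpha>" and \<beta>: "real_polynomial_function \<beta>"
    and eq: "\<And>p. \<mu> p * (fst p \<bullet> snd p) = \<alpha> p * (fst p \<bullet> fst p) + \<beta> p * (snd p \<bullet> snd p)"
  obtains \<alpha>' \<beta>' :: "oct2 \<Rightarrow> real" where "real_polynomial_function \<alpha>'" "real_polynomial_function \<beta>'"
    "\<And>p. \<mu> p = \<alpha>' p * (fst p \<bullet> fst p) + \<beta>' p * (snd p \<bullet> snd p)"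
proof -
  let ?x = "\<lambda>p::oct2. fst p $ 0" and ?y = "\<lambda>p::oct2. snd p $ 0"
  let ?X = "\<lambda>p::oct2. fst p \<bullet> fst p" and ?Y = "\<lambda>p::oct2. snd p \<bullet> snd p"
  let ?Q = "\<lambda>p::oct2. fst p \<bullet> snd p - ?x p * ?y p"
  \<comment> \<open>The remainder of \<mu> modulo |x|^2 in the variable x0 is divided further by
    |y|^2 in y0. Four coefficients remain; the goal is that they vanish.\<close>
  obtain m0 m1 g where m: "real_polynomial_function m0" "real_polynomial_function m1" "real_polynomial_function g"
    "\<And>p. m0 (quad_x.\<pi> p) = m0 p" "\<And>p. m1 (quad_x.\<pi> p) = m1 p" "\<And>p. \<mu> p = m0 p + ?x p * m1 p + ?X p * g p"
    using quad_x.division[OF \<mu>] by metis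
  obtain m00 m01 g0 where m0: "real_polynomial_function m00" "real_polynomial_function m01" "real_polynomial_function g0"
    "\<And>p. m00 (quad_y.\<pi> p) = m00 p" "\<And>p. m01 (quad_y.\<pi> p) = m01 p" "\<And>p. m0 p = m00 p + ?y p * m01 p + ?Y p * g0 p"
    using quad_y.division[OF m(1)] by metis
  obtain m10 m11 g1 where m1: "real_polynomial_function m10" "real_polynomial_function m11" "real_polynomial_function g1"
    "\<And>p. m10 (quad_y.\<pi> p) = m10 p" "\<And>p. m11 (quad_y.\<pi> p) = m11 p" "\<And>p. m1 p = m10 p + ?y p * m11 p + ?Y p * g1 p"
    using quad_y.division[OF m(2)] by metis
  have com: "quad_x.\<pi> (quad_y.\<pi> p) = quad_y.\<pi> (quad_x.\<pi> p)" for p by (simp add: algebra_simps)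
  have D: "gram (quad_x.\<pi> p) = gram p" "gram (quad_y.\<pi> p) = gram p" for p
    by (simp_all add: gram_def inner_diff_left inner_diff_right inner_axis inner_axis' power2_eq_square algebra_simps)
  \<comment> \<open>Composing with the projection removes x0 from the coefficient as well, so that
    both uniqueness statements can be applied to \<open>c m\<close>.\<close>
  define c where "c m p = gram p * m (quad_x.\<pi> p)" for m :: "oct2 \<Rightarrow> real" and p
  have cx: "c m (quad_x.\<pi> p) = c m p" for m p
    unfolding c_def D quad_x.\<pi>_\<pi> ..
  have cy: "c m (quad_y.\<pi> p) = c m p" if "\<And>p. m (quad_y.\<pi> p) = m p" for m p
    unfolding c_def D com that ..
  have pQ: "real_polynomial_function (\<lambda>p::oct2. fst p \<bullet> snd p)" "real_polynomial_function ?X" "real_polynomial_function ?Y"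
    by (intro real_polynomial_function_inner polynomial_function_bounded_linear bounded_linear_fst bounded_linear_snd)+
  note px = quad_x.polynomial_L and py = quad_y.polynomial_L
  have inv: "m0 p = m00 (quad_x.\<pi> p) + ?y p * m01 (quad_x.\<pi> p) + ?Y p * g0 (quad_x.\<pi> p)"
    "m1 p = m10 (quad_x.\<pi> p) + ?y p * m11 (quad_x.\<pi> p) + ?Y p * g1 (quad_x.\<pi> p)" for p
    using m0(6)[of "quad_x.\<pi> p"] m1(6)[of "quad_x.\<pi> p"] m(4,5)[of p] by simp_all
  \<comment> \<open>Multiplying the hypothesis by x0 y0 - Q expresses the Gram determinant times
    \<mu> through |x|^2 and |y|^2. \<open>?A\<close> and \<open>?B\<close> are the coefficients
    after the known multiples of the squares in \<mu> have been moved to the right.\<close>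
  let ?A = "\<lambda>p. (?x p * ?y p - ?Q p) * \<alpha> p - \<mu> p * (?Y p - (?Y p - (?y p)\<^sup>2)) - gram p * g p"
  let ?B = "\<lambda>p. (?x p * ?y p - ?Q p) * \<beta> p + \<mu> p * (?X p - (?x p)\<^sup>2)
      - gram p * (g0 (quad_x.\<pi> p) + ?x p * g1 (quad_x.\<pi> p))"
  have main: "c m00 p + ?y p * c m01 p + ?x p * (c m10 p + ?y p * c m11 p) = ?A p * ?X p + ?B p * ?Y p" for p
  proof -
    have "gram p * \<mu> p = (?x p * ?y p - ?Q p) * (\<mu> p * (fst p \<bullet> snd p))
        - \<mu> p * (?X p * (?Y p - (?Y p - (?y p)\<^sup>2)) - (?X p - (?x p)\<^sup>2) * ?Y p)"
      unfolding gram_def by (simp add: power2_eq_square algebra_simps)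
    moreover have "gram p * \<mu> p = c m00 p + ?y p * c m01 p + ?x p * (c m10 p + ?y p * c m11 p)
        + gram p * g p * ?X p + gram p * (g0 (quad_x.\<pi> p) + ?x p * g1 (quad_x.\<pi> p)) * ?Y p"
      unfolding m(6)[of p] inv[of p] c_def by (simp add: algebra_simps)
    ultimately show ?thesis unfolding eq by (simp add: algebra_simps)
  qed
  have pg: "real_polynomial_function gram"
    unfolding gram_def[abs_def] using pQ px py by (intro real_polynomial_function_diff real_polynomial_function.intros(4)
        real_polynomial_function_power) auto
  have pc: "real_polynomial_function (c m)" if "real_polynomial_function m" for m
    unfolding c_def[abs_def] by (intro real_polynomial_function.intros(4) pg quad_x.polynomial_comp_\<pi> that)
  have pA: "real_polynomial_function ?A"
    by (intro real_polynomial_function_diff real_polynomial_function.intros(4) real_polynomial_function_power pg \<alpha> \<mu> m pQ px py)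
  have pB: "real_polynomial_function ?B"
    by (intro real_polynomial_function_diff real_polynomial_function.intros(3) real_polynomial_function.intros(4)
        real_polynomial_function_power pg \<beta> \<mu> m0 m1 pQ px py quad_x.polynomial_comp_\<pi>)
  \<comment> \<open>Replacing \<open>?A\<close> by its remainder modulo |y|^2 makes both sides
    reduced in y0. Uniqueness for y0 then gives two equations modulo |x|^2, and uniqueness for x0
    makes all four coefficients vanish.\<close>
  obtain a0 a1 \<gamma> where a: "real_polynomial_function a0" "real_polynomial_function a1" "real_polynomial_function \<gamma>"
    "\<And>p. a0 (quad_y.\<pi> p) = a0 p" "\<And>p. a1 (quad_y.\<pi> p) = a1 p" "\<And>p. ?A p = a0 p + ?y p * a1 p + ?Y p * \<gamma> p"
    using quad_y.division[OF pA] by metis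
  let ?f0 = "\<lambda>p. c m00 p + ?x p * c m10 p - ?X p * a0 p" and ?f1 = "\<lambda>p. c m01 p + ?x p * c m11 p - ?X p * a1 p"
  have z: "?f0 p = 0" "?f1 p = 0" for p
  proof -
    have 1: "?f0 p + ?y p * ?f1 p = ?Y p * (?B p + \<gamma> p * ?X p)" for p
      using main[of p] unfolding a(6)[of p] by (simp add: algebra_simps)
    have 2: "real_polynomial_function (\<lambda>p. ?B p + \<gamma> p * ?X p)"
      by (intro real_polynomial_function.intros(3) real_polynomial_function.intros(4) pB a pQ)
    have 3: "?f0 (quad_y.\<pi> p) = ?f0 p" "?f1 (quad_y.\<pi> p) = ?f1 p" for p
      by (simp_all only: cy[where m = m00, OF m0(4)] cy[where m = m01, OF m0(5)]
          cy[where m = m10, OF m1(4)] cy[where m = m11, OF m1(5)] a(4,5)) simp_all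
    show "?f0 p = 0" "?f1 p = 0" using quad_y.remainder_unique[of ?f0 ?f1, OF 3 2 1] by blast+
  qed
  have z0: "c m00 p + ?x p * c m10 p = ?X p * a0 p" "c m01 p + ?x p * c m11 p = ?X p * a1 p" for p
    using z[of p] by simp_all
  have c0: "c m00 p = 0" "c m10 p = 0" "c m01 p = 0" "c m11 p = 0" for p
    by (fact quad_x.remainder_unique[OF cx cx a(1) z0(1)] quad_x.remainder_unique[OF cx cx a(2) z0(2)])+
  have "m (quad_x.\<pi> p) = 0" if "real_polynomial_function m" "\<And>p. c m p = 0" for m p
    using gram_not_zero_divisor[OF quad_x.polynomial_comp_\<pi>[OF that(1)]] that(2) unfolding c_def by blast
  then have "m00 (quad_x.\<pi> p) = 0" "m01 (quad_x.\<pi> p) = 0" "m10 (quad_x.\<pi> p) = 0" "m11 (quad_x.\<pi> p) = 0" for p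
    using m0 m1 c0 by blast+
  then have "\<mu> p = g p * ?X p + (g0 (quad_x.\<pi> p) + ?x p * g1 (quad_x.\<pi> p)) * ?Y p" for p
    unfolding m(6)[of p] inv[of p] by (simp add: algebra_simps)
  moreover have "real_polynomial_function (\<lambda>p. g0 (quad_x.\<pi> p) + ?x p * g1 (quad_x.\<pi> p))"
    by (intro real_polynomial_function.intros(3) real_polynomial_function.intros(4) quad_x.polynomial_comp_\<pi> m0 m1 px)
  ultimately show ?thesis using that[OF m(3)] by blast
qed

section \<open>Exactness of the linear part\<close>

subsection \<open>Homogeneous Taylor components\<close>

lemma polynomial_function_dders:
  fixes f :: "'a::euclidean_space \<Rightarrow> 'b::euclidean_space"
  assumes U: "open U" "0 \<in> U" and f: "smooth_on U f"
  shows "polynomial_function (\<lambda>p. dders (replicate n p) f 0)"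
  using f
proof (induction n arbitrary: f)
  case (Suc n)
  have "dders (replicate (Suc n) p) f 0 = (\<Sum>b\<in>Basis. (p \<bullet> b) *\<^sub>R dders (replicate n p) (dder b f) 0)" for p
  proof -
    have "dders (replicate (Suc n) p) f 0 = dders (replicate n p) (\<lambda>q. \<Sum>b\<in>Basis. (p \<bullet> b) *\<^sub>R dder b f q) 0"
      unfolding replicate_Suc dders.simps
      by (rule dders_cong[OF U]) (rule dder_sum_Basis[OF smooth_onD(1)[OF Suc.prems]])
    then show ?thesis
      by (simp only: dders_scaleR_sum[OF U smooth_onD(3)[OF Suc.prems]])
  qed
  moreover have "polynomial_function (\<lambda>p. \<Sum>b\<in>Basis. (p \<bullet> b) *\<^sub>R dders (replicate n p) (dder b f) 0)"
    by (intro polynomial_function_sum polynomial_function_mult Suc.IH smooth_onD(3)[OF Suc.prems] finite_Basis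
        polynomial_function_bounded_linear bounded_linear_inner_left)
  ultimately show ?case by simp
qed simp

lemma smooth_on_polynomial_function:
  fixes f :: "'a::euclidean_space \<Rightarrow> 'b::euclidean_space"
  assumes f: "polynomial_function f" and U: "open U"
  shows "smooth_on U f"
proof (rule smooth_on_componentwise[OF U])
  fix b :: 'b assume "b \<in> Basis"
  then have "real_polynomial_function (\<lambda>p. f p \<bullet> b)" using f by (simp add: polynomial_function_iff_Basis_inner)
  then show "smooth_on U (\<lambda>p. f p \<bullet> b)"
  proof induction
    case (linear f)
    then show ?case by (rule smooth_on_bounded_linear[OF _ U smooth_on_id])
  qed (intro smooth_intros U; assumption)+
qed

definition taylor_part :: "nat \<Rightarrow> ('a::euclidean_space \<Rightarrow> 'b::euclidean_space) \<Rightarrow> 'a \<Rightarrow> 'b" where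
  "taylor_part n f p = (1 / fact n) *\<^sub>R dders (replicate n p) f 0"

lemma polynomial_taylor_part:
  assumes "open U" "0 \<in> U" "smooth_on U f"
  shows "polynomial_function (taylor_part n f)"
  unfolding taylor_part_def[abs_def] by (intro polynomial_function_cmul polynomial_function_dders[OF assms])

lemma taylor_part_homogeneous:
  assumes "open U" "0 \<in> U" "smooth_on U f"
  shows "taylor_part n f (c *\<^sub>R p) = c ^ n *\<^sub>R taylor_part n f p"
  unfolding taylor_part_def dders_replicate_scaleR[OF assms] by simp

lemma taylor_part_remainder:
  fixes f :: "'a::euclidean_space \<Rightarrow> 'b::euclidean_space"
  assumes U: "open U" "0 \<in> U" and f: "smooth_on U f"
  obtains C r where "C \<ge> 0" "r > 0" "cball 0 r \<subseteq> U"
    "\<And>p. norm p \<le> r \<Longrightarrow> norm (f p - (\<Sum>j<n. taylor_part j f p)) \<le> C * norm p ^ n"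
proof -
  obtain r where r: "r > 0" "cball 0 r \<subseteq> U" using U open_contains_cball by blast
  obtain C where C: "C \<ge> 0" "\<And>a h. (\<And>s. s \<in> {0..1} \<Longrightarrow> a + s *\<^sub>R h \<in> cball 0 r) \<Longrightarrow>
      norm (f (a + h) - (\<Sum>j<n. (1 / fact j) *\<^sub>R dders (replicate j h) f a)) \<le> C * norm h ^ n"
    using taylor_bound[OF U(1) compact_cball r(2) f, of n] by blast
  have "norm (f p - (\<Sum>j<n. taylor_part j f p)) \<le> C * norm p ^ n" if p: "norm p \<le> r" for p
  proof -
    have "0 + s *\<^sub>R p \<in> cball 0 r" if "s \<in> {0..1}" for s
      using that p mult_left_le_one_le[of "norm p" s] by simp
    from C(2)[OF this] show ?thesis by (simp add: taylor_part_def)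
  qed
  then show ?thesis using that C(1) r by blast
qed

text \<open>Along the ray through p the Taylor expansion is a polynomial in the scale, and a
  polynomial agreeing with s^n c up to high order has no other coefficients. The linear map L is
  fixed while the point moves.\<close>

lemma taylor_part_of_homogeneous_ray:
  fixes f :: "'a::euclidean_space \<Rightarrow> 'b::euclidean_space" and L :: "'b \<Rightarrow> 'c::real_normed_vector"
  assumes U: "open U" "0 \<in> U" and f: "smooth_on U f" and L: "bounded_linear L"
    and ray: "\<And>s. s > 0 \<Longrightarrow> s *\<^sub>R p \<in> U \<Longrightarrow> L (f (s *\<^sub>R p)) = s ^ n *\<^sub>R c"
  shows "L (taylor_part j f p) = (if j = n then c else 0)"
proof -
  interpret L: bounded_linear L by (rule L)
  \<comment> \<open>Large enough that the expansion includes both the component j in question and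
    the degree n.\<close>
  define m where "m = Suc (max j n)"
  obtain C r where C: "C \<ge> 0" "r > 0" "cball 0 r \<subseteq> U"
    "\<And>p. norm p \<le> r \<Longrightarrow> norm (f p - (\<Sum>j<m. taylor_part j f p)) \<le> C * norm p ^ m"
    using taylor_part_remainder[OF U f, of m] by blast
  define \<epsilon> where "\<epsilon> = r / (1 + norm p)"
  have np: "1 + norm p > 0" using norm_ge_zero[of p] by linarith
  have \<epsilon>: "\<epsilon> > 0" "\<epsilon> * norm p \<le> r" using C(2) np by (simp_all add: \<epsilon>_def field_simps)
  obtain K where K: "K > 0" "\<And>x. norm (L x) \<le> norm x * K" using L.pos_bounded by blast
  let ?c = "\<lambda>i. \<epsilon> ^ i *\<^sub>R (L (taylor_part i f p) - (if i = n then c else 0))"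
  have "\<forall>i<m. ?c i = 0"
  proof (rule coefficients_zero_if_small[where C = "C * (\<epsilon> * norm p) ^ m * K"])
    fix s :: real assume s: "0 < s" "s \<le> 1"
    let ?p = "(s * \<epsilon>) *\<^sub>R p"
    have "norm ?p = s * (\<epsilon> * norm p)" using s \<epsilon> by simp
    also have "\<dots> \<le> 1 * (\<epsilon> * norm p)" using s \<epsilon> by (intro mult_right_mono) auto
    finally have np: "norm ?p \<le> r" using \<epsilon> by simp
    then have pU: "?p \<in> U" using C(3) by auto
    have "(\<Sum>i<m. s ^ i *\<^sub>R ?c i) = (\<Sum>i<m. L (taylor_part i f ?p)) - (\<Sum>i<m. (if i = n then (s * \<epsilon>) ^ n *\<^sub>R c else 0))"
      unfolding sum_subtractf[symmetric]
      by (intro sum.cong) (auto simp: taylor_part_homogeneous[OF U f] L.scaleR power_mult_distrib scaleR_diff_right)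
    also have "(\<Sum>i<m. (if i = n then (s * \<epsilon>) ^ n *\<^sub>R c else 0)) = L (f ?p)"
      using ray[OF _ pU] s \<epsilon> by (simp add: m_def)
    also have "(\<Sum>i<m. L (taylor_part i f ?p)) - L (f ?p) = - L (f ?p - (\<Sum>i<m. taylor_part i f ?p))"
      by (simp add: L.diff L.sum)
    finally have "norm (\<Sum>i<m. s ^ i *\<^sub>R ?c i) = norm (L (f ?p - (\<Sum>i<m. taylor_part i f ?p)))" by simp
    also have "\<dots> \<le> norm (f ?p - (\<Sum>i<m. taylor_part i f ?p)) * K" by (rule K(2))
    also have "\<dots> \<le> C * norm ?p ^ m * K" using C(4)[OF np] K(1) by (intro mult_right_mono) auto
    also have "\<dots> = C * (\<epsilon> * norm p) ^ m * K * s ^ m"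
      using s \<epsilon> by (simp add: power_mult_distrib mult_ac)
    finally show "norm (\<Sum>i<m. s ^ i *\<^sub>R ?c i) \<le> C * (\<epsilon> * norm p) ^ m * K * s ^ m" .
  qed
  moreover have "j < m" by (simp add: m_def)
  ultimately show ?thesis using \<epsilon>(1) by auto
qed

subsection \<open>Polynomial exactness\<close>

lemma inner_self_eq: "p \<bullet> p = fst p \<bullet> fst p + snd p \<bullet> snd p" for p :: oct2
  by (simp add: inner_prod_def)

lemma bounded_bilinear_OH_h: "bounded_bilinear OH_h"
proof -
  have "bilinear OH_h"
    by (simp add: bilinear_def linear_iff OH_h_def inner_add_left inner_add_right herm_sq.add_left herm_sq.add_right
        herm_sq.scaleR_left herm_sq.scaleR_right algebra_simps)
  then show ?thesis by (simp add: bilinear_conv_bounded_bilinear)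
qed

lemmas smooth_on_OH_h [smooth_intros] = smooth_on_bilinear[OF bounded_bilinear_OH_h]

lemma herm_tr_h: "herm_tr (OH_h p w) = 0"
  by (simp add: OH_h_def linear_diff[OF linear_herm_tr] linear_scale[OF linear_herm_tr] herm_tr_sq)
    (simp add: herm_tr_def)

lemma continuous_on_OH_d1:
  "open U \<Longrightarrow> smooth_on U r \<Longrightarrow> continuous_on U (\<lambda>p. OH_d1 p (r p))"
  by (intro smooth_onD(4) smooth_intros)

lemma oct_cnj_cancel: "(a \<odot> y) \<odot> oct_cnj y = (y \<bullet> y) *\<^sub>R a"
proof -
  have "2 *\<^sub>R ((a \<odot> y) \<odot> oct_cnj y) = 2 *\<^sub>R ((y \<bullet> y) *\<^sub>R a)"
    using oct_alternative_right[of a y y] by (simp add: scaleR_2[symmetric] numeral_mult_oct)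
  then show ?thesis by (rule scaleR_left_imp_eq[rotated]) simp
qed

lemma oct_real_part_mult_cnj: "(a \<odot> oct_cnj b) \<bullet> oct_basis 0 = a \<bullet> b"
  unfolding inner_axis by (simp add: oct_mult_nth inner_oct oct_cnj_nth)

lemma h_eq: "OH_h p w = (fst p \<bullet> fst w - snd p \<bullet> snd w,
    fst p \<odot> oct_cnj (snd w) + fst w \<odot> oct_cnj (snd p), snd p \<bullet> snd w - fst p \<bullet> fst w)"
  by (simp add: OH_h_def herm_sq_def inner_prod_def algebra_simps)

text \<open>The primitive is (h s + d2 t) / |p|^2 with t chosen to make the division possible.
  Regularity settles the diagonal entries; the octonionic entry follows by
  \<open>smooth_common_quotient\<close>, so that the primitive is obtained as a smooth
  function.\<close>

lemma polynomial_exactness: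
  assumes s: "polynomial_function s" and \<rho>: "\<And>p. OH_rho0 p (s p) = 0"
  obtains r where "smooth_on UNIV r" "\<And>p. OH_d1 p (r p) = s p"
proof -
  define \<mu> where "\<mu> p = fst (OH_h p (s p))" for p
  define a where "a p = fst (snd (OH_h p (s p)))" for p
  have ss: "smooth_on UNIV s" by (rule smooth_on_polynomial_function[OF s open_UNIV])
  have hs: "OH_h p (s p) = (\<mu> p, a p, - \<mu> p)" for p
    using herm_tr_h[of p "s p"] by (simp add: \<mu>_def a_def herm_tr_def prod_eq_iff)
  have d: "OH_d1 p (\<mu> p, a p, - \<mu> p) = (p \<bullet> p) *\<^sub>R s p" for p
    using d1_h[of p "s p"] by (simp add: hs \<rho>)
  \<comment> \<open>The first component of d1 (h s) = |p|^2 s, multiplied from the right by the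
    conjugate of y, which isolates a.\<close>
  have xy: "\<mu> p *\<^sub>R (fst p \<odot> oct_cnj (snd p)) + (snd p \<bullet> snd p) *\<^sub>R a p
      = (p \<bullet> p) *\<^sub>R (fst (s p) \<odot> oct_cnj (snd p))" for p
  proof -
    have "\<mu> p *\<^sub>R fst p + a p \<odot> snd p = (p \<bullet> p) *\<^sub>R fst (s p)"
      using arg_cong[OF d[of p], of fst] by (simp add: cl_eq)
    then have "(\<mu> p *\<^sub>R fst p + a p \<odot> snd p) \<odot> oct_cnj (snd p) = ((p \<bullet> p) *\<^sub>R fst (s p)) \<odot> oct_cnj (snd p)" by simp
    then show ?thesis by (simp only: oct.add_left oct.scaleR_left oct_cnj_cancel)
  qed
  have pf: "polynomial_function (\<lambda>p. fst (s p))" "polynomial_function (\<lambda>p. snd (s p))"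
    using polynomial_function_compose[OF s polynomial_function_bounded_linear[OF bounded_linear_fst]]
      polynomial_function_compose[OF s polynomial_function_bounded_linear[OF bounded_linear_snd]] by (simp_all add: o_def)
  have pxy: "polynomial_function (\<lambda>p::oct2. fst p)" "polynomial_function (\<lambda>p::oct2. snd p)"
    by (intro polynomial_function_bounded_linear bounded_linear_fst bounded_linear_snd)+
  let ?u = "\<lambda>p. fst (s p) \<bullet> snd p"
  have a0: "a p \<bullet> oct_basis 0 = fst p \<bullet> snd (s p) + ?u p" for p
    by (simp add: a_def h_eq inner_add_left oct_real_part_mult_cnj)
  have \<mu>p: "real_polynomial_function \<mu>"
    unfolding \<mu>_def[abs_def] h_eq fst_conv
    by (intro real_polynomial_function_diff real_polynomial_function_inner pf pxy)
  have \<alpha>p: "real_polynomial_function ?u" by (intro real_polynomial_function_inner pf pxy)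
  have \<beta>p: "real_polynomial_function (\<lambda>p. - (fst p \<bullet> snd (s p)))"
    by (intro real_polynomial_function_minus real_polynomial_function_inner pf pxy)
  \<comment> \<open>The real part of \<open>xy\<close>: modulo the two squares, \<mu> is annihilated
    by the inner product of x and y.\<close>
  have "\<mu> p * (fst p \<bullet> snd p) = ?u p * (fst p \<bullet> fst p) + (- (fst p \<bullet> snd (s p))) * (snd p \<bullet> snd p)" for p
    using arg_cong[OF xy[of p], of "\<lambda>z. z \<bullet> oct_basis 0"] inner_self_eq[of p]
    by (simp add: inner_add_left oct_real_part_mult_cnj a0 algebra_simps)
  then obtain \<alpha> \<beta> where \<alpha>\<beta>: "real_polynomial_function \<alpha>" "real_polynomial_function \<beta>"
    "\<And>p. \<mu> p = \<alpha> p * (fst p \<bullet> fst p) + \<beta> p * (snd p \<bullet> snd p)"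
    using inner_not_zero_divisor_mod_squares[OF \<mu>p \<alpha>p \<beta>p] by metis
  have sm: "smooth_on UNIV \<alpha>" "smooth_on UNIV \<beta>" "smooth_on UNIV a"
    using \<alpha>\<beta>(1,2) smooth_on_polynomial_function[OF _ open_UNIV]
    unfolding a_def[abs_def] by (auto simp: real_polynomial_function_eq intro!: smooth_intros ss)
  \<comment> \<open>With this choice the diagonal entries of h s + d2 t become \<alpha> |p|^2 and
    -\<beta> |p|^2.\<close>
  define t where "t p = \<beta> p - \<alpha> p" for p
  let ?q = "\<lambda>p::oct2. fst p \<odot> oct_cnj (snd p)"
  \<comment> \<open>By \<open>xy\<close> the octonionic entry a + t x (cnj y) of h s + d2 t
    satisfies |y|^2 (a + t x (cnj y)) = |p|^2 F. With G the difference of this entry and F, this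
    says |x|^2 F = |y|^2 G.\<close>
  let ?F = "\<lambda>p. fst (s p) \<odot> oct_cnj (snd p) - \<alpha> p *\<^sub>R ?q p"
  let ?G = "\<lambda>p. a p + t p *\<^sub>R ?q p - ?F p"
  have FG: "(norm x)\<^sup>2 *\<^sub>R ?F (x, y) = (norm y)\<^sup>2 *\<^sub>R ?G (x, y)" for x y
  proof -
    let ?p = "(x, y)"
    have "(y \<bullet> y) *\<^sub>R (a ?p + t ?p *\<^sub>R ?q ?p) = (x \<bullet> x + y \<bullet> y) *\<^sub>R ?F ?p"
      using xy[of ?p] by (simp add: inner_self_eq \<alpha>\<beta>(3) t_def algebra_simps)
    then show ?thesis by (simp add: power2_norm_eq_inner algebra_simps)
  qed
  have sF: "smooth_on UNIV ?F" "smooth_on UNIV ?G"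
    unfolding t_def by (intro smooth_intros sm ss open_UNIV)+
  obtain b where b: "smooth_on UNIV b" "\<And>x y. ?F (x, y) = (norm y)\<^sup>2 *\<^sub>R b (x, y)" "\<And>x y. ?G (x, y) = (norm x)\<^sup>2 *\<^sub>R b (x, y)"
    using smooth_common_quotient[OF open_UNIV sF FG] by (metis UNIV_I)
  have ab: "a p + t p *\<^sub>R ?q p = (p \<bullet> p) *\<^sub>R b p" for p
    using b(2)[of "fst p" "snd p"] b(3)[of "fst p" "snd p"]
    by (simp add: inner_self_eq power2_norm_eq_inner algebra_simps)
  define r where "r p = (\<alpha> p, b p, - \<beta> p)" for p
  have rs: "smooth_on UNIV r" unfolding r_def by (intro smooth_intros sm b open_UNIV)
  have r: "(p \<bullet> p) *\<^sub>R r p = (\<mu> p, a p, - \<mu> p) + OH_d2 p (t p)" for p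
  proof -
    have "OH_d2 p (t p) = (- ((snd p \<bullet> snd p) * t p), t p *\<^sub>R ?q p, - ((fst p \<bullet> fst p) * t p))"
      by (cases p) (simp add: power2_norm_eq_inner)
    then show ?thesis using ab[of p] by (simp add: r_def t_def \<alpha>\<beta>(3) inner_self_eq algebra_simps)
  qed
  have sc: "(p \<bullet> p) *\<^sub>R OH_d1 p (r p) = (p \<bullet> p) *\<^sub>R s p" for p
    using arg_cong[OF r[of p], of "OH_d1 p"] by (simp add: cl.add_left cl.scaleR_left d1_d2 d)
  have off: "OH_d1 p (r p) = s p" if "p \<noteq> 0" for p
    by (rule scaleR_left_imp_eq[OF _ sc]) (use that in simp)
  have "OH_d1 p (r p) = s p" for p
  proof (cases "p = 0")
    case True
    show ?thesis
      unfolding True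
      by (rule continuous_on_eq_at_limit[OF open_UNIV continuous_on_OH_d1[OF open_UNIV rs] smooth_onD(4)[OF ss]])
        (use off in auto)
  qed (rule off)
  then show ?thesis using that rs by blast
qed

subsection \<open>Smooth exactness\<close>

lemma exact_at_E0:
  assumes U: "open U" and w: "smooth_on U w" and \<rho>: "\<And>p. p \<in> U \<Longrightarrow> OH_rho0 p (w p) = 0"
  obtains r where "smooth_on U r" "\<And>p. p \<in> U \<Longrightarrow> OH_d1 p (r p) = w p"
proof (cases "0 \<in> U")
  case False
  \<comment> \<open>Away from the origin the homotopy can be divided by |p|^2 directly.\<close>
  let ?r = "\<lambda>p. inverse ((norm p)\<^sup>2) *\<^sub>R OH_h p (w p)"
  have "smooth_on U ?r" by (intro smooth_intros smooth_on_inverse U w) (use False in auto)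
  moreover have "OH_d1 p (?r p) = w p" if "p \<in> U" for p
  proof -
    have "p \<noteq> 0" using that False by auto
    then show ?thesis
      using d1_h[of p "w p"] \<rho>[OF that] by (simp add: cl.scaleR_left power2_norm_eq_inner)
  qed
  ultimately show ?thesis using that by blast
next
  case U0: True
  define sk where "sk n = taylor_part n w" for n
  \<comment> \<open>The anchor is homogeneous of degree 2 in the base point, so w takes values in
    the kernel of \<open>OH_rho0 p\<close> along the whole ray through p, and so do its Taylor
    components at p.\<close>
  have \<rho>sk: "OH_rho0 p (sk n p) = 0" for n p
  proof -
    have "bounded_linear (OH_rho0 p)"
      by (rule linear_conv_bounded_linear[THEN iffD1]) (simp add: linear_iff OH_rho0_linear_simps)
    moreover have "OH_rho0 p (w (c *\<^sub>R p)) = c ^ 0 *\<^sub>R 0" if c: "c > 0" "c *\<^sub>R p \<in> U" for c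
    proof -
      have "OH_rho0 (c *\<^sub>R p) v = c\<^sup>2 *\<^sub>R OH_rho0 p v" for v
        by (simp add: OH_rho0_eq herm_sq.scaleR_left herm_sq.scaleR_right cl.scaleR_left power2_eq_square algebra_simps)
      then show ?thesis using \<rho>[OF c(2)] c(1) by simp
    qed
    ultimately show ?thesis
      using taylor_part_of_homogeneous_ray[OF U U0 w, of "OH_rho0 p" p 0 0 n] by (simp add: sk_def)
  qed
  have "\<exists>r. smooth_on UNIV r \<and> (\<forall>p. OH_d1 p (r p) = sk n p)" for n
    using polynomial_exactness[OF polynomial_taylor_part[OF U U0 w] \<rho>sk[unfolded sk_def]] unfolding sk_def by metis
  then obtain R where R: "\<And>n. smooth_on UNIV (R n)" "\<And>n p. OH_d1 p (R n p) = sk n p" by metis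
  \<comment> \<open>The primitive \<open>R (Suc n)\<close> is known only to be smooth. As d1 is
    linear in the base point, its component of degree n alone is a primitive of
    \<open>sk (Suc n)\<close>, and it is polynomial and homogeneous as Borel's lemma
    requires.\<close>
  define rk where "rk n = taylor_part n (R (Suc n))" for n
  \<comment> \<open>A cycle has no constant term, because d1 is zero at the origin; so the index
    shift between \<open>rk\<close> and \<open>sk\<close> loses nothing.\<close>
  have sk0: "sk 0 p = 0" for p
    using R(2)[of 0 0] by (simp add: sk_def taylor_part_def cl.zero_right)
  have d1rk: "OH_d1 p (rk n p) = sk (Suc n) p" for n p
  proof -
    have ray: "OH_d1 p (R (Suc n) (c *\<^sub>R p)) = c ^ n *\<^sub>R sk (Suc n) p" if "c > 0" for c
    proof -
      have "c *\<^sub>R OH_d1 p (R (Suc n) (c *\<^sub>R p)) = c *\<^sub>R (c ^ n *\<^sub>R sk (Suc n) p)"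
        using R(2)[of "c *\<^sub>R p" "Suc n"] taylor_part_homogeneous[OF U U0 w, of "Suc n" c p]
        by (simp add: sk_def cl.scaleR_right)
      then show ?thesis by (rule scaleR_left_imp_eq[rotated]) (use that in simp)
    qed
    have "OH_d1 p (taylor_part n (R (Suc n)) p) = (if n = n then sk (Suc n) p else 0)"
      by (rule taylor_part_of_homogeneous_ray[where L = "OH_d1 p", OF open_UNIV UNIV_I R(1) cl.bounded_linear_left])
        (rule ray)
    then show ?thesis by (simp add: rk_def)
  qed
  have rks: "smooth_on UNIV (rk n)" for n
    unfolding rk_def by (intro smooth_on_polynomial_function polynomial_taylor_part[OF open_UNIV UNIV_I R(1)] open_UNIV)
  have rkh: "rk n (c *\<^sub>R p) = c ^ n *\<^sub>R rk n p" for n c p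
    unfolding rk_def by (rule taylor_part_homogeneous[OF open_UNIV UNIV_I R(1)])
  obtain f where f: "smooth_on UNIV f"
    "\<And>N. \<exists>C e. e > 0 \<and> (\<forall>p. norm p < e \<longrightarrow> norm (f p - (\<Sum>k<N. rk k p)) \<le> C * norm p ^ N)"
    using borel_homogeneous[OF rks rkh] by blast
  have fU: "smooth_on U f" using f(1) smooth_on_subset by blast
  define w' where "w' p = w p - OH_d1 p (f p)" for p
  have w's: "smooth_on U w'" unfolding w'_def by (intro smooth_intros U w fU)
  obtain K where K: "K > 0" "\<And>e p. norm (OH_d1 p e) \<le> norm p * norm e * K"
    using cl.pos_bounded by (metis mult.commute)
  have "flat_at_0 w'"
    unfolding flat_at_0_def
  proof
    fix N
    obtain C r where C: "C \<ge> 0" "r > 0" "\<And>p. norm p \<le> r \<Longrightarrow> norm (w p - (\<Sum>j<Suc N. sk j p)) \<le> C * norm p ^ Suc N"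
      using taylor_part_remainder[OF U U0 w, of "Suc N"] unfolding sk_def by metis
    obtain C' e where C': "e > 0" "\<And>p. norm p < e \<Longrightarrow> norm (f p - (\<Sum>k<N. rk k p)) \<le> C' * norm p ^ N"
      using f(2) by metis
    have "norm (w' p) \<le> (C + C' * K) * norm p ^ N" if p: "norm p < min 1 (min r e)" for p
    proof -
      \<comment> \<open>N terms of f match N + 1 Taylor components of w, so both remainders are of
        order N + 1 once d1 contributes its factor \<open>norm p\<close>.\<close>
      have "OH_d1 p (\<Sum>k<N. rk k p) = (\<Sum>j<Suc N. sk j p)"
        unfolding sum.lessThan_Suc_shift by (simp add: cl.sum_left d1rk sk0)
      then have "w' p = (w p - (\<Sum>j<Suc N. sk j p)) - OH_d1 p (f p - (\<Sum>k<N. rk k p))"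
        by (simp add: w'_def cl.diff_left)
      then have "norm (w' p) \<le> norm (w p - (\<Sum>j<Suc N. sk j p)) + norm (OH_d1 p (f p - (\<Sum>k<N. rk k p)))"
        by (simp only: norm_triangle_ineq4)
      also have "\<dots> \<le> C * norm p ^ Suc N + norm p * (C' * norm p ^ N) * K"
      proof (intro add_mono)
        show "norm (w p - (\<Sum>j<Suc N. sk j p)) \<le> C * norm p ^ Suc N" using C(3)[of p] p by simp
        have "norm p * norm (f p - (\<Sum>k<N. rk k p)) * K \<le> norm p * (C' * norm p ^ N) * K"
          using C'(2)[of p] p K(1) by (intro mult_right_mono mult_left_mono) auto
        then show "norm (OH_d1 p (f p - (\<Sum>k<N. rk k p))) \<le> norm p * (C' * norm p ^ N) * K"
          using K(2) order_trans by blast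
      qed
      also have "\<dots> = norm p * ((C + C' * K) * norm p ^ N)" by (simp add: algebra_simps)
      also have "\<dots> \<le> 1 * ((C + C' * K) * norm p ^ N)"
      proof (rule mult_right_mono)
        have "0 \<le> C' * norm p ^ N" using order_trans[OF norm_ge_zero C'(2)[of p]] p by simp
        then have "0 \<le> C' * norm p ^ N * K" using K(1) by simp
        then show "0 \<le> (C + C' * K) * norm p ^ N" using C(1) by (simp add: algebra_simps)
      qed (use p in simp)
      finally show ?thesis by simp
    qed
    then show "\<exists>C e. e > 0 \<and> (\<forall>p. norm p < e \<longrightarrow> norm (w' p) \<le> C * norm p ^ N)"
      using C(2) C'(1) by (intro exI[of _ "C + C' * K"] exI[of _ "min 1 (min r e)"]) auto
  qed
  then have "flat_at_0 (\<lambda>p. OH_h p (w' p))"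
    by (rule flat_at_0_bilinear[OF bounded_bilinear_OH_h]) simp
  moreover have "smooth_on U (\<lambda>p. OH_h p (w' p))" by (intro smooth_intros U w's)
  moreover have "DIM(oct2) \<ge> 2" by simp
  ultimately obtain g where g: "smooth_on U g" "\<And>p. p \<in> U \<Longrightarrow> OH_h p (w' p) = (norm p)\<^sup>2 *\<^sub>R g p"
    using flat_at_0_divide_norm_power2[OF _ U U0, of "\<lambda>p. OH_h p (w' p)"] by blast
  have \<rho>w': "OH_rho0 p (w' p) = 0" if "p \<in> U" for p
    using \<rho>[OF that] by (simp add: w'_def OH_rho0_linear_simps rho_d1)
  have sc: "(p \<bullet> p) *\<^sub>R OH_d1 p (g p) = (p \<bullet> p) *\<^sub>R w' p" if "p \<in> U" for p
    using d1_h[of p "w' p"] g(2)[OF that] \<rho>w'[OF that] by (simp add: cl.scaleR_left power2_norm_eq_inner)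
  have off: "OH_d1 p (g p) = w' p" if "p \<in> U - {0}" for p
    by (rule scaleR_left_imp_eq[OF _ sc]) (use that in auto)
  have "OH_d1 p (g p) = w' p" if "p \<in> U" for p
  proof (cases "p = 0")
    case True
    show ?thesis
      unfolding True
      by (rule continuous_on_eq_at_limit[OF U continuous_on_OH_d1[OF U g(1)] smooth_onD(4)[OF w's] U0 off])
  qed (use off that in auto)
  then have "OH_d1 p (f p + g p) = w p" if "p \<in> U" for p
    using that by (simp add: cl.add_left w'_def)
  moreover have "smooth_on U (\<lambda>p. f p + g p)" by (intro smooth_intros U fU g)
  ultimately show ?thesis using that by blast
qed

text \<open>For a cycle the homotopy says that |p|^2 e = - d2 (tr e). Comparing the diagonal entries
  gives |x|^2 \<mu> = |y|^2 \<nu>, and the common quotient is, up to the sign in d2, the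
  primitive.\<close>

lemma exact_at_E1:
  assumes U: "open U" and e: "smooth_on U e" and d: "\<And>p. p \<in> U \<Longrightarrow> OH_d1 p (e p) = 0"
  obtains t where "smooth_on U t" "\<And>p. p \<in> U \<Longrightarrow> OH_d2 p (t p) = e p"
proof -
  have h: "(p \<bullet> p) *\<^sub>R e p = - OH_d2 p (herm_tr (e p))" if "p \<in> U" for p
    using h_d1[of p "e p"] d[OF that] by (simp add: OH_h_def herm_sq.zero_right eq_neg_iff_add_eq_0)
      (simp add: zero_prod_def)
  have n: "(norm x)\<^sup>2 * fst (e (x, y)) = (norm y)\<^sup>2 * snd (snd (e (x, y)))" if "(x, y) \<in> U" for x y
  proof -
    have "(x \<bullet> x + y \<bullet> y) * fst (e (x, y)) = (y \<bullet> y) * (fst (e (x, y)) + snd (snd (e (x, y))))"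
      using arg_cong[OF h[OF that], of fst] by (simp add: inner_prod_def herm_tr_def power2_norm_eq_inner)
    then show ?thesis by (simp add: power2_norm_eq_inner algebra_simps)
  qed
  have s: "smooth_on U (\<lambda>p. fst (e p))" "smooth_on U (\<lambda>p. snd (snd (e p)))" by (intro smooth_intros U e)+
  obtain t where t: "smooth_on U t" "\<And>x y. (x, y) \<in> U \<Longrightarrow> fst (e (x, y)) = (norm y)\<^sup>2 *\<^sub>R t (x, y)"
    "\<And>x y. (x, y) \<in> U \<Longrightarrow> snd (snd (e (x, y))) = (norm x)\<^sup>2 *\<^sub>R t (x, y)"
    using smooth_common_quotient[OF U s] n by (metis real_scaleR_def)
  have ts: "smooth_on U (\<lambda>p. - t p)" by (intro smooth_intros U t)
  have off: "OH_d2 p (- t p) = e p" if p: "p \<in> U - {0}" for p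
  proof -
    have "herm_tr (e p) = (p \<bullet> p) * t p"
      using t(2,3)[of "fst p" "snd p"] p by (simp add: herm_tr_def inner_self_eq power2_norm_eq_inner algebra_simps)
    then have "(p \<bullet> p) *\<^sub>R e p = (p \<bullet> p) *\<^sub>R OH_d2 p (- t p)"
      using h[of p] p by (simp add: OH_d2_eq)
    then show ?thesis using p by simp
  qed
  have "OH_d2 p (- t p) = e p" if "p \<in> U" for p
  proof (cases "p = 0")
    case True
    have "continuous_on U (\<lambda>p. (- (1/2) * (- t p)) *\<^sub>R herm_sq p p)"
      by (rule smooth_onD(4), intro smooth_intros U t)
    then have "continuous_on U (\<lambda>p. OH_d2 p (- t p))" by (simp add: OH_d2_eq)
    from continuous_on_eq_at_limit[OF U this smooth_onD(4)[OF e] _ off] show ?thesis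
      using that True by simp
  qed (use off that in auto)
  then show ?thesis using that[OF ts] by blast
qed

text \<open>The trace of d2 t is -|p|^2 t, so d2 is injective off the origin; continuity covers the
  origin.\<close>

lemma exact_at_E2:
  assumes U: "open U" and t: "smooth_on U t" and d: "\<And>p. p \<in> U \<Longrightarrow> OH_d2 p (t p) = 0" and p: "p \<in> U"
  shows "t p = 0"
proof (cases "p = 0")
  case False
  then show ?thesis using herm_tr_d2[of p "t p"] d[OF p] linear_0[OF linear_herm_tr] by simp
next
  case True
  have "t q = 0" if "q \<in> U - {0}" for q
    using herm_tr_d2[of q "t q"] d[of q] that linear_0[OF linear_herm_tr] by simp
  from continuous_on_eq_at_limit[OF U smooth_onD(4)[OF t] continuous_on_const p[unfolded True] this]
  show ?thesis using True by simp
qed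

section \<open>The singular octonionic Hopf foliation\<close>

lemma smooth_on_locally:
  assumes "\<And>p. p \<in> U \<Longrightarrow> \<exists>W. open W \<and> p \<in> W \<and> smooth_on W f"
  shows "smooth_on U f"
proof -
  have "Ck_on k U f" if "\<And>p. p \<in> U \<Longrightarrow> \<exists>W. open W \<and> p \<in> W \<and> Ck_on k W f" for k
    using that
  proof (induction k arbitrary: f)
    case 0
    then have "isCont f p" if "p \<in> U" for p
      using that continuous_on_eq_continuous_at by fastforce
    then show ?case by (simp add: continuous_at_imp_continuous_on)
  next
    case (Suc k)
    have "f differentiable (at p)" if "p \<in> U" for p using Suc.prems[OF that] by auto
    moreover have "Ck_on k U (dder h f)" for h
      by (rule Suc.IH) (use Suc.prems in force)
    ultimately show ?case by simp
  qed
  then show ?thesis using assms unfolding smooth_on_def by blast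
qed

lemma in_E0_section: "smooth_on U w \<Longrightarrow> open U \<Longrightarrow> (\<lambda>p. in_E0 (w p)) \<in> sections U (OH_E 0)"
  by (auto simp: sections_def mem_OH_E intro!: smooth_intros)

text \<open>Off the origin \<open>X / \<bar>p\<bar>\<^sup>2\<close> is a preimage of \<open>X\<close>, by \<open>rho_rho\<close>.\<close>

lemma F_OH_iff:
  assumes U: "open U"
  shows "X \<in> F_OH U \<longleftrightarrow> (\<exists>w. smooth_on U w \<and> (\<forall>p\<in>U. X p = OH_rho0 p (w p)))"
proof
  assume X: "X \<in> F_OH U"
  have loc: "\<exists>W w. open W \<and> p \<in> W \<and> W \<subseteq> U \<and> smooth_on UNIV w \<and> (\<forall>q\<in>W. X q = OH_rho0 q (w q))" if pU: "p \<in> U" for p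
  proof -
    obtain W e where W: "open W" "p \<in> W" "W \<subseteq> U" "e \<in> sections UNIV (OH_E 0)" "\<forall>q\<in>W. X q = OH_rho q (e q)"
      using bspec[OF X[unfolded F_OH_def generated_foliation_def mem_Collect_eq] pU] by blast
    have "smooth_on UNIV (\<lambda>p. fst (e p))" using sections_OH_ED(1)[OF W(4)] by (intro smooth_intros open_UNIV)
    moreover have "\<forall>q\<in>W. X q = OH_rho0 q (fst (e q))" using W(5) by (simp add: OH_rho_def)
    ultimately show ?thesis using W(1-3) by (intro exI[of _ W] exI[of _ "\<lambda>q. fst (e q)"]) simp
  qed
  have smX: "smooth_on U X"
  proof (rule smooth_on_locally)
    fix p assume "p \<in> U"
    from loc[OF this] obtain W w where W: "open W" "p \<in> W" "smooth_on UNIV w" "\<forall>q\<in>W. X q = OH_rho0 q (w q)"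
      by blast
    have "smooth_on W (\<lambda>q. OH_rho0 q (w q))"
      by (intro smooth_intros W smooth_on_subset[OF W(3)]) simp
    then have "smooth_on W X" using smooth_on_cong[OF W(1), of X "\<lambda>q. OH_rho0 q (w q)"] W(4) by simp
    then show "\<exists>W. open W \<and> p \<in> W \<and> smooth_on W X" using W by blast
  qed
  have \<rho>X: "OH_rho0 p (X p) = (p \<bullet> p) *\<^sub>R X p" if pU: "p \<in> U" for p
  proof -
    obtain w where "X p = OH_rho0 p (w p)" using loc[OF pU] by blast
    then show ?thesis by (simp add: rho_rho)
  qed
  have off: "OH_rho0 p (inverse ((norm p)\<^sup>2) *\<^sub>R Y) = Y" if "OH_rho0 p Y = (p \<bullet> p) *\<^sub>R Y" "p \<noteq> 0" for p Y
    using that by (simp add: OH_rho0_linear_simps power2_norm_eq_inner)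
  show "\<exists>w. smooth_on U w \<and> (\<forall>p\<in>U. X p = OH_rho0 p (w p))"
  proof (cases "0 \<in> U")
    case False
    have "smooth_on U (\<lambda>p. inverse ((norm p)\<^sup>2) *\<^sub>R X p)"
      by (intro smooth_intros smooth_on_inverse U smX) (use False in auto)
    moreover have "X p = OH_rho0 p (inverse ((norm p)\<^sup>2) *\<^sub>R X p)" if "p \<in> U" for p
      using off[OF \<rho>X[OF that]] that False by force
    ultimately show ?thesis by blast
  next
    case True
    then obtain W w where W: "open W" "0 \<in> W" "W \<subseteq> U" "smooth_on UNIV w" "\<forall>q\<in>W. X q = OH_rho0 q (w q)"
      using loc[OF True] by blast
    \<comment> \<open>Subtracting a local representation near the origin makes the remaining field
      vanish on W. Its quotient by |p|^2 is then zero on W and glues with the quotient off the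
      origin.\<close>
    let ?Y = "\<lambda>p. X p - OH_rho0 p (w p)" and ?g = "\<lambda>p. inverse ((norm p)\<^sup>2) *\<^sub>R (X p - OH_rho0 p (w p))"
    have wU: "smooth_on V w" for V using W(4) smooth_on_subset by blast
    have "open (U - {0})" using U by auto
    then have "smooth_on (U - {0}) ?g"
      by (intro smooth_intros smooth_on_inverse wU smooth_on_subset[OF smX]) auto
    moreover have "smooth_on W ?g"
      by (subst smooth_on_cong[OF W(1), of _ "\<lambda>_. 0"]) (use W(5) in \<open>auto intro: smooth_on_const\<close>)
    ultimately have "smooth_on ((U - {0}) \<union> W) ?g"
      using U W(1) by (intro smooth_on_union) auto
    moreover have "(U - {0}) \<union> W = U" using W by auto
    ultimately have gs: "smooth_on U ?g" by simp
    have "X p = OH_rho0 p (w p + ?g p)" if p: "p \<in> U" for p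
    proof (cases "p = 0")
      case True
      then show ?thesis using W by (simp add: OH_rho0_linear_simps)
    next
      case False
      have "OH_rho0 p (?Y p) = (p \<bullet> p) *\<^sub>R ?Y p"
        using \<rho>X[OF p] by (simp add: OH_rho0_linear_simps rho_rho scaleR_diff_right)
      from off[OF this False] show ?thesis by (simp add: OH_rho0_linear_simps(1))
    qed
    moreover have "smooth_on U (\<lambda>p. w p + ?g p)" by (rule smooth_on_add[OF U wU gs])
    ultimately show ?thesis by blast
  qed
next
  assume "\<exists>w. smooth_on U w \<and> (\<forall>p\<in>U. X p = OH_rho0 p (w p))"
  then obtain w where w: "smooth_on U w" "\<And>p. p \<in> U \<Longrightarrow> X p = OH_rho0 p (w p)" by blast
  show "X \<in> F_OH U"
    unfolding F_OH_def generated_foliation_def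
  proof (intro CollectI ballI)
    fix p assume p: "p \<in> U"
    obtain W \<beta> where W: "open W" "p \<in> W" "W \<subseteq> U" "\<And>q. q \<in> W \<Longrightarrow> \<beta> q = (1::real)"
        "smooth_on UNIV (\<lambda>q. if q \<in> U then \<beta> q *\<^sub>R w q else 0)"
      by (rule smooth_local_extension[OF U p w(1)]) (rule that, assumption+)
    let ?e = "\<lambda>q. in_E0 (if q \<in> U then \<beta> q *\<^sub>R w q else 0)"
    have "?e \<in> sections UNIV (OH_E 0)" by (rule in_E0_section[OF W(5) open_UNIV])
    moreover have "\<forall>q\<in>W. X q = OH_rho q (?e q)"
    proof
      fix q assume q: "q \<in> W"
      then have "q \<in> U" using W(3) by (rule rev_subsetD)
      then show "X q = OH_rho q (?e q)" by (simp add: OH_rho_in_E0 W(4)[OF q] w(2))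
    qed
    ultimately show "\<exists>W. open W \<and> p \<in> W \<and> W \<subseteq> U \<and> (\<exists>e\<in>sections UNIV (OH_E 0). \<forall>q\<in>W. X q = OH_rho q (e q))"
      using W(1-3) by (intro exI[of _ W] conjI bexI[of _ ?e])
  qed
qed

lemma F_OH_I: "open U \<Longrightarrow> smooth_on U w \<Longrightarrow> (\<And>p. p \<in> U \<Longrightarrow> X p = OH_rho0 p (w p)) \<Longrightarrow> X \<in> F_OH U"
  using F_OH_iff by blast

lemma F_OH_E:
  assumes "open U" "X \<in> F_OH U"
  obtains w where "smooth_on U w" "\<And>p. p \<in> U \<Longrightarrow> X p = OH_rho0 p (w p)"
  using assms F_OH_iff by blast

text \<open>Realises the Lie bracket of two fields of the foliation as the anchor of a section; this
  gives involutivity.\<close>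

lemma lie_bracket_rho:
  assumes U: "open U" "p \<in> U" and w: "smooth_on U w" "smooth_on U w'"
    and X: "\<And>p. p \<in> U \<Longrightarrow> X p = OH_rho0 p (w p)" and Y: "\<And>p. p \<in> U \<Longrightarrow> Y p = OH_rho0 p (w' p)"
  shows "lie_bracket X Y p = OH_rho p (OH_bracket (\<lambda>p. in_E0 (w p)) (\<lambda>p. in_E0 (w' p)) p)"
proof -
  have s: "smooth_on U (\<lambda>p. in_E0 (v p))" if "smooth_on U v" for v by (intro smooth_intros U that)
  define dr where "dr v h = OH_drho p h (fst (in_E0 (v p))) + OH_rho p (dder h (\<lambda>p. in_E0 (v p)) p)" for v h
  have D: "frechet_derivative Z (at p) h = dr v h" if v: "smooth_on U v" and Z: "\<And>p. p \<in> U \<Longrightarrow> Z p = OH_rho0 p (v p)" for Z v h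
  proof -
    have "frechet_derivative Z (at p) = frechet_derivative (\<lambda>p. OH_rho p (in_E0 (v p))) (at p)"
      by (rule frechet_derivative_cong_open[OF U]) (simp add: Z OH_rho_in_E0)
    then show ?thesis
      unfolding dr_def using dder_eqI[OF has_derivative_OH_rho[OF smooth_onD(2)[OF s[OF v] U(2)]]] by metis
  qed
  have "OH_rho p (OH_bracket (\<lambda>p. in_E0 (w p)) (\<lambda>p. in_E0 (w' p)) p)
      = dr w' (OH_rho p (in_E0 (w p))) - dr w (OH_rho p (in_E0 (w' p)))"
    by (rule anchor_bracket) (simp_all add: dr_def)
  then show ?thesis
    using D[OF w(1) X] D[OF w(2) Y] U by (simp add: lie_bracket_def X Y OH_rho_in_E0)
qed

lemma singular_foliation_F_OH: "singular_foliation F_OH"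
proof
  fix U :: "oct2 set" assume U: "open U"
  show "smooth_on U X" if X: "X \<in> F_OH U" for X
  proof -
    obtain w where w: "smooth_on U w" "\<And>p. p \<in> U \<Longrightarrow> X p = OH_rho0 p (w p)" using F_OH_E[OF U X] by blast
    have "smooth_on U (\<lambda>p. OH_rho0 p (w p))" by (intro smooth_intros U w)
    then show ?thesis using smooth_on_cong[OF U, of X "\<lambda>p. OH_rho0 p (w p)"] w(2) by simp
  qed
  show "Y \<in> F_OH U" if "X \<in> F_OH U" "\<And>p. p \<in> U \<Longrightarrow> Y p = X p" for X Y
    using that F_OH_iff[OF U] by auto
  show "X \<in> F_OH W" if "open W" "W \<subseteq> U" "X \<in> F_OH U" for W X
  proof -
    have W: "open W" "W \<subseteq> U" and X: "X \<in> F_OH U" using that by auto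
    obtain w where w: "smooth_on U w" "\<And>p. p \<in> U \<Longrightarrow> X p = OH_rho0 p (w p)" using F_OH_E[OF U X] by blast
    show ?thesis by (rule F_OH_I[OF W(1) smooth_on_subset[OF w(1) W(2)]]) (use w(2) W(2) in blast)
  qed
  show "X \<in> F_OH U" if loc: "\<And>p. p \<in> U \<Longrightarrow> \<exists>W. open W \<and> p \<in> W \<and> W \<subseteq> U \<and> X \<in> F_OH W" for X
    unfolding F_OH_def generated_foliation_def
  proof (intro CollectI ballI)
    fix p assume "p \<in> U"
    then obtain W where W: "p \<in> W" "W \<subseteq> U" "X \<in> F_OH W" using loc by blast
    obtain V where V: "open V" "p \<in> V" "V \<subseteq> W" "\<exists>e\<in>sections UNIV (OH_E 0). \<forall>q\<in>V. X q = OH_rho q (e q)"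
      using bspec[OF W(3)[unfolded F_OH_def generated_foliation_def mem_Collect_eq] W(1)] by blast
    show "\<exists>W. open W \<and> p \<in> W \<and> W \<subseteq> U \<and> (\<exists>e\<in>sections UNIV (OH_E 0). \<forall>q\<in>W. X q = OH_rho q (e q))"
      by (intro exI[of _ V] conjI V order_trans[OF V(3) W(2)])
  qed
  show "(\<lambda>_. 0) \<in> F_OH U"
    by (rule F_OH_I[OF U smooth_on_const[of U 0]]) (simp add: OH_rho0_linear_simps)
  show "(\<lambda>p. X p + Y p) \<in> F_OH U" if X: "X \<in> F_OH U" and Y: "Y \<in> F_OH U" for X Y
  proof -
    obtain w where w: "smooth_on U w" "\<And>p. p \<in> U \<Longrightarrow> X p = OH_rho0 p (w p)" using F_OH_E[OF U X] by blast
    obtain v where v: "smooth_on U v" "\<And>p. p \<in> U \<Longrightarrow> Y p = OH_rho0 p (v p)" using F_OH_E[OF U Y] by blast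
    show ?thesis
      by (rule F_OH_I[OF U smooth_on_add[OF U w(1) v(1)]]) (simp add: w v OH_rho0_linear_simps)
  qed
  show "(\<lambda>p. f p *\<^sub>R X p) \<in> F_OH U" if X: "X \<in> F_OH U" and f: "smooth_on U f" for X f
  proof -
    obtain w where w: "smooth_on U w" "\<And>p. p \<in> U \<Longrightarrow> X p = OH_rho0 p (w p)" using F_OH_E[OF U X] by blast
    show ?thesis
      by (rule F_OH_I[OF U smooth_on_scaleR[OF U f w(1)]]) (simp add: w OH_rho0_linear_simps)
  qed
  show "lie_bracket X Y \<in> F_OH U" if X: "X \<in> F_OH U" and Y: "Y \<in> F_OH U" for X Y
  proof -
    obtain w where w: "smooth_on U w" "\<And>p. p \<in> U \<Longrightarrow> X p = OH_rho0 p (w p)" using F_OH_E[OF U X] by blast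
    obtain v where v: "smooth_on U v" "\<And>p. p \<in> U \<Longrightarrow> Y p = OH_rho0 p (v p)" using F_OH_E[OF U Y] by blast
    have "smooth_on U (\<lambda>p. fst (OH_bracket (\<lambda>p. in_E0 (w p)) (\<lambda>p. in_E0 (v p)) p))"
      by (intro smooth_on_fst U smooth_on_OH_bracket smooth_intros w v)
    then show ?thesis
      by (rule F_OH_I[OF U]) (simp add: lie_bracket_rho[OF U _ w(1) v(1) w(2) v(2)] OH_rho_def)
  qed
next
  fix p :: oct2
  let ?G = "(\<lambda>b q. OH_rho0 q b) ` (Basis :: oct2 set)"
  have "?G \<subseteq> F_OH UNIV"
  proof (intro subsetI)
    fix Y assume "Y \<in> ?G"
    then obtain b where "Y = (\<lambda>q. OH_rho0 q b)" by blast
    then show "Y \<in> F_OH UNIV" by (intro F_OH_I[OF open_UNIV smooth_on_const[of UNIV b]]) simp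
  qed
  moreover have "\<exists>c. (\<forall>Y\<in>?G. smooth_on U (c Y)) \<and> (\<forall>q\<in>U. X q = (\<Sum>Y\<in>?G. c Y q *\<^sub>R Y q))"
    if U: "open U" and X: "X \<in> F_OH U" for U X
  proof -
    obtain w where w: "smooth_on U w" "\<And>p. p \<in> U \<Longrightarrow> X p = OH_rho0 p (w p)" using F_OH_E[OF U X] by blast
    \<comment> \<open>Generators are indexed by vector fields, so the coefficient of Y collects all
      basis vectors that the anchor sends to the same field.\<close>
    define c where "c Y q = (\<Sum>b | b \<in> Basis \<and> (\<lambda>q. OH_rho0 q b) = Y. w q \<bullet> b)" for Y :: "oct2 \<Rightarrow> oct2" and q
    have "smooth_on U (c Y)" for Y
      unfolding c_def[abs_def] by (intro smooth_intros U w)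
    moreover have "X q = (\<Sum>Y\<in>?G. c Y q *\<^sub>R Y q)" if q: "q \<in> U" for q
    proof -
      have l: "linear (OH_rho0 q)" by (simp add: linear_iff OH_rho0_linear_simps)
      have "X q = OH_rho0 q (\<Sum>b\<in>Basis. (w q \<bullet> b) *\<^sub>R b)" by (simp only: euclidean_representation w(2)[OF q])
      also have "\<dots> = (\<Sum>b\<in>Basis. (w q \<bullet> b) *\<^sub>R OH_rho0 q b)" by (simp add: linear_sum[OF l] linear_scale[OF l])
      also have "\<dots> = (\<Sum>Y\<in>?G. \<Sum>b | b \<in> Basis \<and> (\<lambda>q. OH_rho0 q b) = Y. (w q \<bullet> b) *\<^sub>R OH_rho0 q b)"
        by (rule sum.group[symmetric]) auto
      also have "\<dots> = (\<Sum>Y\<in>?G. c Y q *\<^sub>R Y q)"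
        unfolding c_def scaleR_sum_left by (intro sum.cong) auto
      finally show ?thesis .
    qed
    ultimately show ?thesis by blast
  qed
  ultimately show "\<exists>W G. open W \<and> p \<in> W \<and> finite G \<and> G \<subseteq> F_OH W \<and>
    (\<forall>U X. open U \<and> U \<subseteq> W \<and> X \<in> F_OH U \<longrightarrow>
      (\<exists>c. (\<forall>Y\<in>G. smooth_on U (c Y)) \<and> (\<forall>q\<in>U. X q = (\<Sum>Y\<in>G. c Y q *\<^sub>R Y q))))"
    by (intro exI[of _ UNIV] exI[of _ ?G]) auto
qed

lemma geometric_resolution_OH: "geometric_resolution OH_E OH_d OH_rho F_OH"
proof (intro geometric_resolution.intro geometric_resolution_axioms.intro singular_foliation_F_OH graded_fibre_OH_E)
  show "bundle_morphism (OH_E (Suc i)) (OH_E i) OH_d" for i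
    unfolding bundle_morphism_def
  proof (intro conjI allI ballI)
    show "OH_d p v \<in> OH_E i" if "v \<in> OH_E (Suc i)" for p v
      using that unfolding mem_OH_E OH_d_eq by (simp add: cl.zero_left OH_d2_eq)
    show "smooth_on UNIV (\<lambda>p. OH_d p v)" for v by (intro smooth_intros open_UNIV)
  qed (simp add: linear_add[OF linear_OH_d] linear_scale[OF linear_OH_d])
  show "bundle_morphism (OH_E 0) UNIV OH_rho"
    unfolding bundle_morphism_def by (auto simp: OH_rho_linear intro!: smooth_intros)
  show "OH_d p (OH_d p v) = 0" for p v
    by (simp add: OH_d_eq d1_d2) (simp add: OH_d2_eq zero_prod_def)
  show "OH_rho p (OH_d p v) = 0" for p v
    by (simp add: OH_rho_def OH_d_eq rho_d1)
  fix U :: "oct2 set" assume U: "open U"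
  show "X \<in> F_OH U \<longleftrightarrow> (\<exists>e\<in>sections U (OH_E 0). \<forall>p\<in>U. X p = OH_rho p (e p))" for X
  proof
    assume "X \<in> F_OH U"
    then obtain w where w: "smooth_on U w" "\<And>p. p \<in> U \<Longrightarrow> X p = OH_rho0 p (w p)" using F_OH_E[OF U] by blast
    show "\<exists>e\<in>sections U (OH_E 0). \<forall>p\<in>U. X p = OH_rho p (e p)"
      by (rule bexI[OF _ in_E0_section[OF w(1) U]]) (simp add: w OH_rho_in_E0)
  next
    assume "\<exists>e\<in>sections U (OH_E 0). \<forall>p\<in>U. X p = OH_rho p (e p)"
    then obtain e where e: "smooth_on U e" "\<And>p. p \<in> U \<Longrightarrow> X p = OH_rho p (e p)" by (auto simp: sections_def)
    show "X \<in> F_OH U" by (rule F_OH_I[OF U smooth_on_fst[OF U e(1)]]) (simp add: e OH_rho_def)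
  qed
  show "\<exists>r\<in>sections U (OH_E 1). \<forall>p\<in>U. s p = OH_d p (r p)"
    if s: "s \<in> sections U (OH_E 0)" and \<rho>: "\<And>p. p \<in> U \<Longrightarrow> OH_rho p (s p) = 0" for s
  proof -
    have s': "smooth_on U s" "\<And>p. p \<in> U \<Longrightarrow> snd (s p) = 0" using s by (auto simp: sections_def mem_OH_E prod_eq_iff)
    have \<rho>0: "OH_rho0 p (fst (s p)) = 0" if "p \<in> U" for p using \<rho>[OF that] by (simp add: OH_rho_def)
    obtain r where r: "smooth_on U r" "\<And>p. p \<in> U \<Longrightarrow> OH_d1 p (r p) = fst (s p)"
      using exact_at_E0[OF U smooth_on_fst[OF U s'(1)] \<rho>0] by blast
    have "smooth_on U (\<lambda>p. (0, r p, 0))" by (intro smooth_intros U r)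
    then have "(\<lambda>p. (0, r p, 0)) \<in> sections U (OH_E 1)" by (simp add: sections_def mem_OH_E)
    moreover have "s p = OH_d p (0, r p, 0)" if "p \<in> U" for p
    proof -
      have "s p = (OH_d1 p (r p), 0)" using r(2)[OF that] s'(2)[OF that] by (metis prod.collapse)
      then show ?thesis by (simp add: OH_d_eq OH_d2_eq zero_prod_def)
    qed
    ultimately show ?thesis by (intro bexI[of _ "\<lambda>p. (0, r p, 0)"] ballI)
  qed
  show "\<exists>r\<in>sections U (OH_E (Suc (Suc i))). \<forall>p\<in>U. s p = OH_d p (r p)"
    if s: "s \<in> sections U (OH_E (Suc i))" and d: "\<And>p. p \<in> U \<Longrightarrow> OH_d p (s p) = 0" for i s
  proof -
    have sm: "smooth_on U s" and m: "\<And>p. p \<in> U \<Longrightarrow> s p \<in> OH_E (Suc i)" using s by (auto simp: sections_def)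
    have d12: "OH_d1 p (fst (snd (s p))) = 0" "OH_d2 p (snd (snd (s p))) = 0" if "p \<in> U" for p
      using d[OF that] by (simp_all add: OH_d_eq prod_eq_iff)
    show ?thesis
    \<comment> \<open>Only i = 0 needs a primitive. For i = 1 the cycle is zero by injectivity of
      d2, and for larger i its values lie in the zero fibre.\<close>
    proof (cases "i = 0")
      case True
      obtain t where t: "smooth_on U t" "\<And>p. p \<in> U \<Longrightarrow> OH_d2 p (t p) = fst (snd (s p))"
        using exact_at_E1[OF U smooth_on_fst[OF U smooth_on_snd[OF U sm]] d12(1)] by blast
      have "smooth_on U (\<lambda>p. (0, 0, t p))" by (intro smooth_intros U t)
      then have "(\<lambda>p. (0, 0, t p)) \<in> sections U (OH_E (Suc (Suc i)))" using True by (simp add: sections_def mem_OH_E)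
      moreover have "s p = OH_d p (0, 0, t p)" if "p \<in> U" for p
      proof -
        have "fst (s p) = 0" "snd (snd (s p)) = 0" using m[OF that] True by (simp_all add: mem_OH_E)
        then have "s p = (0, OH_d2 p (t p), 0)" using t(2)[OF that] by (metis prod.collapse)
        then show ?thesis by (simp add: OH_d_eq cl.zero_left)
      qed
      ultimately show ?thesis by (intro bexI[of _ "\<lambda>p. (0, 0, t p)"] ballI)
    next
      case False
      have "snd (snd (s p)) = 0" if "p \<in> U" for p
        by (rule exact_at_E2[OF U smooth_on_snd[OF U smooth_on_snd[OF U sm]] d12(2) that])
      then have "s p = 0" if "p \<in> U" for p
        using m[OF that] that False by (simp add: mem_OH_E prod_eq_iff)
      moreover have "(\<lambda>_. 0) \<in> sections U (OH_E (Suc (Suc i)))"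
        by (simp add: sections_def smooth_on_const mem_OH_E)
      moreover have "OH_d p 0 = 0" for p by (rule linear_0[OF linear_OH_d])
      ultimately show ?thesis by (intro bexI[of _ "\<lambda>_. 0"]) auto
    qed
  qed
qed

text \<open>The map d1 is linear and d2 quadratic in the base point.\<close>

lemma minimal_at_OH: "minimal_at OH_E OH_d 0"
  unfolding minimal_at_def
  by (auto simp: OH_d_eq OH_d2_eq cl.zero_right herm_sq.zero_right) (simp add: zero_prod_def)

lemma linear_part_OH_l: "linear_part OH_l = OH_d"
  by (simp add: linear_part_def fun_eq_iff)

theorem proposition6p10:
  "lie_n_algebroid 3 OH_E OH_l OH_rho \<and>
   universal_lie_n_algebroid 3 OH_E OH_l OH_rho F_OH \<and>
   minimal_at OH_E (linear_part OH_l) 0"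
  using OH_lie_3_algebroid geometric_resolution_OH minimal_at_OH
  by (simp add: universal_lie_n_algebroid_def linear_part_OH_l)

end
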